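(* There are natural transformations (1) $\mathrm{pr}_{\mathrm{R}}$ from $U_{\mathrm{R}}$ to $Q_{\mathrm{R}}$, (2) $\mathrm{pr}_{\mathrm{G}}$ from $U_{\mathrm{G}}$ to $Q_{\mathrm{G}}$, (3) $\mathrm{pr}_{\mathrm{S}}$ from $U_{\mathrm{S}}$ to $Q_{\mathrm{S}}$, (4) $\alpha$ from $Q_{\mathrm{R}}$ to $Q_{\mathrm{G}}\circ(\cdot)^{\natural}$, and (5) $\beta$ from $Q_{\mathrm{R}}\circ(\cdot)^{\flat}$ to $Q_{\mathrm{S}}$.
   Context: Hom-sets of a category are assumed pairwise disjoint. A Riguet congruence on a category $\mathsf{C}$ is a pair $\Phi=(\Phi^{\mathrm{ob}},\Phi^{\mathrm{fl}})$ where $\Phi^{\mathrm{ob}}$ is an equivalence relation on $\mathrm{Ob}(\mathsf{C})$ and $\Phi^{\mathrm{fl}}$ assigns to all $(a,a'),(b,b')\in\Phi^{\mathrm{ob}}$ a subset $\Phi^{\mathrm{fl}}_{\left(\begin{smallmatrix}a&b\\ a'&b'\end{smallmatrix}\right)}\subseteq\mathrm{Hom}_{\mathsf{C}}(a,b)\times\mathrm{Hom}_{\mathsf{C}}(a',b')$ such that: (Ra) if $(a,b)\in\Phi^{\mathrm{ob}}$, then $(\mathrm{id}_a,\mathrm{id}_b)\in\Phi^{\mathrm{fl}}_{\left(\begin{smallmatrix}a&a\\ b&b\end{smallmatrix}\right)}$; (Rb) if $f\in\mathrm{Hom}_{\mathsf{C}}(a,b)$, then $(f,f)\in\Phi^{\mathrm{fl}}_{\left(\begin{smallmatrix}a&b\\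 a&b\end{smallmatrix}\right)}$; (Rc) if $(f,f')\in\Phi^{\mathrm{fl}}_{\left(\begin{smallmatrix}a&b\\ a'&b'\end{smallmatrix}\right)}$, then $(f',f)\in\Phi^{\mathrm{fl}}_{\left(\begin{smallmatrix}a'&b'\\ a&b\end{smallmatrix}\right)}$; (Rd) if $(f,f')\in\Phi^{\mathrm{fl}}_{\left(\begin{smallmatrix}a&b\\ a'&b'\end{smallmatrix}\right)}$ and $(f',f'')\in\Phi^{\mathrm{fl}}_{\left(\begin{smallmatrix}a'&b'\\ a''&b''\end{smallmatrix}\right)}$, then $(f,f'')\in\Phi^{\mathrm{fl}}_{\left(\begin{smallmatrix}a&b\\ a''&b''\end{smallmatrix}\right)}$; (Re) if $(f,f')\in\Phi^{\mathrm{fl}}_{\left(\begin{smallmatrix}a&b\\ a'&b'\end{smallmatrix}\right)}$ and $(g,g')\in\Phi^{\mathrm{fl}}_{\left(\begin{smallmatrix}b&c\\ b'&c'\end{smallmatrix}\right)}$, then $(g\circ f,g'\circ f')\in\Phi^{\mathrm{fl}}_{\left(\begin{smallmatrix}a&c\\ a'&c'\end{smallmatrix}\right)}$; (Rf) for all $(a,a'),(b,b')\in\Phi^{\mathrm{ob}}$ and $f\in\mathrm{Hom}_{\mathsf{C}}(a,b)$ there is $f'\in\mathrm{Hom}_{\mathsf{C}}(a',b')$ with $(f,f')\in\Phi^{\mathrm{fl}}_{\left(\begin{smallmatrix}a&b\\ a'&b'\end{smallmatrix}\right)}$. The Riguet quotient $\mathsf{C}/\Phi$ is the category whose objects are the $\Phi^{\mathrm{ob}}$-classes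 $[a]$; whose morphisms from $[a]$ to $[b]$ are the classes $[f]$ of elements $f$ of $\bigcup_{a'\in[a],b'\in[b]}\mathrm{Hom}_{\mathsf{C}}(a',b')$ under the equivalence relation $\bigcup_{a',a''\in[a];\,b',b''\in[b]}\Phi^{\mathrm{fl}}_{\left(\begin{smallmatrix}a'&b'\\ a''&b''\end{smallmatrix}\right)}$; whose identities are $[\mathrm{id}_a]$; and where, for $f\colon a'\to b'$, $g\colon b''\to c'$ with $(b',b'')\in\Phi^{\mathrm{ob}}$, $[g]\circ[f]=[g\circ h]$ for any $h\colon a'\to b''$ with $(f,h)\in\Phi^{\mathrm{fl}}_{\left(\begin{smallmatrix}a'&b'\\ a'&b''\end{smallmatrix}\right)}$. The projection $P_\Phi\colon\mathsf{C}\to\mathsf{C}/\Phi$ is $a\mapsto[a]$, $f\mapsto[f]$; a functor on $\mathsf{C}$ identifying $\Phi$-related objects and $\Phi$-related morphisms factors uniquely through $P_\Phi$. Let $\mathrm{sc}(f)$, $\mathrm{tg}(f)$ be source and target, $\mathrm{Mor}(\mathsf{C})^{+}$ the set of finite nonempty sequences of morphisms of $\mathsf{C}$, $(f)$ the length-one sequence, $\curlywedge$ concatenation; for an equivalence relation $E$ on $\mathrm{Ob}(\mathsf{C})$, $\mathrm{Mor}(\mathsf{C})^{+}_{E}$ is the set of $(f_i)_{i\in m}$ with $(\mathrm{tg}(f_i),\mathrm{sc}(f_{i+1}))\in E$ for every $i\in m-1$. A generalized congruence on $\mathsf{C}$ is a pair $\Psi=(\Psi^{\mathrm{ob}},\Psi^{\mathrm{fl}})$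 where $\Psi^{\mathrm{ob}}$ is an equivalence relation on $\mathrm{Ob}(\mathsf{C})$ and $\Psi^{\mathrm{fl}}$ is an equivalence relation on $\mathrm{Mor}(\mathsf{C})^{+}_{\Psi^{\mathrm{ob}}}$ such that: (a) if $(a,b)\in\Psi^{\mathrm{ob}}$, then $((\mathrm{id}_a),(\mathrm{id}_b))\in\Psi^{\mathrm{fl}}$; (b) if $((f_i)_{i\in m},(g_j)_{j\in n})\in\Psi^{\mathrm{fl}}$, then $(\mathrm{sc}(f_0),\mathrm{sc}(g_0))\in\Psi^{\mathrm{ob}}$ and $(\mathrm{tg}(f_{m-1}),\mathrm{tg}(g_{n-1}))\in\Psi^{\mathrm{ob}}$; (c) if $\mathrm{sc}(g)=\mathrm{tg}(f)$, then $((f,g),(g\circ f))\in\Psi^{\mathrm{fl}}$; (d) if $((f_i)_{i\in m},(f'_{i'})_{i'\in m'}),((g_j)_{j\in n},(g'_{j'})_{j'\in n'})\in\Psi^{\mathrm{fl}}$ and $(\mathrm{tg}(f_{m-1}),\mathrm{sc}(g_0))\in\Psi^{\mathrm{ob}}$, then $((f_i)_{i\in m}\curlywedge(g_j)_{j\in n},(f'_{i'})_{i'\in m'}\curlywedge(g'_{j'})_{j'\in n'})\in\Psi^{\mathrm{fl}}$. $\Psi$ is strong if, for all $(a,a'),(b,b')\in\Psi^{\mathrm{ob}}$ and $f\in\mathrm{Hom}_{\mathsf{C}}(a,b)$, there is $f'\in\mathrm{Hom}_{\mathsf{C}}(a',b')$ with $((f),(f'))\in\Psi^{\mathrm{fl}}$.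 The quotient $\mathsf{C}/\Psi$ has as objects the $\Psi^{\mathrm{ob}}$-classes, as morphisms $[a]\to[b]$ the $\Psi^{\mathrm{fl}}$-classes of sequences $(f_i)_{i\in m}\in\mathrm{Mor}(\mathsf{C})^{+}_{\Psi^{\mathrm{ob}}}$ with $\mathrm{sc}(f_0)\in[a]$, $\mathrm{tg}(f_{m-1})\in[b]$, composition induced by concatenation ($[v]\circ[u]=[u\curlywedge v]$) and identities $[(\mathrm{id}_a)]$; $P_\Psi\colon\mathsf{C}\to\mathsf{C}/\Psi$ is $a\mapsto[a]$, $f\mapsto[(f)]$. A functor $F\colon\mathsf{C}\to\mathsf{E}$ such that $\Psi^{\mathrm{ob}}$-related objects have the same image and $\Psi^{\mathrm{fl}}$-related sequences $(f_i)_{i\in m}$, $(g_j)_{j\in n}$ satisfy $F(f_{m-1})\circ\cdots\circ F(f_0)=F(g_{n-1})\circ\cdots\circ F(g_0)$ factors uniquely through $P_\Psi$. In both cases the factorization of $F$ is denoted $F^{\sharp}$. For a Riguet congruence $\Phi$, $\Phi^{\natural}$ is the smallest (coordinatewise) generalized congruence $\Psi$ with $\Phi^{\mathrm{ob}}\subseteq\Psi^{\mathrm{ob}}$ and $((f),(f'))\in\Psi^{\mathrm{fl}}$ whenever $(f,f')$ is in some component of $\Phi^{\mathrm{fl}}$; it is strong with object part $\Phi^{\mathrm{ob}}$. For $\Psi$ strong, $\Psi^{\flat}$ is the Riguet congruence with $\Psi^{\flat\mathrm{ob}}=\Psi^{\mathrm{ob}}$ and $(f,f')\in\Psi^{\flat\mathrm{fl}}_{\left(\begin{smallmatrix}a&b\\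 a'&b'\end{smallmatrix}\right)}$ iff $((f),(f'))\in\Psi^{\mathrm{fl}}$. $\mathsf{RCCat}$: objects $(\mathsf{C},\Phi)$ with $\Phi$ a Riguet congruence on $\mathsf{C}$; morphisms $(\mathsf{C},\Phi)\to(\mathsf{D},\Upsilon)$ are functors $F\colon\mathsf{C}\to\mathsf{D}$ sending $\Phi^{\mathrm{ob}}$-related objects to $\Upsilon^{\mathrm{ob}}$-related ones and such that $(f,f')\in\Phi^{\mathrm{fl}}_{\left(\begin{smallmatrix}a&b\\ a'&b'\end{smallmatrix}\right)}$ implies $(F(f),F(f'))\in\Upsilon^{\mathrm{fl}}_{\left(\begin{smallmatrix}F(a)&F(b)\\ F(a')&F(b')\end{smallmatrix}\right)}$. $\mathsf{GCCat}$: objects $(\mathsf{C},\Psi)$ with $\Psi$ a generalized congruence on $\mathsf{C}$; morphisms $(\mathsf{C},\Psi)\to(\mathsf{D},\Omega)$ are functors sending $\Psi^{\mathrm{ob}}$-related objects to $\Omega^{\mathrm{ob}}$-related ones and, applied termwise, $\Psi^{\mathrm{fl}}$-related sequences to $\Omega^{\mathrm{fl}}$-related ones. $\mathsf{SGCCat}$: full subcategory of $\mathsf{GCCat}$ on the $(\mathsf{C},\Psi)$ with $\Psi$ strong. The functors $(\cdot)^{\natural}\colon\mathsf{RCCat}\to\mathsf{GCCat}$, $(\mathsf{C},\Phi)\mapsto(\mathsf{C},\Phi^{\natural})$, and $(\cdot)^{\flat}\colon\mathsf{SGCCat}\to\mathsf{RCCat}$, $(\mathsf{C},\Psi)\mapsto(\mathsf{C},\Psi^{\flat})$,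 are the identity on underlying functors. $\mathsf{Cat}$ is the category of $\mathbf{U}$-categories ($\mathbf{U}$ a fixed Grothendieck universe) and functors, and quotients are regarded as objects of it. $U_{\mathrm{R}}\colon\mathsf{RCCat}\to\mathsf{Cat}$ and $U_{\mathrm{G}}\colon\mathsf{GCCat}\to\mathsf{Cat}$ are the forgetful functors to the underlying category. $Q_{\mathrm{R}}\colon\mathsf{RCCat}\to\mathsf{Cat}$ sends $(\mathsf{C},\Phi)$ to $\mathsf{C}/\Phi$ and $F\colon(\mathsf{C},\Phi)\to(\mathsf{D},\Upsilon)$ to $(P_{\Upsilon}\circ F)^{\sharp}$; $Q_{\mathrm{G}}\colon\mathsf{GCCat}\to\mathsf{Cat}$ sends $(\mathsf{C},\Psi)$ to $\mathsf{C}/\Psi$ and $F\colon(\mathsf{C},\Psi)\to(\mathsf{D},\Omega)$ to $(P_{\Omega}\circ F)^{\sharp}$. $U_{\mathrm{S}}$ and $Q_{\mathrm{S}}$ are the restrictions of $U_{\mathrm{G}}$ and $Q_{\mathrm{G}}$ to $\mathsf{SGCCat}$. *)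

theory Defs
  imports Main "HOL-Library.FuncSet"
begin

section \<open>Categories, functors, natural transformations\<close>

text \<open>
  Every morphism carries its source and target, so hom-sets are pairwise disjoint.
  All structure maps are required to be \<^const>\<open>undefined\<close> outside their domain of definition,
  so that two categories (or functors) are equal in HOL iff they are equal as mathematical objects.
\<close>

record ('o, 'm) cat =
  Ob  :: "'o set"
  Mor :: "'m set"
  Sc  :: "'m \<Rightarrow> 'o"
  Tg  :: "'m \<Rightarrow> 'o"
  Idt :: "'o \<Rightarrow> 'm"
  Cmp :: "'m \<Rightarrow> 'm \<Rightarrow> 'm"   \<comment> \<open>\<open>Cmp C g f\<close> is \<open>g \<circ> f\<close>\<close>

definition Hom :: "('o, 'm) cat \<Rightarrow> 'o \<Rightarrow> 'o \<Rightarrow> 'm set" where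
  "Hom C a b = {f \<in> Mor C. Sc C f = a \<and> Tg C f = b}"

definition category :: "('o, 'm) cat \<Rightarrow> bool" where
  "category C \<longleftrightarrow>
     Sc C \<in> Mor C \<rightarrow>\<^sub>E Ob C \<and>
     Tg C \<in> Mor C \<rightarrow>\<^sub>E Ob C \<and>
     Idt C \<in> Ob C \<rightarrow>\<^sub>E Mor C \<and>
     (\<forall>a\<in>Ob C. Idt C a \<in> Hom C a a) \<and>
     (\<forall>f\<in>Mor C. \<forall>g\<in>Mor C. Sc C g = Tg C f \<longrightarrow> Cmp C g f \<in> Hom C (Sc C f) (Tg C g)) \<and>
     (\<forall>f g. \<not> (f \<in> Mor C \<and> g \<in> Mor C \<and> Sc C g = Tg C f) \<longrightarrow> Cmp C g f = undefined) \<and>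
     (\<forall>f\<in>Mor C. Cmp C f (Idt C (Sc C f)) = f \<and> Cmp C (Idt C (Tg C f)) f = f) \<and>
     (\<forall>f\<in>Mor C. \<forall>g\<in>Mor C. \<forall>h\<in>Mor C. Sc C g = Tg C f \<and> Sc C h = Tg C g \<longrightarrow>
        Cmp C h (Cmp C g f) = Cmp C (Cmp C h g) f)"

definition mk_cat ::
  "'o set \<Rightarrow> 'm set \<Rightarrow> ('m \<Rightarrow> 'o) \<Rightarrow> ('m \<Rightarrow> 'o) \<Rightarrow> ('o \<Rightarrow> 'm) \<Rightarrow> ('m \<Rightarrow> 'm \<Rightarrow> 'm) \<Rightarrow> ('o, 'm) cat" where
  "mk_cat O' M s t i c =
     \<lparr>Ob = O', Mor = M, Sc = restrict s M, Tg = restrict t M, Idt = restrict i O',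
      Cmp = (\<lambda>g f. if f \<in> M \<and> g \<in> M \<and> s g = t f then c g f else undefined)\<rparr>"

record ('o1, 'm1, 'o2, 'm2) func =
  fdom :: "('o1, 'm1) cat"
  fcod :: "('o2, 'm2) cat"
  fob  :: "'o1 \<Rightarrow> 'o2"
  fmor :: "'m1 \<Rightarrow> 'm2"

definition is_functor :: "('o1, 'm1, 'o2, 'm2) func \<Rightarrow> bool" where
  "is_functor F \<longleftrightarrow>
     category (fdom F) \<and> category (fcod F) \<and>
     fob F \<in> Ob (fdom F) \<rightarrow>\<^sub>E Ob (fcod F) \<and>
     fmor F \<in> Mor (fdom F) \<rightarrow>\<^sub>E Mor (fcod F) \<and>
     (\<forall>f\<in>Mor (fdom F). Sc (fcod F) (fmor F f) = fob F (Sc (fdom F) f) \<and>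
                        Tg (fcod F) (fmor F f) = fob F (Tg (fdom F) f)) \<and>
     (\<forall>a\<in>Ob (fdom F). fmor F (Idt (fdom F) a) = Idt (fcod F) (fob F a)) \<and>
     (\<forall>f\<in>Mor (fdom F). \<forall>g\<in>Mor (fdom F). Sc (fdom F) g = Tg (fdom F) f \<longrightarrow>
        fmor F (Cmp (fdom F) g f) = Cmp (fcod F) (fmor F g) (fmor F f))"

definition mk_func ::
  "('o1, 'm1) cat \<Rightarrow> ('o2, 'm2) cat \<Rightarrow> ('o1 \<Rightarrow> 'o2) \<Rightarrow> ('m1 \<Rightarrow> 'm2) \<Rightarrow> ('o1, 'm1, 'o2, 'm2) func" where
  "mk_func C D u v =
     \<lparr>fdom = C, fcod = D, fob = restrict u (Ob C), fmor = restrict v (Mor C)\<rparr>"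

definition func_id :: "('o, 'm) cat \<Rightarrow> ('o, 'm, 'o, 'm) func" where
  "func_id C = mk_func C C (\<lambda>a. a) (\<lambda>f. f)"

definition func_comp ::
  "('o2, 'm2, 'o3, 'm3) func \<Rightarrow> ('o1, 'm1, 'o2, 'm2) func \<Rightarrow> ('o1, 'm1, 'o3, 'm3) func" where
  "func_comp G F =
     mk_func (fdom F) (fcod G) (\<lambda>a. fob G (fob F a)) (\<lambda>f. fmor G (fmor F f))"

definition full_subcat :: "('o, 'm) cat \<Rightarrow> 'o set \<Rightarrow> ('o, 'm) cat" where
  "full_subcat C S =
     mk_cat (Ob C \<inter> S) {f \<in> Mor C. Sc C f \<in> S \<and> Tg C f \<in> S} (Sc C) (Tg C) (Idt C) (Cmp C)"

definition func_restrict ::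
  "('o1, 'm1) cat \<Rightarrow> ('o1, 'm1, 'o2, 'm2) func \<Rightarrow> ('o1, 'm1, 'o2, 'm2) func" where
  "func_restrict S F = mk_func S (fcod F) (fob F) (fmor F)"

definition nat_trans ::
  "('o1, 'm1, 'o2, 'm2) func \<Rightarrow> ('o1, 'm1, 'o2, 'm2) func \<Rightarrow> ('o1 \<Rightarrow> 'm2) \<Rightarrow> bool" where
  "nat_trans F G \<tau> \<longleftrightarrow>
     is_functor F \<and> is_functor G \<and> fdom F = fdom G \<and> fcod F = fcod G \<and>
     \<tau> \<in> (\<Pi>\<^sub>E a\<in>Ob (fdom F). Hom (fcod F) (fob F a) (fob G a)) \<and>
     (\<forall>f\<in>Mor (fdom F).
        Cmp (fcod F) (\<tau> (Tg (fdom F) f)) (fmor F f) =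
        Cmp (fcod F) (fmor G f) (\<tau> (Sc (fdom F) f)))"

text \<open>
  \<open>F\<^sup>\<sharp>\<close> with respect to a projection \<open>P\<close>; meaningful when the factorization of \<open>F\<close> through \<open>P\<close> exists uniquely.
\<close>

definition sharp ::
  "('o1, 'm1, 'o2, 'm2) func \<Rightarrow> ('o1, 'm1, 'o3, 'm3) func \<Rightarrow> ('o2, 'm2, 'o3, 'm3) func" where
  "sharp P F =
     (THE G. is_functor G \<and> fdom G = fcod P \<and> fcod G = fcod F \<and> func_comp G P = F)"


section \<open>Riguet congruences\<close>

text \<open>
  \<open>rfl \<Phi> a b a' b'\<close> is the component of \<open>\<Phi>\<^sup>f\<^sup>l\<close> with first row \<open>a b\<close> and second row \<open>a' b'\<close>.
  The family is only indexed by \<open>(a, a'), (b, b') \<in> \<Phi>\<^sup>o\<^sup>b\<close>;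
  components at other indices are required to be empty.
\<close>

record ('o, 'm) riguet =
  rob :: "('o \<times> 'o) set"
  rfl :: "'o \<Rightarrow> 'o \<Rightarrow> 'o \<Rightarrow> 'o \<Rightarrow> ('m \<times> 'm) set"

definition riguet_congruence :: "('o, 'm) cat \<Rightarrow> ('o, 'm) riguet \<Rightarrow> bool" where
  "riguet_congruence C \<Phi> \<longleftrightarrow>
     equiv (Ob C) (rob \<Phi>) \<and>
     (\<forall>a b a' b'. (a, a') \<in> rob \<Phi> \<and> (b, b') \<in> rob \<Phi> \<longrightarrow> rfl \<Phi> a b a' b' \<subseteq> Hom C a b \<times> Hom C a' b') \<and>
     (\<forall>a b a' b'. \<not> ((a, a') \<in> rob \<Phi> \<and> (b, b') \<in> rob \<Phi>) \<longrightarrow> rfl \<Phi> a b a' b' = {}) \<and>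
     (\<forall>a b. (a, b) \<in> rob \<Phi> \<longrightarrow> (Idt C a, Idt C b) \<in> rfl \<Phi> a a b b) \<and>
     (\<forall>a\<in>Ob C. \<forall>b\<in>Ob C. \<forall>f\<in>Hom C a b. (f, f) \<in> rfl \<Phi> a b a b) \<and>
     (\<forall>a b a' b' f f'. (f, f') \<in> rfl \<Phi> a b a' b' \<longrightarrow> (f', f) \<in> rfl \<Phi> a' b' a b) \<and>
     (\<forall>a b a' b' a'' b'' f f' f''.
        (f, f') \<in> rfl \<Phi> a b a' b' \<and> (f', f'') \<in> rfl \<Phi> a' b' a'' b'' \<longrightarrow>
        (f, f'') \<in> rfl \<Phi> a b a'' b'') \<and>
     (\<forall>a b c a' b' c' f f' g g'.
        (f, f') \<in> rfl \<Phi> a b a' b' \<and> (g, g') \<in> rfl \<Phi> b c b' c' \<longrightarrow>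
        (Cmp C g f, Cmp C g' f') \<in> rfl \<Phi> a c a' c') \<and>
     (\<forall>a b a' b'. \<forall>f\<in>Hom C a b. (a, a') \<in> rob \<Phi> \<and> (b, b') \<in> rob \<Phi> \<longrightarrow>
        (\<exists>f'\<in>Hom C a' b'. (f, f') \<in> rfl \<Phi> a b a' b'))"

text \<open>
  For \<open>\<Phi>\<^sup>o\<^sup>b\<close>-classes \<open>A\<close>, \<open>B\<close>: all morphisms from a member of \<open>A\<close> to a member of \<open>B\<close>,
  and the equivalence relation on them whose classes are the morphisms \<open>A \<rightarrow> B\<close> of the quotient.
\<close>

definition class_hom :: "('o, 'm) cat \<Rightarrow> 'o set \<Rightarrow> 'o set \<Rightarrow> 'm set" where
  "class_hom C A B = (\<Union>a\<in>A. \<Union>b\<in>B. Hom C a b)"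

definition class_rel :: "('o, 'm) riguet \<Rightarrow> 'o set \<Rightarrow> 'o set \<Rightarrow> ('m \<times> 'm) set" where
  "class_rel \<Phi> A B = (\<Union>a'\<in>A. \<Union>a''\<in>A. \<Union>b'\<in>B. \<Union>b''\<in>B. rfl \<Phi> a' b' a'' b'')"

definition rob_class :: "('o, 'm) riguet \<Rightarrow> 'o \<Rightarrow> 'o set" where
  "rob_class \<Phi> a = rob \<Phi> `` {a}"

definition rfl_class :: "('o, 'm) cat \<Rightarrow> ('o, 'm) riguet \<Rightarrow> 'm \<Rightarrow> 'm set" where
  "rfl_class C \<Phi> f = class_rel \<Phi> (rob_class \<Phi> (Sc C f)) (rob_class \<Phi> (Tg C f)) `` {f}"

definition riguet_quotient :: "('o, 'm) cat \<Rightarrow> ('o, 'm) riguet \<Rightarrow> ('o set, 'm set) cat" where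
  "riguet_quotient C \<Phi> =
     mk_cat
       (Ob C // rob \<Phi>)
       (\<Union>A \<in> Ob C // rob \<Phi>. \<Union>B \<in> Ob C // rob \<Phi>. class_hom C A B // class_rel \<Phi> A B)
       (\<lambda>X. THE A. \<exists>f\<in>X. A = rob_class \<Phi> (Sc C f))
       (\<lambda>X. THE B. \<exists>f\<in>X. B = rob_class \<Phi> (Tg C f))
       (\<lambda>A. THE X. \<exists>a\<in>A. X = rfl_class C \<Phi> (Idt C a))
       (\<lambda>Y X. THE Z. \<exists>a' b' b'' c' f g h.
          f \<in> Hom C a' b' \<and> g \<in> Hom C b'' c' \<and> (b', b'') \<in> rob \<Phi> \<and>
          X = rfl_class C \<Phi> f \<and> Y = rfl_class C \<Phi> g \<and>
          h \<in> Hom C a' b'' \<and> (f, h) \<in> rfl \<Phi> a' b' a' b'' \<and>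
          Z = rfl_class C \<Phi> (Cmp C g h))"


section \<open>Generalized congruences\<close>

record ('o, 'm) gencong =
  gob :: "('o \<times> 'o) set"
  gfl :: "('m list \<times> 'm list) set"

text \<open>
  \<open>Mor(C)\<^sup>+\<^sub>E\<close>; the first morphism to be applied comes first in the list.
\<close>

definition mor_plus :: "('o, 'm) cat \<Rightarrow> ('o \<times> 'o) set \<Rightarrow> 'm list set" where
  "mor_plus C E =
     {w. w \<noteq> [] \<and> set w \<subseteq> Mor C \<and>
         (\<forall>i. Suc i < length w \<longrightarrow> (Tg C (w ! i), Sc C (w ! Suc i)) \<in> E)}"

definition generalized_congruence :: "('o, 'm) cat \<Rightarrow> ('o, 'm) gencong \<Rightarrow> bool" where
  "generalized_congruence C \<Psi> \<longleftrightarrow>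
     equiv (Ob C) (gob \<Psi>) \<and>
     equiv (mor_plus C (gob \<Psi>)) (gfl \<Psi>) \<and>
     (\<forall>a b. (a, b) \<in> gob \<Psi> \<longrightarrow> ([Idt C a], [Idt C b]) \<in> gfl \<Psi>) \<and>
     (\<forall>u v. (u, v) \<in> gfl \<Psi> \<longrightarrow>
        (Sc C (hd u), Sc C (hd v)) \<in> gob \<Psi> \<and> (Tg C (last u), Tg C (last v)) \<in> gob \<Psi>) \<and>
     (\<forall>f\<in>Mor C. \<forall>g\<in>Mor C. Sc C g = Tg C f \<longrightarrow> ([f, g], [Cmp C g f]) \<in> gfl \<Psi>) \<and>
     (\<forall>u u' v v'. (u, u') \<in> gfl \<Psi> \<and> (v, v') \<in> gfl \<Psi> \<and> (Tg C (last u), Sc C (hd v)) \<in> gob \<Psi> \<longrightarrow>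
        (u @ v, u' @ v') \<in> gfl \<Psi>)"

definition strong :: "('o, 'm) cat \<Rightarrow> ('o, 'm) gencong \<Rightarrow> bool" where
  "strong C \<Psi> \<longleftrightarrow>
     (\<forall>a b a' b'. \<forall>f\<in>Hom C a b. (a, a') \<in> gob \<Psi> \<and> (b, b') \<in> gob \<Psi> \<longrightarrow>
        (\<exists>f'\<in>Hom C a' b'. ([f], [f']) \<in> gfl \<Psi>))"

definition generalized_quotient :: "('o, 'm) cat \<Rightarrow> ('o, 'm) gencong \<Rightarrow> ('o set, 'm list set) cat" where
  "generalized_quotient C \<Psi> =
     mk_cat
       (Ob C // gob \<Psi>)
       (mor_plus C (gob \<Psi>) // gfl \<Psi>)
       (\<lambda>X. THE A. \<exists>u\<in>X. A = gob \<Psi> `` {Sc C (hd u)})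
       (\<lambda>X. THE B. \<exists>u\<in>X. B = gob \<Psi> `` {Tg C (last u)})
       (\<lambda>A. THE X. \<exists>a\<in>A. X = gfl \<Psi> `` {[Idt C a]})
       (\<lambda>Y X. THE Z. \<exists>u\<in>X. \<exists>v\<in>Y. Z = gfl \<Psi> `` {u @ v})"

definition natural_spec :: "('o, 'm) cat \<Rightarrow> ('o, 'm) riguet \<Rightarrow> ('o, 'm) gencong \<Rightarrow> bool" where
  "natural_spec C \<Phi> \<Psi> \<longleftrightarrow>
     generalized_congruence C \<Psi> \<and> rob \<Phi> \<subseteq> gob \<Psi> \<and>
     (\<forall>a b a' b' f f'. (f, f') \<in> rfl \<Phi> a b a' b' \<longrightarrow> ([f], [f']) \<in> gfl \<Psi>)"

definition natural_cong :: "('o, 'm) cat \<Rightarrow> ('o, 'm) riguet \<Rightarrow> ('o, 'm) gencong" where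
  "natural_cong C \<Phi> =
     (THE \<Psi>. natural_spec C \<Phi> \<Psi> \<and>
        (\<forall>\<Psi>'. natural_spec C \<Phi> \<Psi>' \<longrightarrow> gob \<Psi> \<subseteq> gob \<Psi>' \<and> gfl \<Psi> \<subseteq> gfl \<Psi>'))"

definition flat_cong :: "('o, 'm) cat \<Rightarrow> ('o, 'm) gencong \<Rightarrow> ('o, 'm) riguet" where
  "flat_cong C \<Psi> =
     \<lparr>rob = gob \<Psi>,
      rfl = (\<lambda>a b a' b'. {(f, f'). (a, a') \<in> gob \<Psi> \<and> (b, b') \<in> gob \<Psi> \<and>
               f \<in> Hom C a b \<and> f' \<in> Hom C a' b' \<and> ([f], [f']) \<in> gfl \<Psi>})\<rparr>"


section \<open>The Grothendieck universe and small categories\<close>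

text \<open>
  The elements of the universe \<open>U\<close> are the members of the type \<open>'u\<close>, and \<open>elts x\<close> is the set
  of elements of \<open>x \<in> U\<close>, so transitivity of \<open>U\<close> is built in. A set \<open>A :: 'u set\<close> of
  elements of \<open>U\<close> is itself (an element) in \<open>U\<close> iff it is in the range of \<open>elts\<close>, and then
  \<open>vset elts A\<close> is that element. Pairs are Kuratowski pairs, natural numbers
  are von Neumann numerals, and a finite sequence is a function on a numeral, i.e. a set of pairs.
\<close>

definition vset :: "('u \<Rightarrow> 'u set) \<Rightarrow> 'u set \<Rightarrow> 'u" where
  "vset elts A = (THE x. elts x = A)"

definition vpair :: "('u \<Rightarrow> 'u set) \<Rightarrow> 'u \<Rightarrow> 'u \<Rightarrow> 'u" where
  "vpair elts x y = vset elts {vset elts {x}, vset elts {x, y}}"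

primrec vnat :: "('u \<Rightarrow> 'u set) \<Rightarrow> nat \<Rightarrow> 'u" where
  "vnat elts 0 = vset elts {}"
| "vnat elts (Suc n) = vset elts (insert (vnat elts n) (elts (vnat elts n)))"

definition vseq :: "('u \<Rightarrow> 'u set) \<Rightarrow> 'u list \<Rightarrow> 'u" where
  "vseq elts w = vset elts {vpair elts (vnat elts i) (w ! i) | i. i < length w}"

text \<open>
  In order: extensionality, and closure of \<open>U\<close> under unordered pairs, power sets (the subsets of
  \<open>x\<close> are exactly the extensions of the members of \<open>p\<close>), unions of families indexed by an
  element of \<open>U\<close>; and \<open>\<omega> \<in> U\<close>.
\<close>

definition grothendieck_universe :: "('u \<Rightarrow> 'u set) \<Rightarrow> bool" where
  "grothendieck_universe elts \<longleftrightarrow>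
     inj elts \<and>
     (\<forall>x y. \<exists>z. elts z = {x, y}) \<and>
     (\<forall>x. \<exists>p. elts ` elts p = Pow (elts x)) \<and>
     (\<forall>I x. \<exists>z. elts z = (\<Union>i\<in>elts I. elts (x i))) \<and>
     (\<exists>w. elts w = range (vnat elts))"

definition U_category :: "('u \<Rightarrow> 'u set) \<Rightarrow> ('u, 'u) cat \<Rightarrow> bool" where
  "U_category elts C \<longleftrightarrow> category C \<and> Ob C \<in> range elts \<and> Mor C \<in> range elts"

type_synonym 'u ucat = "('u, 'u) cat"
type_synonym 'u ufunc = "('u, 'u, 'u, 'u) func"

definition Cat :: "('u \<Rightarrow> 'u set) \<Rightarrow> ('u ucat, 'u ufunc) cat" where
  "Cat elts =
     mk_cat {C. U_category elts C}
       {F. is_functor F \<and> U_category elts (fdom F) \<and> U_category elts (fcod F)}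
       fdom fcod func_id func_comp"

text \<open>
  Quotients as objects of \<open>Cat\<close>: the classes occurring in a quotient are HOL sets (of
  elements of \<open>U\<close>, or of finite sequences of these) and are replaced by the corresponding elements of \<open>U\<close>.
  \<open>transport u v C\<close> renames the objects and the morphisms of \<open>C\<close> along maps \<open>u\<close>, \<open>v\<close>
  that are injective on \<open>Ob C\<close> and \<open>Mor C\<close>.
\<close>

definition transport :: "('o \<Rightarrow> 'o2) \<Rightarrow> ('m \<Rightarrow> 'm2) \<Rightarrow> ('o, 'm) cat \<Rightarrow> ('o2, 'm2) cat" where
  "transport u v C =
     mk_cat (u ` Ob C) (v ` Mor C)
       (\<lambda>x. u (Sc C (inv_into (Mor C) v x)))
       (\<lambda>x. u (Tg C (inv_into (Mor C) v x)))
       (\<lambda>a. v (Idt C (inv_into (Ob C) u a)))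
       (\<lambda>y x. v (Cmp C (inv_into (Mor C) v y) (inv_into (Mor C) v x)))"

definition seq_class :: "('u \<Rightarrow> 'u set) \<Rightarrow> 'u list set \<Rightarrow> 'u" where
  "seq_class elts W = vset elts (vseq elts ` W)"

definition RQuot :: "('u \<Rightarrow> 'u set) \<Rightarrow> 'u ucat \<Rightarrow> ('u, 'u) riguet \<Rightarrow> 'u ucat" where
  "RQuot elts C \<Phi> = transport (vset elts) (vset elts) (riguet_quotient C \<Phi>)"

definition RProj :: "('u \<Rightarrow> 'u set) \<Rightarrow> 'u ucat \<Rightarrow> ('u, 'u) riguet \<Rightarrow> 'u ufunc" where
  "RProj elts C \<Phi> =
     mk_func C (RQuot elts C \<Phi>)
       (\<lambda>a. vset elts (rob_class \<Phi> a)) (\<lambda>f. vset elts (rfl_class C \<Phi> f))"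

definition GQuot :: "('u \<Rightarrow> 'u set) \<Rightarrow> 'u ucat \<Rightarrow> ('u, 'u) gencong \<Rightarrow> 'u ucat" where
  "GQuot elts C \<Psi> = transport (vset elts) (seq_class elts) (generalized_quotient C \<Psi>)"

definition GProj :: "('u \<Rightarrow> 'u set) \<Rightarrow> 'u ucat \<Rightarrow> ('u, 'u) gencong \<Rightarrow> 'u ufunc" where
  "GProj elts C \<Psi> =
     mk_func C (GQuot elts C \<Psi>)
       (\<lambda>a. vset elts (gob \<Psi> `` {a})) (\<lambda>f. seq_class elts (gfl \<Psi> `` {[f]}))"


section \<open>The categories of categories with congruences, and the functors between them\<close>

text \<open>
  A morphism \<open>(X, F, Y)\<close> consists of its source, its underlying functor and its target.
\<close>

type_synonym 'u robj = "'u ucat \<times> ('u, 'u) riguet"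
type_synonym 'u rmor = "'u robj \<times> 'u ufunc \<times> 'u robj"
type_synonym 'u gobj = "'u ucat \<times> ('u, 'u) gencong"
type_synonym 'u gmor = "'u gobj \<times> 'u ufunc \<times> 'u gobj"

definition rc_objects :: "('u \<Rightarrow> 'u set) \<Rightarrow> 'u robj set" where
  "rc_objects elts = {(C, \<Phi>). U_category elts C \<and> riguet_congruence C \<Phi>}"

definition rc_morphisms :: "('u \<Rightarrow> 'u set) \<Rightarrow> 'u rmor set" where
  "rc_morphisms elts =
     {((C, \<Phi>), F, (D, \<Upsilon>)) | C \<Phi> F D \<Upsilon>.
        (C, \<Phi>) \<in> rc_objects elts \<and> (D, \<Upsilon>) \<in> rc_objects elts \<and>
        is_functor F \<and> fdom F = C \<and> fcod F = D \<and>
        (\<forall>a b. (a, b) \<in> rob \<Phi> \<longrightarrow> (fob F a, fob F b) \<in> rob \<Upsilon>) \<and>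
        (\<forall>a b a' b' f f'. (f, f') \<in> rfl \<Phi> a b a' b' \<longrightarrow>
           (fmor F f, fmor F f') \<in> rfl \<Upsilon> (fob F a) (fob F b) (fob F a') (fob F b'))}"

definition RCCat :: "('u \<Rightarrow> 'u set) \<Rightarrow> ('u robj, 'u rmor) cat" where
  "RCCat elts =
     mk_cat (rc_objects elts) (rc_morphisms elts)
       (\<lambda>(X, F, Y). X) (\<lambda>(X, F, Y). Y)
       (\<lambda>X. (X, func_id (fst X), X))
       (\<lambda>(Y, G, Z) (X, F, Y'). (X, func_comp G F, Z))"

definition gc_objects :: "('u \<Rightarrow> 'u set) \<Rightarrow> 'u gobj set" where
  "gc_objects elts = {(C, \<Psi>). U_category elts C \<and> generalized_congruence C \<Psi>}"

definition gc_morphisms :: "('u \<Rightarrow> 'u set) \<Rightarrow> 'u gmor set" where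
  "gc_morphisms elts =
     {((C, \<Psi>), F, (D, \<Omega>)) | C \<Psi> F D \<Omega>.
        (C, \<Psi>) \<in> gc_objects elts \<and> (D, \<Omega>) \<in> gc_objects elts \<and>
        is_functor F \<and> fdom F = C \<and> fcod F = D \<and>
        (\<forall>a b. (a, b) \<in> gob \<Psi> \<longrightarrow> (fob F a, fob F b) \<in> gob \<Omega>) \<and>
        (\<forall>u v. (u, v) \<in> gfl \<Psi> \<longrightarrow> (map (fmor F) u, map (fmor F) v) \<in> gfl \<Omega>)}"

definition GCCat :: "('u \<Rightarrow> 'u set) \<Rightarrow> ('u gobj, 'u gmor) cat" where
  "GCCat elts =
     mk_cat (gc_objects elts) (gc_morphisms elts)
       (\<lambda>(X, F, Y). X) (\<lambda>(X, F, Y). Y)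
       (\<lambda>X. (X, func_id (fst X), X))
       (\<lambda>(Y, G, Z) (X, F, Y'). (X, func_comp G F, Z))"

definition SGCCat :: "('u \<Rightarrow> 'u set) \<Rightarrow> ('u gobj, 'u gmor) cat" where
  "SGCCat elts = full_subcat (GCCat elts) {(C, \<Psi>). strong C \<Psi>}"

definition natural_ob :: "'u robj \<Rightarrow> 'u gobj" where
  "natural_ob = (\<lambda>(C, \<Phi>). (C, natural_cong C \<Phi>))"

definition flat_ob :: "'u gobj \<Rightarrow> 'u robj" where
  "flat_ob = (\<lambda>(C, \<Psi>). (C, flat_cong C \<Psi>))"

definition Natural :: "('u \<Rightarrow> 'u set) \<Rightarrow> ('u robj, 'u rmor, 'u gobj, 'u gmor) func" where
  "Natural elts =
     mk_func (RCCat elts) (GCCat elts) natural_ob (\<lambda>(X, F, Y). (natural_ob X, F, natural_ob Y))"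

definition Flat :: "('u \<Rightarrow> 'u set) \<Rightarrow> ('u gobj, 'u gmor, 'u robj, 'u rmor) func" where
  "Flat elts =
     mk_func (SGCCat elts) (RCCat elts) flat_ob (\<lambda>(X, F, Y). (flat_ob X, F, flat_ob Y))"

definition U_R :: "('u \<Rightarrow> 'u set) \<Rightarrow> ('u robj, 'u rmor, 'u ucat, 'u ufunc) func" where
  "U_R elts = mk_func (RCCat elts) (Cat elts) (\<lambda>(C, \<Phi>). C) (\<lambda>(X, F, Y). F)"

definition U_G :: "('u \<Rightarrow> 'u set) \<Rightarrow> ('u gobj, 'u gmor, 'u ucat, 'u ufunc) func" where
  "U_G elts = mk_func (GCCat elts) (Cat elts) (\<lambda>(C, \<Psi>). C) (\<lambda>(X, F, Y). F)"

definition U_S :: "('u \<Rightarrow> 'u set) \<Rightarrow> ('u gobj, 'u gmor, 'u ucat, 'u ufunc) func" where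
  "U_S elts = func_restrict (SGCCat elts) (U_G elts)"

definition Q_R :: "('u \<Rightarrow> 'u set) \<Rightarrow> ('u robj, 'u rmor, 'u ucat, 'u ufunc) func" where
  "Q_R elts =
     mk_func (RCCat elts) (Cat elts)
       (\<lambda>(C, \<Phi>). RQuot elts C \<Phi>)
       (\<lambda>((C, \<Phi>), F, (D, \<Upsilon>)). sharp (RProj elts C \<Phi>) (func_comp (RProj elts D \<Upsilon>) F))"

definition Q_G :: "('u \<Rightarrow> 'u set) \<Rightarrow> ('u gobj, 'u gmor, 'u ucat, 'u ufunc) func" where
  "Q_G elts =
     mk_func (GCCat elts) (Cat elts)
       (\<lambda>(C, \<Psi>). GQuot elts C \<Psi>)
       (\<lambda>((C, \<Psi>), F, (D, \<Omega>)). sharp (GProj elts C \<Psi>) (func_comp (GProj elts D \<Omega>) F))"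

definition Q_S :: "('u \<Rightarrow> 'u set) \<Rightarrow> ('u gobj, 'u gmor, 'u ucat, 'u ufunc) func" where
  "Q_S elts = func_restrict (SGCCat elts) (Q_G elts)"

end

theory Submission
  imports Defs
begin

text \<open>
  A projection onto a quotient is an epimorphism of \<open>Cat\<close>, because a quotient consists of the classes
  of objects, the classes of morphisms and, in the generalized case, composites of the latter
  (\<open>RProj_cancel\<close>, \<open>GProj_cancel\<close>). A functor between categories with congruences that respects
  the congruences induces a functor on quotients (\<open>RProj_lift\<close>, \<open>GProj_lift\<close>), and by
  cancellation it is the only one that commutes with the projections, so it is the value of \<open>Q\<close>.
  Hence the square that expresses naturality of the projections holds by construction, and
  the functor laws for \<open>Q\<close> follow from it by cancelling a projection
  (\<open>nat_trans_epi_components\<close>). This gives \<open>pr_R\<close> and \<open>pr_G\<close>. As \<open>U_S\<close> and \<open>Q_S\<close> are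
  composites with the inclusion of \<open>SGCCat\<close>, whiskering gives \<open>pr_S\<close>.

  For \<open>\<alpha>\<close>, note that \<open>U_G \<circ> Natural = U_R\<close>. So two natural transformations start at
  \<open>U_R\<close>: the projections to the Riguet quotients, which are epimorphisms, and the
  projections to the quotients by the generated congruences. Since a generated
  congruence contains the Riguet congruence, the second factors through the first, componentwise; the
  factors are natural because the epimorphisms can be cancelled (\<open>nat_trans_factor\<close>). In the same way,
  \<open>U_R \<circ> Flat = U_S\<close>, and for strong \<open>\<Psi>\<close> the projection to the quotient by \<open>\<Psi>\<close>
  factors through the projection to the quotient by \<open>\<Psi>\<^sup>\<flat>\<close>, which gives \<open>\<beta>\<close>.

  Two points need more work. First, the quotients have to be categories in the universe. Both
  are instances of one construction (locale \<open>presentation\<close>), in which arrows compose already if target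
  and source are equivalent; their sizes are controlled by replacement
  and by the smallness of the set of finite sequences (\<open>small_sequences\<close>). Second, \<open>Natural\<close> has to
  be a functor: the generated congruence is an intersection, and a functor respects
  generated congruences because congruences can be pulled back along it (\<open>natural_gc_morphisms\<close>).
\<close>

section \<open>Small sets in a Grothendieck universe\<close>

locale universe =
  fixes elts :: "'u \<Rightarrow> 'u set"
  assumes universe: "grothendieck_universe elts"
begin

definition small :: "'u set \<Rightarrow> bool" where
  "small A \<longleftrightarrow> A \<in> range elts"

lemma small_elts [simp]: "small (elts x)"
  by (simp add: small_def)

lemma smallE: "small A \<Longrightarrow> (\<And>x. A = elts x \<Longrightarrow> P) \<Longrightarrow> P"
  by (auto simp: small_def)

lemma inj_elts: "inj elts"
  and pair_closed: "\<exists>z. elts z = {x, y}"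
  and power_closed: "\<exists>p. elts ` elts p = Pow (elts x)"
  and union_closed: "\<exists>z. elts z = (\<Union>i\<in>elts I. elts (F i))"
  and infinity: "\<exists>w. elts w = range (vnat elts)"
proof -
  note u = universe[unfolded grothendieck_universe_def]
  show "inj elts" by (rule u[THEN conjunct1])
  show "\<exists>z. elts z = {x, y}"
    by (rule u[THEN conjunct2, THEN conjunct1, THEN spec, THEN spec])
  show "\<exists>p. elts ` elts p = Pow (elts x)"
    by (rule u[THEN conjunct2, THEN conjunct2, THEN conjunct1, THEN spec])
  show "\<exists>z. elts z = (\<Union>i\<in>elts I. elts (F i))"
    by (rule u[THEN conjunct2, THEN conjunct2, THEN conjunct2, THEN conjunct1, THEN spec, THEN spec])
  show "\<exists>w. elts w = range (vnat elts)"
    by (rule u[THEN conjunct2, THEN conjunct2, THEN conjunct2, THEN conjunct2])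
qed

lemma elts_vset [simp]: "small A \<Longrightarrow> elts (vset elts A) = A"
proof -
  assume "small A"
  then obtain x where x: "A = elts x" by (rule smallE)
  have "(THE y. elts y = A) = x" using x by (auto simp: inj_eq[OF inj_elts])
  then show ?thesis unfolding vset_def using x by simp
qed

lemma vset_eq_iff: "small A \<Longrightarrow> small B \<Longrightarrow> vset elts A = vset elts B \<longleftrightarrow> A = B"
  by (metis elts_vset)

lemma small_pair [simp]: "small {x, y}"
  by (metis pair_closed small_elts)

lemma small_singleton [simp]: "small {x}"
  using small_pair[of x x] by simp

lemma small_subset: "small B \<Longrightarrow> A \<subseteq> B \<Longrightarrow> small A"
proof -
  assume "small B" "A \<subseteq> B"
  then obtain x where "B = elts x" by (auto elim: smallE)
  moreover obtain p where "elts ` elts p = Pow (elts x)"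
    using power_closed[of x] by auto
  ultimately have "A \<in> elts ` elts p" using \<open>A \<subseteq> B\<close> by simp
  then show "small A" by auto
qed

lemma small_UN: "small A \<Longrightarrow> (\<And>a. a \<in> A \<Longrightarrow> small (B a)) \<Longrightarrow> small (\<Union>a\<in>A. B a)"
proof -
  assume "small A" and B: "\<And>a. a \<in> A \<Longrightarrow> small (B a)"
  then obtain x where x: "A = elts x" by (auto elim: smallE)
  obtain z where "elts z = (\<Union>i\<in>elts x. elts (vset elts (B i)))"
    using union_closed[where I = x and F = "\<lambda>i. vset elts (B i)"] by auto
  also have "\<dots> = (\<Union>a\<in>A. B a)" using B x by simp
  finally show ?thesis by (metis small_elts)
qed

text \<open>
  Replacement: an image is the union of a family of singletons.
\<close>

lemma small_image: "small A \<Longrightarrow> small (f ` A)"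
  using small_UN[of A "\<lambda>a. {f a}"] by (simp add: UNION_singleton_eq_range)

lemma small_power: "small A \<Longrightarrow> small {x. elts x \<subseteq> A}"
proof -
  assume "small A"
  then obtain x where x: "A = elts x" by (rule smallE)
  obtain p where "elts ` elts p = Pow (elts x)"
    using power_closed[of x] by auto
  then have "y \<in> elts p \<longleftrightarrow> elts y \<subseteq> A" for y
    using x inj_image_mem_iff[OF inj_elts, of y "elts p"] by simp
  then have "elts p = {x. elts x \<subseteq> A}" by blast
  then show ?thesis by (metis small_elts)
qed

lemma small_omega: "small (range (vnat elts))"
  by (metis infinity small_elts)

lemma vpair_eq_iff: "vpair elts x y = vpair elts x' y' \<longleftrightarrow> x = x' \<and> y = y'"
  by (auto simp: vpair_def vset_eq_iff doubleton_eq_iff)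

lemma elts_vnat: "elts (vnat elts n) = vnat elts ` {..<n}"
proof (induction n)
  case 0
  show ?case using small_subset[OF small_omega, of "{}"] by simp
next
  case (Suc n)
  have "insert (vnat elts n) (elts (vnat elts n)) = vnat elts ` {..<Suc n}"
    using Suc by (simp add: lessThan_Suc)
  then show ?case using small_subset[OF small_omega, of "vnat elts ` {..<Suc n}"]
    by (simp add: image_mono)
qed

text \<open>
  The universe is not assumed to be well-founded, so that a numeral is not a member of itself
  has to come from the construction: if the first \<open>n\<close> numerals are distinct, then
  \<open>vnat elts n\<close> has \<open>n\<close> members while each of them has fewer, so it is different from them.
\<close>

lemma inj_vnat: "inj (vnat elts)"
proof -
  have "inj_on (vnat elts) {..<n}" for n
  proof (induction n)
    case (Suc n)
    have "vnat elts n \<noteq> vnat elts i" if "i < n" for i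
    proof
      assume "vnat elts n = vnat elts i"
      then have "elts (vnat elts n) = elts (vnat elts i)" by (rule arg_cong)
      then have "card (vnat elts ` {..<n}) = card (vnat elts ` {..<i})" by (simp only: elts_vnat)
      moreover have "inj_on (vnat elts) {..<i}"
        by (rule inj_on_subset[OF Suc]) (use that in auto)
      ultimately have "n = i" by (simp only: card_image[OF Suc] card_image card_lessThan)
      then show False using that by simp
    qed
    then have "vnat elts n \<notin> vnat elts ` {..<n}" by blast
    with Suc show ?case by (simp add: lessThan_Suc)
  qed simp
  then have *: "inj_on (vnat elts) {..<Suc (max m n)}" for m n .
  show ?thesis
  proof (rule injI)
    fix m n assume "vnat elts m = vnat elts n"
    then show "m = n" by (rule inj_onD[OF *[of m n]]) auto
  qed
qed

lemma elts_vseq: "elts (vseq elts w) = {vpair elts (vnat elts i) (w ! i) | i. i < length w}"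
proof -
  have "{vpair elts (vnat elts i) (w ! i) | i. i < length w} =
      (\<lambda>x. vpair elts x (w ! inv (vnat elts) x)) ` vnat elts ` {..<length w}"
    by (auto simp: image_iff inj_vnat)
  moreover have "small (vnat elts ` {..<length w})"
    using small_elts[of "vnat elts (length w)"] by (simp only: elts_vnat)
  ultimately have "small {vpair elts (vnat elts i) (w ! i) | i. i < length w}"
    by (simp only: small_image)
  then show ?thesis by (simp only: vseq_def elts_vset)
qed

lemma inj_vseq: "inj (vseq elts)"
proof (rule injI)
  fix v w :: "'u list"
  assume "vseq elts v = vseq elts w"
  then have eq: "{vpair elts (vnat elts i) (v ! i) | i. i < length v} =
      {vpair elts (vnat elts i) (w ! i) | i. i < length w}"
    unfolding elts_vseq[symmetric] by (rule arg_cong)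
  have prefix: "length x \<le> length y \<and> (\<forall>i<length x. x ! i = y ! i)"
    if sub: "{vpair elts (vnat elts i) (x ! i) | i. i < length x} \<subseteq>
        {vpair elts (vnat elts i) (y ! i) | i. i < length y}" for x y :: "'u list"
  proof -
    have *: "i < length y \<and> x ! i = y ! i" if "i < length x" for i
    proof -
      have "vpair elts (vnat elts i) (x ! i) \<in> {vpair elts (vnat elts i) (y ! i) | i. i < length y}"
        using sub that by blast
      then show ?thesis by (auto simp: vpair_eq_iff dest: injD[OF inj_vnat])
    qed
    then have "\<not> length y < length x" by blast
    with * show ?thesis by simp
  qed
  show "v = w"
    using prefix[OF equalityD1[OF eq]] prefix[OF equalityD2[OF eq]]
    by (metis nth_equalityI le_antisym)
qed

text \<open>
  A sequence in \<open>M\<close> is a subset of \<open>\<omega> \<times> M\<close>, so the sequences in a small set form a small set.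
\<close>

lemma small_sequences: "small M \<Longrightarrow> small (vseq elts ` lists M)"
proof -
  assume M: "small M"
  let ?prod = "\<Union>x\<in>range (vnat elts). vpair elts x ` M"
  have "small ?prod" by (intro small_UN small_omega small_image M)
  moreover have "vseq elts ` lists M \<subseteq> {x. elts x \<subseteq> ?prod}"
    by (fastforce simp: elts_vseq)
  ultimately show ?thesis using small_subset small_power by blast
qed

end

section \<open>Categories, functors, and whiskering\<close>

lemma mk_cat_simps [simp]:
  "Ob (mk_cat A M s t i c) = A" "Mor (mk_cat A M s t i c) = M"
  "Sc (mk_cat A M s t i c) = restrict s M" "Tg (mk_cat A M s t i c) = restrict t M"
  "Idt (mk_cat A M s t i c) = restrict i A"
  "Cmp (mk_cat A M s t i c) = (\<lambda>g f. if f \<in> M \<and> g \<in> M \<and> s g = t f then c g f else undefined)"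
  by (simp_all add: mk_cat_def)

lemma mk_func_simps [simp]:
  "fdom (mk_func C D u v) = C" "fcod (mk_func C D u v) = D"
  "fob (mk_func C D u v) = restrict u (Ob C)" "fmor (mk_func C D u v) = restrict v (Mor C)"
  by (simp_all add: mk_func_def)

lemma func_comp_simps [simp]:
  "fdom (func_comp G F) = fdom F" "fcod (func_comp G F) = fcod G"
  "fob (func_comp G F) = restrict (\<lambda>a. fob G (fob F a)) (Ob (fdom F))"
  "fmor (func_comp G F) = restrict (\<lambda>f. fmor G (fmor F f)) (Mor (fdom F))"
  by (simp_all add: func_comp_def)

lemma categoryD:
  assumes "category C"
  shows "f \<in> Mor C \<Longrightarrow> Sc C f \<in> Ob C" "f \<in> Mor C \<Longrightarrow> Tg C f \<in> Ob C"
    "a \<in> Ob C \<Longrightarrow> Idt C a \<in> Mor C" "a \<in> Ob C \<Longrightarrow> Sc C (Idt C a) = a"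
    "a \<in> Ob C \<Longrightarrow> Tg C (Idt C a) = a"
    "\<lbrakk>f \<in> Mor C; g \<in> Mor C; Sc C g = Tg C f\<rbrakk> \<Longrightarrow> Cmp C g f \<in> Mor C"
    "\<lbrakk>f \<in> Mor C; g \<in> Mor C; Sc C g = Tg C f\<rbrakk> \<Longrightarrow> Sc C (Cmp C g f) = Sc C f"
    "\<lbrakk>f \<in> Mor C; g \<in> Mor C; Sc C g = Tg C f\<rbrakk> \<Longrightarrow> Tg C (Cmp C g f) = Tg C g"
    "f \<in> Mor C \<Longrightarrow> Cmp C f (Idt C (Sc C f)) = f" "f \<in> Mor C \<Longrightarrow> Cmp C (Idt C (Tg C f)) f = f"
    "\<lbrakk>f \<in> Mor C; g \<in> Mor C; h \<in> Mor C; Sc C g = Tg C f; Sc C h = Tg C g\<rbrakk> \<Longrightarrow>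
      Cmp C h (Cmp C g f) = Cmp C (Cmp C h g) f"
  using assms unfolding category_def Hom_def by (auto simp: PiE_def Pi_def)

text \<open>
  The domain and the codomain are separate variables, so that these rules can be
  instantiated with whichever name a proof uses for them.
\<close>

lemma functorD:
  assumes "is_functor F" "fdom F = C" "fcod F = D"
  shows "category C" "category D"
    "a \<in> Ob C \<Longrightarrow> fob F a \<in> Ob D" "f \<in> Mor C \<Longrightarrow> fmor F f \<in> Mor D"
    "f \<in> Mor C \<Longrightarrow> Sc D (fmor F f) = fob F (Sc C f)"
    "f \<in> Mor C \<Longrightarrow> Tg D (fmor F f) = fob F (Tg C f)"
    "a \<in> Ob C \<Longrightarrow> fmor F (Idt C a) = Idt D (fob F a)"
    "\<lbrakk>f \<in> Mor C; g \<in> Mor C; Sc C g = Tg C f\<rbrakk> \<Longrightarrow>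
      fmor F (Cmp C g f) = Cmp D (fmor F g) (fmor F f)"
    "fob F \<in> extensional (Ob C)" "fmor F \<in> extensional (Mor C)"
  using assms unfolding is_functor_def by (auto simp: PiE_def Pi_def)

lemma functor_mk_func:
  assumes "category C" "category D"
    "\<And>a. a \<in> Ob C \<Longrightarrow> u a \<in> Ob D" "\<And>f. f \<in> Mor C \<Longrightarrow> v f \<in> Mor D"
    "\<And>f. f \<in> Mor C \<Longrightarrow> Sc D (v f) = u (Sc C f)" "\<And>f. f \<in> Mor C \<Longrightarrow> Tg D (v f) = u (Tg C f)"
    "\<And>a. a \<in> Ob C \<Longrightarrow> v (Idt C a) = Idt D (u a)"
    "\<And>f g. \<lbrakk>f \<in> Mor C; g \<in> Mor C; Sc C g = Tg C f\<rbrakk> \<Longrightarrow> v (Cmp C g f) = Cmp D (v g) (v f)"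
  shows "is_functor (mk_func C D u v)"
  using assms unfolding is_functor_def by (auto simp: categoryD)

lemma functor_eqI:
  assumes "is_functor F" "is_functor G" "fdom F = fdom G" "fcod F = fcod G"
    "\<And>a. a \<in> Ob (fdom G) \<Longrightarrow> fob F a = fob G a" "\<And>f. f \<in> Mor (fdom G) \<Longrightarrow> fmor F f = fmor G f"
  shows "F = G"
proof -
  have "fob F = fob G" "fmor F = fmor G"
    using assms functorD(9,10)[OF assms(1) refl refl] functorD(9,10)[OF assms(2) refl refl]
    by (auto intro: extensionalityI)
  then show ?thesis using assms by (intro func.equality) auto
qed

lemma functor_comp:
  assumes "is_functor F" "is_functor G" "fcod F = fdom G"
  shows "is_functor (func_comp G F)"
  unfolding func_comp_def
  by (rule functor_mk_func)
    (simp_all add: functorD[OF assms(1) refl assms(3)] functorD[OF assms(2) refl refl])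

lemma functor_id: "category C \<Longrightarrow> is_functor (func_id C)"
  unfolding func_id_def by (rule functor_mk_func) auto

lemma func_comp_assoc:
  assumes "is_functor F" "is_functor G" "is_functor H" "fcod F = fdom G" "fcod G = fdom H"
  shows "func_comp H (func_comp G F) = func_comp (func_comp H G) F"
  using assms by (intro functor_eqI)
    (auto intro!: functor_comp simp: functorD[OF assms(1) refl assms(4)])

lemma func_comp_id:
  assumes "is_functor F"
  shows "func_comp F (func_id (fdom F)) = F" "func_comp (func_id (fcod F)) F = F"
  using assms functorD[OF assms refl refl]
  by (auto intro!: functor_eqI functor_comp functor_id[unfolded func_id_def]
      simp: func_id_def)

lemma fdom_func_id [simp]: "fdom (func_id C) = C" and fcod_func_id [simp]: "fcod (func_id C) = C"
  by (simp_all add: func_id_def)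

lemma Cat_simps [simp]:
  "Ob (Cat elts) = {C. U_category elts C}"
  "F \<in> Mor (Cat elts) \<longleftrightarrow> is_functor F \<and> U_category elts (fdom F) \<and> U_category elts (fcod F)"
  "F \<in> Mor (Cat elts) \<Longrightarrow> Sc (Cat elts) F = fdom F"
  "F \<in> Mor (Cat elts) \<Longrightarrow> Tg (Cat elts) F = fcod F"
  "U_category elts C \<Longrightarrow> Idt (Cat elts) C = func_id C"
  "\<lbrakk>F \<in> Mor (Cat elts); G \<in> Mor (Cat elts); fdom G = fcod F\<rbrakk> \<Longrightarrow> Cmp (Cat elts) G F = func_comp G F"
  unfolding Cat_def by simp_all

lemma category_Cat: "category (Cat elts)"
proof -
  have cat: "U_category elts C \<Longrightarrow> category C" for C by (simp add: U_category_def)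
  show ?thesis
    unfolding category_def Hom_def
    by (auto simp: Cat_def cat functor_id functor_comp func_comp_id func_comp_assoc
        intro: func_comp_id)
qed

lemma nat_transD:
  assumes "nat_trans F G \<tau>"
  shows "is_functor F" "is_functor G" "fdom F = fdom G" "fcod F = fcod G"
    "a \<in> Ob (fdom G) \<Longrightarrow> \<tau> a \<in> Hom (fcod G) (fob F a) (fob G a)"
    "f \<in> Mor (fdom G) \<Longrightarrow> Cmp (fcod G) (\<tau> (Tg (fdom G) f)) (fmor F f) =
        Cmp (fcod G) (fmor G f) (\<tau> (Sc (fdom G) f))"
  using assms unfolding nat_trans_def by (auto simp: PiE_def Pi_def)

lemma nat_trans_whisker:
  assumes \<tau>: "nat_trans F G \<tau>" and H: "is_functor H" "fcod H = fdom F"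
  shows "nat_trans (func_comp F H) (func_comp G H) (\<lambda>a\<in>Ob (fdom H). \<tau> (fob H a))"
proof -
  note GF = nat_transD(1-4)[OF \<tau>]
  note D = functorD[OF H(1) refl H(2)]
  have nat: "Cmp (fcod G) (\<tau> (fob H (Tg (fdom H) f))) (fmor F (fmor H f)) =
    Cmp (fcod G) (fmor G (fmor H f)) (\<tau> (fob H (Sc (fdom H) f)))" if "f \<in> Mor (fdom H)" for f
    using that GF D(4-6)[of f] nat_transD(6)[OF \<tau>, of "fmor H f"] by simp
  have hom: "\<tau> (fob H a) \<in> Hom (fcod G) (fob F (fob H a)) (fob G (fob H a))"
    if "a \<in> Ob (fdom H)" for a
    using that GF D(3)[of a] nat_transD(5)[OF \<tau>] by simp
  show ?thesis
    using H nat hom GF unfolding nat_trans_def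
    by (auto simp: functor_comp categoryD D(1))
qed

section \<open>Quotients presented by loosely composable arrows\<close>

text \<open>
  A description of a quotient category by arrows that are composable only up to equivalence of
  objects. The arrows in \<open>W\<close> run between objects in \<open>A\<close>; \<open>s\<close>, \<open>t\<close>, \<open>e\<close>, \<open>m\<close> are source, target,
  identities and composition, and \<open>p\<close>, \<open>q\<close> send objects and arrows to their classes.
  For a Riguet quotient \<open>W\<close> consists of the morphisms, and \<open>m g f\<close> is \<open>g \<circ> h\<close> for some
  \<open>h\<close> related to \<open>f\<close>; for a generalized quotient \<open>W\<close> consists of the sequences, and \<open>m\<close> is concatenation.
  The equations determine \<open>Q\<close> completely, because every value outside the domains is undefined.
\<close>

definition presents where
  "presents Q A W s t e m p q \<longleftrightarrow>
     Ob Q = p ` A \<and> Mor Q = q ` W \<and>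
     Sc Q \<in> extensional (Mor Q) \<and> Tg Q \<in> extensional (Mor Q) \<and> Idt Q \<in> extensional (Ob Q) \<and>
     (\<forall>f g. \<not> (f \<in> Mor Q \<and> g \<in> Mor Q \<and> Sc Q g = Tg Q f) \<longrightarrow> Cmp Q g f = undefined) \<and>
     (\<forall>u\<in>W. Sc Q (q u) = p (s u) \<and> Tg Q (q u) = p (t u)) \<and>
     (\<forall>a\<in>A. Idt Q (p a) = q (e a)) \<and>
     (\<forall>u\<in>W. \<forall>v\<in>W. p (s v) = p (t u) \<longrightarrow> Cmp Q (q v) (q u) = q (m v u))"

text \<open>
  Since renaming only composes the class maps \<open>p\<close>, \<open>q\<close> with injections, it suffices to compute a
  quotient with sets as classes, and the laws can be checked for the codes in the universe.
\<close>

lemma presents_transport: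
  assumes P: "presents Q A W s t e m p q"
    and W: "\<And>u. u \<in> W \<Longrightarrow> s u \<in> A" "\<And>u. u \<in> W \<Longrightarrow> t u \<in> A"
    and inj: "inj_on x (Ob Q)" "inj_on y (Mor Q)"
  shows "presents (transport x y Q) A W s t e m (\<lambda>a. x (p a)) (\<lambda>u. y (q u))"
proof -
  have Q: "Ob Q = p ` A" "Mor Q = q ` W" using P by (simp_all add: presents_def)
  have [simp]: "inv_into (q ` W) y (y (q u)) = q u" if "u \<in> W" for u
    using that inj Q by (intro inv_into_f_f) auto
  have [simp]: "inv_into (p ` A) x (x (p a)) = p a" if "a \<in> A" for a
    using that inj Q by (intro inv_into_f_f) auto
  have x: "x (p a) = x (p b) \<longleftrightarrow> p a = p b" if "a \<in> A" "b \<in> A" for a b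
    using that Q inj by (auto simp: inj_on_eq_iff)
  show ?thesis
    using P W unfolding transport_def presents_def
    by (auto simp: image_image x)
qed

text \<open>
  The unit and associativity laws hold for classes of arrows rather than for arrows, and composability of \<open>u\<close> and \<open>v\<close>
  is read off from \<open>p\<close>. Compatibility of \<open>m\<close> with the fibres of \<open>q\<close> is already contained
  in \<open>presents\<close>, where \<open>Cmp Q\<close> is a function of classes.
\<close>

locale presentation =
  fixes Q :: "('o, 'm) cat" and A :: "'a set" and W :: "'w set"
    and s t :: "'w \<Rightarrow> 'a" and e :: "'a \<Rightarrow> 'w" and m :: "'w \<Rightarrow> 'w \<Rightarrow> 'w"
    and p :: "'a \<Rightarrow> 'o" and q :: "'w \<Rightarrow> 'm"
  assumes presents: "presents Q A W s t e m p q"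
    and st_closed: "u \<in> W \<Longrightarrow> s u \<in> A" "u \<in> W \<Longrightarrow> t u \<in> A"
    and e_closed: "a \<in> A \<Longrightarrow> e a \<in> W" "a \<in> A \<Longrightarrow> s (e a) = a" "a \<in> A \<Longrightarrow> t (e a) = a"
    and m_closed: "\<lbrakk>u \<in> W; v \<in> W; p (s v) = p (t u)\<rbrakk> \<Longrightarrow> m v u \<in> W"
    and m_st: "\<lbrakk>u \<in> W; v \<in> W; p (s v) = p (t u)\<rbrakk> \<Longrightarrow> s (m v u) = s u"
      "\<lbrakk>u \<in> W; v \<in> W; p (s v) = p (t u)\<rbrakk> \<Longrightarrow> t (m v u) = t v"
    and unit: "u \<in> W \<Longrightarrow> q (m u (e (s u))) = q u" "u \<in> W \<Longrightarrow> q (m (e (t u)) u) = q u"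
    and assoc: "\<lbrakk>u \<in> W; v \<in> W; w \<in> W; p (s v) = p (t u); p (s w) = p (t v)\<rbrakk> \<Longrightarrow>
      q (m w (m v u)) = q (m (m w v) u)"
begin

lemma Q_simps:
  "Ob Q = p ` A" "Mor Q = q ` W"
  "u \<in> W \<Longrightarrow> Sc Q (q u) = p (s u)" "u \<in> W \<Longrightarrow> Tg Q (q u) = p (t u)"
  "a \<in> A \<Longrightarrow> Idt Q (p a) = q (e a)"
  "\<lbrakk>u \<in> W; v \<in> W; p (s v) = p (t u)\<rbrakk> \<Longrightarrow> Cmp Q (q v) (q u) = q (m v u)"
  using presents by (auto simp: presents_def)

lemma category_Q: "category Q"
  using presents st_closed e_closed m_closed m_st unit assoc
  unfolding presents_def category_def Hom_def
  by (auto simp: PiE_def Pi_def)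

text \<open>
  The universal property. Since \<open>p\<close> and \<open>q\<close> are onto, a map is well defined on the quotient
  as soon as it is constant on their fibres.
\<close>

lemma functor_out:
  assumes E: "category E"
    and FA: "\<And>a. a \<in> A \<Longrightarrow> x a \<in> Ob E" and FW: "\<And>u. u \<in> W \<Longrightarrow> y u \<in> Mor E"
    and st: "\<And>u. u \<in> W \<Longrightarrow> Sc E (y u) = x (s u)" "\<And>u. u \<in> W \<Longrightarrow> Tg E (y u) = x (t u)"
    and id: "\<And>a. a \<in> A \<Longrightarrow> y (e a) = Idt E (x a)"
    and cmp: "\<And>u v. \<lbrakk>u \<in> W; v \<in> W; p (s v) = p (t u)\<rbrakk> \<Longrightarrow> y (m v u) = Cmp E (y v) (y u)"
    and px: "\<And>a b. \<lbrakk>a \<in> A; b \<in> A; p a = p b\<rbrakk> \<Longrightarrow> x a = x b"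
    and qy: "\<And>u v. \<lbrakk>u \<in> W; v \<in> W; q u = q v\<rbrakk> \<Longrightarrow> y u = y v"
  obtains G where "is_functor G" "fdom G = Q" "fcod G = E"
    "\<And>a. a \<in> A \<Longrightarrow> fob G (p a) = x a" "\<And>u. u \<in> W \<Longrightarrow> fmor G (q u) = y u"
proof -
  let ?x = "\<lambda>X. x (inv_into A p X)" and ?y = "\<lambda>X. y (inv_into W q X)"
  have [simp]: "?x (p a) = x a" if "a \<in> A" for a
    using that by (intro px) (auto intro: inv_into_into f_inv_into_f)
  have [simp]: "?y (q u) = y u" if "u \<in> W" for u
    using that by (intro qy) (auto intro: inv_into_into f_inv_into_f)
  show ?thesis
  proof
    show "is_functor (mk_func Q E ?x ?y)"
      by (rule functor_mk_func[OF category_Q E])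
         (auto simp: Q_simps FA FW st id cmp st_closed e_closed m_closed)
  qed (auto simp: Q_simps)
qed

end

section \<open>Riguet quotients\<close>

locale riguet_cong =
  fixes C :: "('o, 'm) cat" and \<Phi> :: "('o, 'm) riguet"
  assumes category_C: "category C" and riguet: "riguet_congruence C \<Phi>"
begin

definition rsim :: "('m \<times> 'm) set" where
  "rsim = {(f, f'). \<exists>a b a' b'. (f, f') \<in> rfl \<Phi> a b a' b'}"

lemmas riguet_conjuncts = riguet[unfolded riguet_congruence_def]
lemmas equiv_rob = riguet_conjuncts[THEN conjunct1]
lemmas riguet_rest = riguet_conjuncts[THEN conjunct2]
lemmas rfl_subset = riguet_rest[THEN conjunct1, rule_format, OF conjI]
lemmas rfl_empty = riguet_rest[THEN conjunct2, THEN conjunct1, rule_format]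
lemmas riguet_axioms =
  riguet_rest[THEN conjunct2, THEN conjunct2]
lemmas rfl_Idt = riguet_axioms[THEN conjunct1, rule_format]
lemmas rfl_refl = riguet_axioms[THEN conjunct2, THEN conjunct1, rule_format]
lemmas rfl_sym = riguet_axioms[THEN conjunct2, THEN conjunct2, THEN conjunct1, rule_format]
lemmas riguet_axioms' = riguet_axioms[THEN conjunct2, THEN conjunct2, THEN conjunct2]
lemmas rfl_trans = riguet_axioms'[THEN conjunct1, rule_format, OF conjI]
lemmas rfl_Cmp = riguet_axioms'[THEN conjunct2, THEN conjunct1, rule_format, OF conjI]
lemmas rfl_lift = riguet_axioms'[THEN conjunct2, THEN conjunct2, rule_format, OF _ conjI]

lemma rfl_index:
  assumes "(f, f') \<in> rfl \<Phi> a b a' b'"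
  shows "(a, a') \<in> rob \<Phi>" "(b, b') \<in> rob \<Phi>" "f \<in> Hom C a b" "f' \<in> Hom C a' b'"
proof -
  show *: "(a, a') \<in> rob \<Phi>" "(b, b') \<in> rob \<Phi>"
    using assms rfl_empty by (metis empty_iff)+
  then have "rfl \<Phi> a b a' b' \<subseteq> Hom C a b \<times> Hom C a' b'" by (rule rfl_subset)
  with assms show "f \<in> Hom C a b" "f' \<in> Hom C a' b'" by auto
qed

text \<open>
  Since hom-sets are disjoint, the indices of the component containing a pair can be recovered from the pair.
  The family \<open>rfl \<Phi>\<close> is thus the same as the single relation \<open>rsim\<close>.
\<close>

lemma rfl_iff:
  "(f, f') \<in> rfl \<Phi> a b a' b' \<longleftrightarrow>
     (f, f') \<in> rsim \<and> Sc C f = a \<and> Tg C f = b \<and> Sc C f' = a' \<and> Tg C f' = b'"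
  using rfl_index by (fastforce simp: rsim_def Hom_def)

lemma rsimD:
  assumes "(f, f') \<in> rsim"
  shows "f \<in> Mor C" "f' \<in> Mor C" "(Sc C f, Sc C f') \<in> rob \<Phi>" "(Tg C f, Tg C f') \<in> rob \<Phi>"
  using assms rfl_index by (fastforce simp: rsim_def Hom_def)+

lemma equiv_rsim: "equiv (Mor C) rsim"
proof (rule equivI)
  show "rsim \<subseteq> Mor C \<times> Mor C" using rsimD by auto
  show "refl_on (Mor C) rsim"
  proof (rule refl_onI)
    fix f assume f: "f \<in> Mor C"
    then have "Sc C f \<in> Ob C" "Tg C f \<in> Ob C" "f \<in> Hom C (Sc C f) (Tg C f)"
      using categoryD[OF category_C] by (auto simp: Hom_def)
    then have "(f, f) \<in> rfl \<Phi> (Sc C f) (Tg C f) (Sc C f) (Tg C f)"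
      by (rule rfl_refl)
    then show "(f, f) \<in> rsim" by (simp add: rfl_iff)
  qed
  show "sym rsim"
  proof (rule symI)
    fix f f' assume "(f, f') \<in> rsim"
    then have "(f, f') \<in> rfl \<Phi> (Sc C f) (Tg C f) (Sc C f') (Tg C f')" by (simp add: rfl_iff)
    then have "(f', f) \<in> rfl \<Phi> (Sc C f') (Tg C f') (Sc C f) (Tg C f)"
      by (rule rfl_sym)
    then show "(f', f) \<in> rsim" by (simp add: rfl_iff)
  qed
  show "trans rsim"
  proof (rule transI)
    fix f f' f'' assume "(f, f') \<in> rsim" "(f', f'') \<in> rsim"
    then have "(f, f') \<in> rfl \<Phi> (Sc C f) (Tg C f) (Sc C f') (Tg C f')"
      "(f', f'') \<in> rfl \<Phi> (Sc C f') (Tg C f') (Sc C f'') (Tg C f'')" by (simp_all add: rfl_iff)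
    then have "(f, f'') \<in> rfl \<Phi> (Sc C f) (Tg C f) (Sc C f'') (Tg C f'')"
      by (rule rfl_trans)
    then show "(f, f'') \<in> rsim" by (simp add: rfl_iff)
  qed
qed

lemma rsim_Idt: "(a, b) \<in> rob \<Phi> \<Longrightarrow> (Idt C a, Idt C b) \<in> rsim"
proof -
  assume "(a, b) \<in> rob \<Phi>"
  then have "(Idt C a, Idt C b) \<in> rfl \<Phi> a a b b"
    by (rule rfl_Idt)
  then show ?thesis by (simp add: rfl_iff)
qed

lemma rsim_Cmp:
  assumes "(f, f') \<in> rsim" "(g, g') \<in> rsim" "Sc C g = Tg C f" "Sc C g' = Tg C f'"
  shows "(Cmp C g f, Cmp C g' f') \<in> rsim"
proof -
  have "(f, f') \<in> rfl \<Phi> (Sc C f) (Tg C f) (Sc C f') (Tg C f')"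
    "(g, g') \<in> rfl \<Phi> (Tg C f) (Tg C g) (Tg C f') (Tg C g')" using assms by (simp_all add: rfl_iff)
  then have "(Cmp C g f, Cmp C g' f') \<in> rfl \<Phi> (Sc C f) (Tg C g) (Sc C f') (Tg C g')"
    by (rule rfl_Cmp)
  then show ?thesis by (simp add: rfl_iff)
qed

lemma rsim_lift:
  assumes "f \<in> Mor C" "(Sc C f, a') \<in> rob \<Phi>" "(Tg C f, b') \<in> rob \<Phi>"
  obtains f' where "f' \<in> Mor C" "Sc C f' = a'" "Tg C f' = b'" "(f, f') \<in> rsim"
proof -
  have "f \<in> Hom C (Sc C f) (Tg C f)" using assms by (simp add: Hom_def)
  then obtain f' where "f' \<in> Hom C a' b'" "(f, f') \<in> rfl \<Phi> (Sc C f) (Tg C f) a' b'"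
    using rfl_lift assms by blast
  with that show ?thesis by (auto simp: Hom_def rfl_iff)
qed

text \<open>
  By the lifting axiom a morphism is related to one with the same source that
  ends at any given equivalent object. This makes classes \<open>[f]\<close>, \<open>[g]\<close>
  composable as soon as the target of \<open>f\<close> and the source of \<open>g\<close> are equivalent.
\<close>

definition retarget :: "'m \<Rightarrow> 'o \<Rightarrow> 'm" where
  "retarget f b = (SOME h. h \<in> Mor C \<and> Sc C h = Sc C f \<and> Tg C h = b \<and> (f, h) \<in> rsim)"

definition rcomp :: "'m \<Rightarrow> 'm \<Rightarrow> 'm" where
  "rcomp g f = Cmp C g (retarget f (Sc C g))"

lemma retarget:
  assumes "f \<in> Mor C" "(Tg C f, b) \<in> rob \<Phi>"
  shows "retarget f b \<in> Mor C" "Sc C (retarget f b) = Sc C f" "Tg C (retarget f b) = b"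
    "(f, retarget f b) \<in> rsim"
proof -
  have "(Sc C f, Sc C f) \<in> rob \<Phi>"
    using assms categoryD(1)[OF category_C] equiv_rob by (meson equivE refl_onD)
  then have "\<exists>h. h \<in> Mor C \<and> Sc C h = Sc C f \<and> Tg C h = b \<and> (f, h) \<in> rsim"
    using rsim_lift[OF assms(1) _ assms(2)] by metis
  from someI_ex[OF this]
  show "retarget f b \<in> Mor C" "Sc C (retarget f b) = Sc C f" "Tg C (retarget f b) = b"
    "(f, retarget f b) \<in> rsim" by (simp_all add: retarget_def)
qed

lemma rob_class_eq_iff:
  "a \<in> Ob C \<Longrightarrow> b \<in> Ob C \<Longrightarrow> rob_class \<Phi> a = rob_class \<Phi> b \<longleftrightarrow> (a, b) \<in> rob \<Phi>"
  unfolding rob_class_def by (rule eq_equiv_class_iff[OF equiv_rob])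

text \<open>
  Relation \<open>rsim\<close> preserves the classes of source and target, so cutting it down to
  the morphisms between two fixed classes does not change the classes of morphisms.
\<close>

lemma class_rel_Image:
  assumes "A \<in> Ob C // rob \<Phi>" "B \<in> Ob C // rob \<Phi>" "f \<in> class_hom C A B"
  shows "class_rel \<Phi> A B `` {f} = rsim `` {f}"
proof -
  have "Sc C f \<in> A" "Tg C f \<in> B" using assms by (auto simp: class_hom_def Hom_def)
  moreover have "Sc C f' \<in> A" "Tg C f' \<in> B" if "(f, f') \<in> rsim" for f'
    using rsimD(3,4)[OF that] assms calculation
    by (metis equiv_rob in_quotient_imp_closed)+
  ultimately show ?thesis by (auto simp: class_rel_def rfl_iff)
qed

lemma rob_class_quotient: "a \<in> Ob C \<Longrightarrow> rob_class \<Phi> a \<in> Ob C // rob \<Phi>"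
  unfolding rob_class_def by (rule quotientI)

lemma class_hom_self: "f \<in> Mor C \<Longrightarrow> f \<in> class_hom C (rob_class \<Phi> (Sc C f)) (rob_class \<Phi> (Tg C f))"
  using categoryD(1,2)[OF category_C, of f] equiv_class_self[OF equiv_rob]
  by (auto simp: class_hom_def Hom_def rob_class_def)

lemma rfl_class_eq: "f \<in> Mor C \<Longrightarrow> rfl_class C \<Phi> f = rsim `` {f}"
  unfolding rfl_class_def
  by (intro class_rel_Image rob_class_quotient class_hom_self categoryD[OF category_C])

lemma rfl_class_eq_iff:
  "f \<in> Mor C \<Longrightarrow> g \<in> Mor C \<Longrightarrow> rfl_class C \<Phi> f = rfl_class C \<Phi> g \<longleftrightarrow> (f, g) \<in> rsim"
  by (simp add: rfl_class_eq eq_equiv_class_iff[OF equiv_rsim])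

lemma quotient_morphisms:
  "(\<Union>A \<in> Ob C // rob \<Phi>. \<Union>B \<in> Ob C // rob \<Phi>. class_hom C A B // class_rel \<Phi> A B) =
     rfl_class C \<Phi> ` Mor C" (is "?L = ?R")
proof
  show "?L \<subseteq> ?R"
  proof
    fix X assume "X \<in> ?L"
    then obtain A B where AB: "A \<in> Ob C // rob \<Phi>" "B \<in> Ob C // rob \<Phi>"
      and "X \<in> class_hom C A B // class_rel \<Phi> A B" by auto
    then obtain f where *: "A \<in> Ob C // rob \<Phi>" "B \<in> Ob C // rob \<Phi>" "f \<in> class_hom C A B"
      and "X = class_rel \<Phi> A B `` {f}" by (auto elim: quotientE)
    then have "X = rsim `` {f}" by (simp add: class_rel_Image)
    moreover have "f \<in> Mor C" using *(3) by (auto simp: class_hom_def Hom_def)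
    ultimately show "X \<in> ?R" by (auto simp: rfl_class_eq)
  qed
  show "?R \<subseteq> ?L"
  proof
    fix X assume "X \<in> ?R"
    then obtain f where f: "f \<in> Mor C" and X: "X = rfl_class C \<Phi> f" by auto
    have "X \<in> class_hom C (rob_class \<Phi> (Sc C f)) (rob_class \<Phi> (Tg C f)) //
        class_rel \<Phi> (rob_class \<Phi> (Sc C f)) (rob_class \<Phi> (Tg C f))"
      unfolding X rfl_class_def by (intro quotientI class_hom_self f)
    then show "X \<in> ?L" using f rob_class_quotient categoryD(1,2)[OF category_C] by blast
  qed
qed

text \<open>
  Each definite description in the quotient picks the value at one representative. The value is the same
  for every representative: for sources, targets and identities by the index condition and the identity
  axiom, for composites because \<open>rsim\<close> is compatible with composition.
\<close>

lemma presents_riguet_quotient: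
  "presents (riguet_quotient C \<Phi>) (Ob C) (Mor C) (Sc C) (Tg C) (Idt C) rcomp
     (rob_class \<Phi>) (rfl_class C \<Phi>)"
proof -
  note cat = categoryD[OF category_C]
  have self: "f \<in> rfl_class C \<Phi> f" if "f \<in> Mor C" for f
    using that equiv_class_self[OF equiv_rsim] by (simp add: rfl_class_eq)
  have member: "rob_class \<Phi> (Sc C g) = rob_class \<Phi> (Sc C f)" "rob_class \<Phi> (Tg C g) = rob_class \<Phi> (Tg C f)"
    if "f \<in> Mor C" "g \<in> rfl_class C \<Phi> f" for f g
  proof -
    have "(f, g) \<in> rsim" using that by (simp add: rfl_class_eq)
    from rsimD[OF this] show "rob_class \<Phi> (Sc C g) = rob_class \<Phi> (Sc C f)"
      "rob_class \<Phi> (Tg C g) = rob_class \<Phi> (Tg C f)"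
      using rob_class_eq_iff cat(1,2) by metis+
  qed
  have ob: "Ob C // rob \<Phi> = rob_class \<Phi> ` Ob C"
    by (auto simp: quotient_def rob_class_def)
  have sc: "(THE A. \<exists>f\<in>rfl_class C \<Phi> f. A = rob_class \<Phi> (Sc C f)) = rob_class \<Phi> (Sc C f)"
    if "f \<in> Mor C" for f
    by (rule the_equality) (use self[OF that] member[OF that] in blast)+
  have tg: "(THE A. \<exists>f\<in>rfl_class C \<Phi> f. A = rob_class \<Phi> (Tg C f)) = rob_class \<Phi> (Tg C f)"
    if "f \<in> Mor C" for f
    by (rule the_equality) (use self[OF that] member[OF that] in blast)+
  have idt: "(THE X. \<exists>b\<in>rob_class \<Phi> a. X = rfl_class C \<Phi> (Idt C b)) = rfl_class C \<Phi> (Idt C a)"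
    if "a \<in> Ob C" for a
  proof (intro the_equality)
    show "\<exists>b\<in>rob_class \<Phi> a. rfl_class C \<Phi> (Idt C a) = rfl_class C \<Phi> (Idt C b)"
      using that equiv_class_self[OF equiv_rob] by (auto simp: rob_class_def)
  next
    fix X assume "\<exists>b\<in>rob_class \<Phi> a. X = rfl_class C \<Phi> (Idt C b)"
    then obtain b where "(a, b) \<in> rob \<Phi>" "X = rfl_class C \<Phi> (Idt C b)" by (auto simp: rob_class_def)
    then show "X = rfl_class C \<Phi> (Idt C a)"
      using rsim_Idt[of a b] rsimD[OF rsim_Idt, of a b] rfl_class_eq_iff by metis
  qed
  have cmp: "(THE Z. \<exists>a' b' b'' c' f g h.
          f \<in> Hom C a' b' \<and> g \<in> Hom C b'' c' \<and> (b', b'') \<in> rob \<Phi> \<and>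
          rfl_class C \<Phi> u = rfl_class C \<Phi> f \<and> rfl_class C \<Phi> v = rfl_class C \<Phi> g \<and>
          h \<in> Hom C a' b'' \<and> (f, h) \<in> rfl \<Phi> a' b' a' b'' \<and>
          Z = rfl_class C \<Phi> (Cmp C g h)) = rfl_class C \<Phi> (rcomp v u)"
    (is "The ?P = _")
    if u: "u \<in> Mor C" and v: "v \<in> Mor C" and uv: "rob_class \<Phi> (Sc C v) = rob_class \<Phi> (Tg C u)" for u v
  proof (rule the_equality)
    have "(Tg C u, Sc C v) \<in> rob \<Phi>"
      using u v uv rob_class_eq_iff[of "Tg C u" "Sc C v"] cat(1,2) by simp
    note h = retarget[OF u this]
    show "?P (rfl_class C \<Phi> (rcomp v u))"
      unfolding rcomp_def using u v h \<open>(Tg C u, Sc C v) \<in> rob \<Phi>\<close>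
      by (intro exI[of _ "Sc C u"] exI[of _ "Tg C u"] exI[of _ "Sc C v"] exI[of _ "Tg C v"]
          exI[of _ u] exI[of _ v] exI[of _ "retarget u (Sc C v)"]) (simp add: Hom_def rfl_iff)
    fix Z assume "?P Z"
    then obtain f g k where f: "f \<in> Mor C" "rfl_class C \<Phi> u = rfl_class C \<Phi> f"
      and g: "g \<in> Mor C" "rfl_class C \<Phi> v = rfl_class C \<Phi> g"
      and k: "(f, k) \<in> rsim" "k \<in> Mor C" "Sc C g = Tg C k" and Z: "Z = rfl_class C \<Phi> (Cmp C g k)"
      by (auto simp: Hom_def rfl_iff)
    have "(u, f) \<in> rsim" "(v, g) \<in> rsim" using u v f g rfl_class_eq_iff by auto
    then have "(k, retarget u (Sc C v)) \<in> rsim" "(g, v) \<in> rsim"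
      using k h(4) equiv_rsim by (meson equivE symE transE)+
    then have "(Cmp C g k, rcomp v u) \<in> rsim"
      unfolding rcomp_def using k h by (intro rsim_Cmp) auto
    then show "Z = rfl_class C \<Phi> (rcomp v u)"
      using rfl_class_eq_iff rsimD(1,2) Z by blast
  qed
  show ?thesis
    unfolding presents_def riguet_quotient_def quotient_morphisms
    by (auto simp: ob sc tg idt cmp cat simp del: ex_simps)
qed

end

text \<open>
  In a category that is small with respect to the universe, all classes are small. Then passing from classes to
  their codes is injective.
\<close>

locale small_riguet = universe elts + riguet_cong C \<Phi>
  for elts :: "'u \<Rightarrow> 'u set" and C :: "('u, 'u) cat" and \<Phi> :: "('u, 'u) riguet" +
  assumes small_C: "U_category elts C"
begin

abbreviation "p \<equiv> \<lambda>a. vset elts (rob_class \<Phi> a)"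
abbreviation "q \<equiv> \<lambda>f. vset elts (rfl_class C \<Phi> f)"

lemma small_Ob: "small (Ob C)" and small_Mor: "small (Mor C)"
  using small_C by (simp_all add: U_category_def small_def)

lemma small_rob_class: "small (rob_class \<Phi> a)"
  by (rule small_subset[OF small_Ob]) (use equiv_rob in \<open>auto simp: rob_class_def equiv_def\<close>)

lemma small_rfl_class: "f \<in> Mor C \<Longrightarrow> small (rfl_class C \<Phi> f)"
  by (rule small_subset[OF small_Mor]) (auto simp: rfl_class_eq dest: rsimD)

lemma p_eq_iff: "a \<in> Ob C \<Longrightarrow> b \<in> Ob C \<Longrightarrow> p a = p b \<longleftrightarrow> (a, b) \<in> rob \<Phi>"
  by (simp add: vset_eq_iff small_rob_class rob_class_eq_iff)

lemma q_eq_iff: "f \<in> Mor C \<Longrightarrow> g \<in> Mor C \<Longrightarrow> q f = q g \<longleftrightarrow> (f, g) \<in> rsim"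
  by (simp add: vset_eq_iff small_rfl_class rfl_class_eq_iff)

lemma presents_RQuot:
  "presents (RQuot elts C \<Phi>) (Ob C) (Mor C) (Sc C) (Tg C) (Idt C) rcomp p q"
  unfolding RQuot_def
proof (rule presents_transport[OF presents_riguet_quotient])
  show "inj_on (vset elts) (Ob (riguet_quotient C \<Phi>))" "inj_on (vset elts) (Mor (riguet_quotient C \<Phi>))"
    using presents_riguet_quotient
    by (auto simp: presents_def inj_on_def vset_eq_iff small_rob_class small_rfl_class)
qed (simp_all add: categoryD[OF category_C])

text \<open>
  For morphisms that are composable in \<open>C\<close> the choice of \<open>h\<close> in \<open>rcomp\<close> does not matter: \<open>f\<close> itself is
  an admissible choice. Therefore \<open>RProj\<close> preserves composition.
\<close>

lemma q_rcomp:
  assumes "f \<in> Mor C" "g \<in> Mor C" "Sc C g = Tg C f"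
  shows "q (rcomp g f) = q (Cmp C g f)"
proof -
  note cat = categoryD[OF category_C]
  have "(Tg C f, Sc C g) \<in> rob \<Phi>" using assms cat(2) equiv_rob by (metis equivE refl_onD)
  note h = retarget[OF assms(1) this]
  have "(g, g) \<in> rsim" using assms(2) equiv_rsim by (meson equivE refl_onD)
  then have "(Cmp C g f, rcomp g f) \<in> rsim"
    unfolding rcomp_def using h assms by (intro rsim_Cmp) auto
  then show ?thesis using q_eq_iff rsimD by metis
qed

sublocale presentation "RQuot elts C \<Phi>" "Ob C" "Mor C" "Sc C" "Tg C" "Idt C" rcomp p q
proof
  note cat = categoryD[OF category_C]
  have rob: "(Tg C f, Sc C g) \<in> rob \<Phi>" if "f \<in> Mor C" "g \<in> Mor C" "p (Sc C g) = p (Tg C f)" for f g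
    using that p_eq_iff cat(1,2) by metis
  fix u v w
  show "presents (RQuot elts C \<Phi>) (Ob C) (Mor C) (Sc C) (Tg C) (Idt C) rcomp p q"
    by (rule presents_RQuot)
  {
    assume u: "u \<in> Mor C" and v: "v \<in> Mor C" and uv: "p (Sc C v) = p (Tg C u)"
    note h = retarget[OF u rob[OF u v uv]]
    show uv_simps: "rcomp v u \<in> Mor C" "Sc C (rcomp v u) = Sc C u" "Tg C (rcomp v u) = Tg C v"
      unfolding rcomp_def using h v by (simp_all add: cat)
    assume w: "w \<in> Mor C" and vw: "p (Sc C w) = p (Tg C v)"
    note h' = retarget[OF v rob[OF v w vw]]
    note h'' = retarget[OF uv_simps(1), unfolded uv_simps, OF rob[OF v w vw]]
    \<comment> \<open>With \<open>u'\<close>, \<open>v'\<close> the retargeted morphisms, \<open>(w \<circ> v') \<circ> u'\<close> is the right-hand side itself;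
      the left-hand side retargets \<open>v \<circ> u'\<close>, which is related to \<open>v' \<circ> u'\<close>.\<close>
    have "(retarget u (Sc C v), retarget u (Sc C v)) \<in> rsim" "(w, w) \<in> rsim"
      using h(1) w equiv_rsim by (meson equivE refl_onD)+
    then have "(Cmp C v (retarget u (Sc C v)), Cmp C (retarget v (Sc C w)) (retarget u (Sc C v))) \<in> rsim"
      using h h' by (intro rsim_Cmp) auto
    then have "(Cmp C (retarget v (Sc C w)) (retarget u (Sc C v)), retarget (rcomp v u) (Sc C w)) \<in> rsim"
      using h''(4) equiv_rsim unfolding rcomp_def by (meson equivE symE transE)
    then have "(Cmp C w (Cmp C (retarget v (Sc C w)) (retarget u (Sc C v))), rcomp w (rcomp v u)) \<in> rsim"
      unfolding rcomp_def[of w "rcomp v u"] using \<open>(w, w) \<in> rsim\<close> h h' h'' w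
      by (intro rsim_Cmp) (simp_all add: cat)
    moreover have "Cmp C w (Cmp C (retarget v (Sc C w)) (retarget u (Sc C v))) = rcomp (rcomp w v) u"
      unfolding rcomp_def using h h' w v by (simp add: cat)
    ultimately show "q (rcomp w (rcomp v u)) = q (rcomp (rcomp w v) u)"
      using q_eq_iff rsimD(1,2) by metis
  }
  show "q (rcomp u (Idt C (Sc C u))) = q u" "q (rcomp (Idt C (Tg C u)) u) = q u" if "u \<in> Mor C"
    using that q_rcomp by (simp_all add: cat)
qed (simp_all add: categoryD[OF category_C])

lemma U_category_RQuot: "U_category elts (RQuot elts C \<Phi>)"
  using category_Q small_image[OF small_Ob, of p] small_image[OF small_Mor, of q]
  by (simp add: U_category_def Q_simps small_def)

lemma functor_RProj: "is_functor (RProj elts C \<Phi>)"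
  unfolding RProj_def
  by (rule functor_mk_func)
    (simp_all add: category_C category_Q Q_simps q_rcomp categoryD[OF category_C])

text \<open>
  The projection is onto on objects and on morphisms, hence cancellable.
\<close>

lemma RProj_cancel:
  assumes "is_functor G" "is_functor H" "fdom G = RQuot elts C \<Phi>" "fdom H = RQuot elts C \<Phi>"
    "fcod G = fcod H" "func_comp G (RProj elts C \<Phi>) = func_comp H (RProj elts C \<Phi>)"
  shows "G = H"
proof -
  have "fob G (p a) = fob H (p a)" if "a \<in> Ob C" for a
    using arg_cong[OF assms(6), of "\<lambda>F. fob F a"] that by (simp add: RProj_def)
  moreover have "fmor G (q f) = fmor H (q f)" if "f \<in> Mor C" for f
    using arg_cong[OF assms(6), of "\<lambda>F. fmor F f"] that by (simp add: RProj_def)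
  ultimately show ?thesis
    using assms(1-5) by (intro functor_eqI) (auto simp: Q_simps)
qed

text \<open>
  \<open>F\<close> turns \<open>rcomp v u\<close> into the composite of \<open>F v\<close> and \<open>F u\<close>, since it identifies
  the retargeted \<open>u\<close> with \<open>u\<close>.
\<close>

lemma RProj_factor:
  assumes F: "is_functor F" "fdom F = C"
    and ob: "\<And>a b. (a, b) \<in> rob \<Phi> \<Longrightarrow> fob F a = fob F b"
    and mor: "\<And>f g. (f, g) \<in> rsim \<Longrightarrow> fmor F f = fmor F g"
  obtains G where "is_functor G" "fdom G = RQuot elts C \<Phi>" "fcod G = fcod F"
    "func_comp G (RProj elts C \<Phi>) = F"
proof -
  note D = functorD[OF F refl]
  have cmp: "fmor F (rcomp v u) = Cmp (fcod F) (fmor F v) (fmor F u)"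
    if u: "u \<in> Mor C" and v: "v \<in> Mor C" and uv: "p (Sc C v) = p (Tg C u)" for u v
  proof -
    have "(Tg C u, Sc C v) \<in> rob \<Phi>"
      using u v uv p_eq_iff categoryD(1,2)[OF category_C] by metis
    note h = retarget[OF u this]
    show ?thesis unfolding rcomp_def using v h mor[OF h(4)] by (simp add: D)
  qed
  obtain G where G: "is_functor G" "fdom G = RQuot elts C \<Phi>" "fcod G = fcod F"
    "\<And>a. a \<in> Ob C \<Longrightarrow> fob G (p a) = fob F a" "\<And>f. f \<in> Mor C \<Longrightarrow> fmor G (q f) = fmor F f"
    by (rule functor_out[of "fcod F" "fob F" "fmor F"]) (simp_all add: D cmp p_eq_iff q_eq_iff ob mor)
  have "func_comp G (RProj elts C \<Phi>) = F"
    using G F functor_RProj by (intro functor_eqI functor_comp) (simp_all add: RProj_def)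
  with G that show thesis by blast
qed

end

section \<open>Generalized quotients\<close>

lemma mor_plus_Cons:
  "f # w \<in> mor_plus C E \<longleftrightarrow>
     f \<in> Mor C \<and> (w \<noteq> [] \<longrightarrow> w \<in> mor_plus C E \<and> (Tg C f, Sc C (hd w)) \<in> E)"
proof -
  have "(\<forall>i. Suc i < length (f # w) \<longrightarrow> (Tg C ((f # w) ! i), Sc C ((f # w) ! Suc i)) \<in> E) \<longleftrightarrow>
      (w \<noteq> [] \<longrightarrow> (Tg C f, Sc C (hd w)) \<in> E) \<and>
      (\<forall>i. Suc i < length w \<longrightarrow> (Tg C (w ! i), Sc C (w ! Suc i)) \<in> E)"
  proof -
    have *: "(\<forall>i. P i) \<longleftrightarrow> P 0 \<and> (\<forall>i. P (Suc i))" for P by (metis not0_implies_Suc)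
    show ?thesis by (subst *) (cases w; simp)
  qed
  then show ?thesis by (auto simp: mor_plus_def)
qed

lemma Nil_notin_mor_plus [simp]: "[] \<notin> mor_plus C E"
  by (simp add: mor_plus_def)

lemma mor_plus_append:
  "u \<noteq> [] \<Longrightarrow> v \<noteq> [] \<Longrightarrow>
     u @ v \<in> mor_plus C E \<longleftrightarrow> u \<in> mor_plus C E \<and> v \<in> mor_plus C E \<and> (Tg C (last u), Sc C (hd v)) \<in> E"
  by (induction u) (auto simp: mor_plus_Cons)

lemma mor_plusD:
  assumes "u \<in> mor_plus C E"
  shows "u \<noteq> []" "hd u \<in> Mor C" "last u \<in> Mor C" "set u \<subseteq> Mor C"
  using assms by (auto simp: mor_plus_def)

lemma mor_plus_map:
  assumes "is_functor F" "fdom F = C" "fcod F = D" "w \<in> mor_plus C E"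
    and "\<And>a b. (a, b) \<in> E \<Longrightarrow> (fob F a, fob F b) \<in> E'"
  shows "map (fmor F) w \<in> mor_plus D E'"
  using assms(4)
proof (induction w)
  case (Cons f w)
  then show ?case
    using functorD[OF assms(1-3)] assms(5) mor_plusD[of w C E]
    by (auto simp: mor_plus_Cons hd_map)
qed simp

locale gen_cong =
  fixes C :: "('o, 'm) cat" and \<Psi> :: "('o, 'm) gencong"
  assumes category_C: "category C" and gencong: "generalized_congruence C \<Psi>"
begin

lemmas gencong_axioms = gencong[unfolded generalized_congruence_def]
lemmas equiv_gob = gencong_axioms[THEN conjunct1]
lemmas equiv_gfl = gencong_axioms[THEN conjunct2, THEN conjunct1]
lemmas gfl_Idt = gencong_axioms[THEN conjunct2, THEN conjunct2, THEN conjunct1, rule_format]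
lemmas gencong_rest = gencong_axioms[THEN conjunct2, THEN conjunct2, THEN conjunct2]
lemmas gfl_Sc = gencong_rest[THEN conjunct1, rule_format, THEN conjunct1]
lemmas gfl_Tg = gencong_rest[THEN conjunct1, rule_format, THEN conjunct2]
lemmas gfl_Cmp = gencong_rest[THEN conjunct2, THEN conjunct1, rule_format]
lemmas gfl_append = gencong_rest[THEN conjunct2, THEN conjunct2, rule_format, OF conjI, OF _ conjI]

abbreviation "W \<equiv> mor_plus C (gob \<Psi>)"

lemma gfl_refl: "u \<in> W \<Longrightarrow> (u, u) \<in> gfl \<Psi>"
  using equiv_gfl by (meson equivE refl_onD)

lemma gfl_sym: "(u, v) \<in> gfl \<Psi> \<Longrightarrow> (v, u) \<in> gfl \<Psi>"
  using equiv_gfl by (meson equivE symD)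

lemma gfl_trans: "(u, v) \<in> gfl \<Psi> \<Longrightarrow> (v, w) \<in> gfl \<Psi> \<Longrightarrow> (u, w) \<in> gfl \<Psi>"
  using equiv_gfl by (meson equivE transD)

lemma gfl_closed: "(u, v) \<in> gfl \<Psi> \<Longrightarrow> u \<in> W" "(u, v) \<in> gfl \<Psi> \<Longrightarrow> v \<in> W"
  using equiv_gfl by (auto simp: equiv_def)

lemma gob_refl: "a \<in> Ob C \<Longrightarrow> (a, a) \<in> gob \<Psi>"
  using equiv_gob by (meson equivE refl_onD)

lemma gob_sym: "(a, b) \<in> gob \<Psi> \<Longrightarrow> (b, a) \<in> gob \<Psi>"
  using equiv_gob by (meson equivE symD)

lemma gob_trans: "(a, b) \<in> gob \<Psi> \<Longrightarrow> (b, c) \<in> gob \<Psi> \<Longrightarrow> (a, c) \<in> gob \<Psi>"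
  using equiv_gob by (meson equivE transD)

lemma gob_closed: "(a, b) \<in> gob \<Psi> \<Longrightarrow> a \<in> Ob C" "(a, b) \<in> gob \<Psi> \<Longrightarrow> b \<in> Ob C"
  using equiv_gob by (auto simp: equiv_def)

lemma gob_class_eq_iff:
  "a \<in> Ob C \<Longrightarrow> b \<in> Ob C \<Longrightarrow> gob \<Psi> `` {a} = gob \<Psi> `` {b} \<longleftrightarrow> (a, b) \<in> gob \<Psi>"
  by (rule eq_equiv_class_iff[OF equiv_gob])

lemma gfl_class_eq_iff:
  "u \<in> W \<Longrightarrow> v \<in> W \<Longrightarrow> gfl \<Psi> `` {u} = gfl \<Psi> `` {v} \<longleftrightarrow> (u, v) \<in> gfl \<Psi>"
  by (rule eq_equiv_class_iff[OF equiv_gfl])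

lemma W_ends: "u \<in> W \<Longrightarrow> Sc C (hd u) \<in> Ob C" "u \<in> W \<Longrightarrow> Tg C (last u) \<in> Ob C"
  using mor_plusD categoryD(1,2)[OF category_C] by metis+

lemma W_singleton: "[f] \<in> W \<longleftrightarrow> f \<in> Mor C"
  by (simp add: mor_plus_Cons)

lemma W_append:
  "u \<in> W \<Longrightarrow> v \<in> W \<Longrightarrow> (Tg C (last u), Sc C (hd v)) \<in> gob \<Psi> \<Longrightarrow> u @ v \<in> W"
  using mor_plus_append mor_plusD(1) by metis

text \<open>
  The composition rule absorbs an identity into the neighbouring morphism, and
  the concatenation rule adds the rest of the sequence.
\<close>

lemma gfl_unit:
  assumes "u \<in> W"
  shows "(Idt C (Sc C (hd u)) # u, u) \<in> gfl \<Psi>" "(u @ [Idt C (Tg C (last u))], u) \<in> gfl \<Psi>"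
proof -
  note cat = categoryD[OF category_C]
  show "(Idt C (Sc C (hd u)) # u, u) \<in> gfl \<Psi>"
  proof (cases u)
    case (Cons f w)
    then have f: "f \<in> Mor C" using assms by (simp add: mor_plus_Cons)
    then have *: "([Idt C (Sc C f), f], [f]) \<in> gfl \<Psi>"
      using gfl_Cmp[of "Idt C (Sc C f)" f] by (simp add: cat)
    show ?thesis
    proof (cases "w = []")
      case False
      then have "w \<in> W" "(Tg C f, Sc C (hd w)) \<in> gob \<Psi>" using assms Cons by (auto simp: mor_plus_Cons)
      then show ?thesis using gfl_append[OF * gfl_refl, of w] Cons by simp
    qed (use * Cons in simp)
  qed (use assms in simp)
  show "(u @ [Idt C (Tg C (last u))], u) \<in> gfl \<Psi>"
  proof (cases u rule: rev_cases)
    case (snoc w f)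
    then have f: "f \<in> Mor C" using mor_plusD(3)[OF assms] by simp
    then have *: "([f, Idt C (Tg C f)], [f]) \<in> gfl \<Psi>"
      using gfl_Cmp[of f "Idt C (Tg C f)"] by (simp add: cat)
    show ?thesis
    proof (cases "w = []")
      case False
      then have "w \<in> W" "(Tg C (last w), Sc C f) \<in> gob \<Psi>"
        using assms snoc mor_plus_append[of w "[f]"] by auto
      then show ?thesis using gfl_append[OF gfl_refl *, of w] snoc by simp
    qed (use * snoc in simp)
  qed (use assms in simp)
qed

lemma presents_generalized_quotient:
  "presents (generalized_quotient C \<Psi>) (Ob C) W (\<lambda>u. Sc C (hd u)) (\<lambda>u. Tg C (last u))
     (\<lambda>a. [Idt C a]) (\<lambda>v u. u @ v) (\<lambda>a. gob \<Psi> `` {a}) (\<lambda>u. gfl \<Psi> `` {u})"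
proof -
  have self: "u \<in> gfl \<Psi> `` {u}" if "u \<in> W" for u
    using gfl_refl[OF that] by simp
  have ob: "Ob C // gob \<Psi> = (\<lambda>a. gob \<Psi> `` {a}) ` Ob C" by (auto simp: quotient_def)
  have mor: "W // gfl \<Psi> = (\<lambda>u. gfl \<Psi> `` {u}) ` W" by (auto simp: quotient_def)
  have sc: "(THE A. \<exists>v\<in>gfl \<Psi> `` {u}. A = gob \<Psi> `` {Sc C (hd v)}) = gob \<Psi> `` {Sc C (hd u)}"
    if "u \<in> W" for u
  proof (rule the_equality)
    fix A assume "\<exists>v\<in>gfl \<Psi> `` {u}. A = gob \<Psi> `` {Sc C (hd v)}"
    then obtain v where "(u, v) \<in> gfl \<Psi>" and A: "A = gob \<Psi> `` {Sc C (hd v)}" by auto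
    then have "(Sc C (hd u), Sc C (hd v)) \<in> gob \<Psi>" by (intro gfl_Sc)
    then show "A = gob \<Psi> `` {Sc C (hd u)}" unfolding A by (rule equiv_class_eq[OF equiv_gob, symmetric])
  qed (use self[OF that] in blast)
  have tg: "(THE A. \<exists>v\<in>gfl \<Psi> `` {u}. A = gob \<Psi> `` {Tg C (last v)}) = gob \<Psi> `` {Tg C (last u)}"
    if "u \<in> W" for u
  proof (rule the_equality)
    fix A assume "\<exists>v\<in>gfl \<Psi> `` {u}. A = gob \<Psi> `` {Tg C (last v)}"
    then obtain v where "(u, v) \<in> gfl \<Psi>" and A: "A = gob \<Psi> `` {Tg C (last v)}" by auto
    then have "(Tg C (last u), Tg C (last v)) \<in> gob \<Psi>" by (intro gfl_Tg)
    then show "A = gob \<Psi> `` {Tg C (last u)}" unfolding A by (rule equiv_class_eq[OF equiv_gob, symmetric])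
  qed (use self[OF that] in blast)
  have idt: "(THE X. \<exists>b\<in>gob \<Psi> `` {a}. X = gfl \<Psi> `` {[Idt C b]}) = gfl \<Psi> `` {[Idt C a]}"
    if "a \<in> Ob C" for a
  proof (rule the_equality)
    fix X assume "\<exists>b\<in>gob \<Psi> `` {a}. X = gfl \<Psi> `` {[Idt C b]}"
    then obtain b where "(a, b) \<in> gob \<Psi>" and X: "X = gfl \<Psi> `` {[Idt C b]}" by auto
    then have "([Idt C a], [Idt C b]) \<in> gfl \<Psi>" by (intro gfl_Idt)
    then show "X = gfl \<Psi> `` {[Idt C a]}" unfolding X by (rule equiv_class_eq[OF equiv_gfl, symmetric])
  qed (use gob_refl[OF that] in blast)
  have cmp: "(THE Z. \<exists>u'\<in>gfl \<Psi> `` {u}. \<exists>v'\<in>gfl \<Psi> `` {v}. Z = gfl \<Psi> `` {u' @ v'}) = gfl \<Psi> `` {u @ v}"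
    if u: "u \<in> W" and v: "v \<in> W" and uv: "gob \<Psi> `` {Sc C (hd v)} = gob \<Psi> `` {Tg C (last u)}" for u v
  proof (rule the_equality)
    have *: "(Tg C (last u), Sc C (hd v)) \<in> gob \<Psi>" using u v uv gob_class_eq_iff W_ends by metis
    fix Z assume "\<exists>u'\<in>gfl \<Psi> `` {u}. \<exists>v'\<in>gfl \<Psi> `` {v}. Z = gfl \<Psi> `` {u' @ v'}"
    then obtain u' v' where "(u, u') \<in> gfl \<Psi>" "(v, v') \<in> gfl \<Psi>" and Z: "Z = gfl \<Psi> `` {u' @ v'}" by auto
    then have "(u @ v, u' @ v') \<in> gfl \<Psi>" using * by (intro gfl_append)
    then show "Z = gfl \<Psi> `` {u @ v}" unfolding Z by (rule equiv_class_eq[OF equiv_gfl, symmetric])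
  qed (use self[OF u] self[OF v] in blast)
  show ?thesis
    unfolding presents_def generalized_quotient_def
    by (auto simp: ob mor sc tg idt cmp W_ends W_singleton categoryD[OF category_C] simp del: bex_simps Image_singleton_iff)
qed

end

text \<open>
  Here a class consists of sequences. Each sequence is coded by a subset of \<open>\<omega> \<times> Mor C\<close>, injectively,
  so that the codes of a class form a small set.
\<close>

locale small_gen = universe elts + gen_cong C \<Psi>
  for elts :: "'u \<Rightarrow> 'u set" and C :: "('u, 'u) cat" and \<Psi> :: "('u, 'u) gencong" +
  assumes small_C: "U_category elts C"
begin

abbreviation "p \<equiv> \<lambda>a. vset elts (gob \<Psi> `` {a})"
abbreviation "q \<equiv> \<lambda>u. seq_class elts (gfl \<Psi> `` {u})"

lemma small_Ob: "small (Ob C)" and small_Mor: "small (Mor C)"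
  using small_C by (simp_all add: U_category_def small_def)

lemma small_W: "small (vseq elts ` W)"
  by (rule small_subset[OF small_sequences[OF small_Mor]]) (auto simp: mor_plus_def)

lemma small_gob_class: "small (gob \<Psi> `` {a})"
  by (rule small_subset[OF small_Ob]) (use equiv_gob in \<open>auto simp: equiv_def\<close>)

lemma small_gfl_class: "small (vseq elts ` (gfl \<Psi> `` {u}))"
  by (rule small_subset[OF small_W]) (auto dest: gfl_closed)

lemma p_eq_iff: "a \<in> Ob C \<Longrightarrow> b \<in> Ob C \<Longrightarrow> p a = p b \<longleftrightarrow> (a, b) \<in> gob \<Psi>"
  by (simp add: vset_eq_iff small_gob_class gob_class_eq_iff)

lemma seq_class_eq_iff: "q u = q v \<longleftrightarrow> gfl \<Psi> `` {u} = gfl \<Psi> `` {v}"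
  by (simp add: seq_class_def vset_eq_iff small_gfl_class inj_image_eq_iff[OF inj_vseq])

lemma q_eq_iff: "u \<in> W \<Longrightarrow> v \<in> W \<Longrightarrow> q u = q v \<longleftrightarrow> (u, v) \<in> gfl \<Psi>"
  by (simp add: seq_class_eq_iff gfl_class_eq_iff)

lemma presents_GQuot:
  "presents (GQuot elts C \<Psi>) (Ob C) W (\<lambda>u. Sc C (hd u)) (\<lambda>u. Tg C (last u))
     (\<lambda>a. [Idt C a]) (\<lambda>v u. u @ v) p q"
  unfolding GQuot_def
proof (rule presents_transport[OF presents_generalized_quotient])
  show "inj_on (vset elts) (Ob (generalized_quotient C \<Psi>))"
    "inj_on (seq_class elts) (Mor (generalized_quotient C \<Psi>))"
    using presents_generalized_quotient
    by (auto simp: presents_def inj_on_def vset_eq_iff small_gob_class seq_class_eq_iff)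
qed (simp_all add: W_ends)

sublocale presentation "GQuot elts C \<Psi>" "Ob C" W "\<lambda>u. Sc C (hd u)" "\<lambda>u. Tg C (last u)"
  "\<lambda>a. [Idt C a]" "\<lambda>v u. u @ v" p q
proof
  have comp: "(Tg C (last u), Sc C (hd v)) \<in> gob \<Psi>"
    if "u \<in> W" "v \<in> W" "p (Sc C (hd v)) = p (Tg C (last u))" for u v
    using that p_eq_iff W_ends by metis
  show "u @ v \<in> W" if "u \<in> W" "v \<in> W" "p (Sc C (hd v)) = p (Tg C (last u))" for u v
    using W_append comp that by blast
  show "q ([Idt C (Sc C (hd u))] @ u) = q u" "q (u @ [Idt C (Tg C (last u))]) = q u" if "u \<in> W" for u
    using gfl_unit[OF that] q_eq_iff gfl_closed by (metis append_Cons append_Nil)+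
qed (auto simp: presents_GQuot W_ends W_singleton categoryD[OF category_C] dest: mor_plusD)

lemma U_category_GQuot: "U_category elts (GQuot elts C \<Psi>)"
proof -
  have "q ` W = (\<lambda>x. q (inv (vseq elts) x)) ` vseq elts ` W"
    by (simp add: image_image inv_f_f[OF inj_vseq])
  then have "small (q ` W)" by (simp only: small_image small_W)
  moreover have "small (p ` Ob C)" by (rule small_image[OF small_Ob])
  ultimately show ?thesis using category_Q by (simp add: U_category_def Q_simps small_def)
qed

text \<open>
  A composable pair is related to its composite; therefore \<open>GProj\<close> preserves composition.
\<close>

lemma q_Cmp:
  assumes "f \<in> Mor C" "g \<in> Mor C" "Sc C g = Tg C f"
  shows "q [Cmp C g f] = q ([f] @ [g])"
  using gfl_sym[OF gfl_Cmp[OF assms]] gfl_closed q_eq_iff by (metis append_Cons append_Nil)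

lemma functor_GProj: "is_functor (GProj elts C \<Psi>)"
proof -
  note cat = categoryD[OF category_C]
  have "q [Cmp C g f] = Cmp (GQuot elts C \<Psi>) (q [g]) (q [f])"
    if "f \<in> Mor C" "g \<in> Mor C" "Sc C g = Tg C f" for f g
    using Q_simps(6)[of "[f]" "[g]"] q_Cmp[OF that] that by (simp add: W_singleton)
  then show ?thesis
    unfolding GProj_def
    by (intro functor_mk_func)
      (simp_all add: category_C category_Q Q_simps W_singleton cat)
qed

text \<open>
  The projection need not be onto on morphisms, but each morphism of the quotient is a composite of
  classes of sequences of length one, and a functor is determined by its values on these.
\<close>

lemma GProj_cancel:
  assumes GH: "is_functor G" "is_functor H" "fdom G = GQuot elts C \<Psi>" "fdom H = GQuot elts C \<Psi>"
    "fcod G = fcod H" and eq: "func_comp G (GProj elts C \<Psi>) = func_comp H (GProj elts C \<Psi>)"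
  shows "G = H"
proof -
  have ob: "fob G (p a) = fob H (p a)" if "a \<in> Ob C" for a
    using arg_cong[OF eq, of "\<lambda>F. fob F a"] that by (simp add: GProj_def)
  have mor: "fmor G (q [f]) = fmor H (q [f])" if "f \<in> Mor C" for f
    using arg_cong[OF eq, of "\<lambda>F. fmor F f"] that by (simp add: GProj_def)
  have "fmor G (q w) = fmor H (q w)" if "w \<in> W" for w
    using that
  proof (induction w)
    case (Cons f w)
    show ?case
    proof (cases "w = []")
      case False
      then have f: "f \<in> Mor C" and w: "w \<in> W" and fw: "(Tg C f, Sc C (hd w)) \<in> gob \<Psi>"
        using Cons.prems by (auto simp: mor_plus_Cons)
      have "p (Sc C (hd w)) = p (Tg C f)"
        using fw by (simp add: equiv_class_eq[OF equiv_gob fw])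
      then have "q (f # w) = Cmp (GQuot elts C \<Psi>) (q w) (q [f])"
        "q w \<in> Mor (GQuot elts C \<Psi>)" "q [f] \<in> Mor (GQuot elts C \<Psi>)"
        "Sc (GQuot elts C \<Psi>) (q w) = Tg (GQuot elts C \<Psi>) (q [f])"
        using Q_simps(6)[of "[f]" w] f w by (auto simp: Q_simps W_singleton)
      then show ?thesis
        using functorD(8)[OF GH(1,3) refl] functorD(8)[OF GH(2,4) refl] GH(5) mor[OF f]
          Cons.IH[OF w] by simp
    qed (use Cons.prems mor in \<open>simp add: mor_plus_Cons\<close>)
  qed simp
  with ob show ?thesis
    using GH by (intro functor_eqI) (auto simp: Q_simps)
qed

end

text \<open>
  A functor that respects the congruences acts on sequences termwise, so on classes of sequences.
\<close>

lemma (in universe) GProj_lift: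
  assumes "((C, \<Psi>), F, (D, \<Omega>)) \<in> gc_morphisms elts"
  obtains G where "is_functor G" "fdom G = GQuot elts C \<Psi>" "fcod G = GQuot elts D \<Omega>"
    "func_comp G (GProj elts C \<Psi>) = func_comp (GProj elts D \<Omega>) F"
proof -
  have F: "is_functor F" "fdom F = C" "fcod F = D"
    and C: "U_category elts C" "generalized_congruence C \<Psi>"
    and D: "U_category elts D" "generalized_congruence D \<Omega>"
    and ob: "\<And>a b. (a, b) \<in> gob \<Psi> \<Longrightarrow> (fob F a, fob F b) \<in> gob \<Omega>"
    and fl: "\<And>u v. (u, v) \<in> gfl \<Psi> \<Longrightarrow> (map (fmor F) u, map (fmor F) v) \<in> gfl \<Omega>"
    using assms by (auto simp: gc_morphisms_def gc_objects_def)
  note Fs = functorD[OF F]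
  interpret C: small_gen elts C \<Psi>
    by unfold_locales (use C in \<open>auto simp: U_category_def\<close>)
  interpret D: small_gen elts D \<Omega>
    by unfold_locales (use D in \<open>auto simp: U_category_def\<close>)
  have W: "map (fmor F) u \<in> D.W" if "u \<in> C.W" for u
    by (rule mor_plus_map[OF F that ob])
  have ends: "Sc D (hd (map (fmor F) u)) = fob F (Sc C (hd u))"
    "Tg D (last (map (fmor F) u)) = fob F (Tg C (last u))" if "u \<in> C.W" for u
    using mor_plusD[OF that] by (simp_all add: hd_map last_map Fs)
  have pq: "D.p (fob F (Sc C (hd v))) = D.p (fob F (Tg C (last u)))"
    if "u \<in> C.W" "v \<in> C.W" "C.p (Sc C (hd v)) = C.p (Tg C (last u))" for u v
    using that C.p_eq_iff[THEN iffD1, THEN ob] C.W_ends Fs(3) by (simp add: D.p_eq_iff)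
  obtain G where G: "is_functor G" "fdom G = GQuot elts C \<Psi>" "fcod G = GQuot elts D \<Omega>"
    "\<And>a. a \<in> Ob C \<Longrightarrow> fob G (C.p a) = D.p (fob F a)"
    "\<And>u. u \<in> C.W \<Longrightarrow> fmor G (C.q u) = D.q (map (fmor F) u)"
  proof (rule C.functor_out[of "GQuot elts D \<Omega>" "\<lambda>a. D.p (fob F a)" "\<lambda>u. D.q (map (fmor F) u)"])
    show "category (GQuot elts D \<Omega>)" by (rule D.category_Q)
    show "D.q (map (fmor F) (u @ v)) =
        Cmp (GQuot elts D \<Omega>) (D.q (map (fmor F) v)) (D.q (map (fmor F) u))"
      if "u \<in> C.W" "v \<in> C.W" "C.p (Sc C (hd v)) = C.p (Tg C (last u))" for u v
      using D.Q_simps(6)[of "map (fmor F) u" "map (fmor F) v"] that W pq[OF that] ends by simp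
  qed (auto simp: D.Q_simps W Fs ends C.p_eq_iff C.q_eq_iff D.p_eq_iff D.q_eq_iff ob fl)
  have "func_comp G (GProj elts C \<Psi>) = func_comp (GProj elts D \<Omega>) F"
    using G F C.functor_GProj D.functor_GProj
    by (intro functor_eqI functor_comp) (simp_all add: GProj_def Fs C.W_singleton)
  with G that show thesis by blast
qed

section \<open>Natural transformations with epimorphic components\<close>

definition epi :: "('o, 'm) cat \<Rightarrow> 'm \<Rightarrow> bool" where
  "epi E e \<longleftrightarrow> e \<in> Mor E \<and>
     (\<forall>g\<in>Mor E. \<forall>h\<in>Mor E. Sc E g = Tg E e \<and> Sc E h = Tg E e \<and> Cmp E g e = Cmp E h e \<longrightarrow> g = h)"

lemma epiD:
  "epi E e \<Longrightarrow> e \<in> Mor E"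
  "\<lbrakk>epi E e; g \<in> Mor E; h \<in> Mor E; Sc E g = Tg E e; Sc E h = Tg E e; Cmp E g e = Cmp E h e\<rbrakk> \<Longrightarrow> g = h"
  by (auto simp: epi_def)

text \<open>
  Functoriality of \<open>Q\<close> is a consequence of the naturality squares: both sides of each functor law
  agree after composition with an epimorphism.
\<close>

lemma nat_trans_epi_components:
  assumes U: "is_functor U" "fdom U = K" "fcod U = E"
    and Q: "fdom Q = K" "fcod Q = E" "fob Q \<in> extensional (Ob K)" "fmor Q \<in> extensional (Mor K)"
    and P: "\<And>X. X \<in> Ob K \<Longrightarrow> epi E (P X)" "\<And>X. X \<in> Ob K \<Longrightarrow> Sc E (P X) = fob U X"
      "\<And>X. X \<in> Ob K \<Longrightarrow> Tg E (P X) = fob Q X"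
    and k: "\<And>k. k \<in> Mor K \<Longrightarrow> fmor Q k \<in> Mor E"
      "\<And>k. k \<in> Mor K \<Longrightarrow> Sc E (fmor Q k) = fob Q (Sc K k)"
      "\<And>k. k \<in> Mor K \<Longrightarrow> Tg E (fmor Q k) = fob Q (Tg K k)"
    and square: "\<And>k. k \<in> Mor K \<Longrightarrow>
      Cmp E (fmor Q k) (P (Sc K k)) = Cmp E (P (Tg K k)) (fmor U k)"
  shows "nat_trans U Q (\<lambda>X\<in>Ob K. P X)"
proof -
  note D = functorD[OF U]
  note cat = categoryD[OF D(1)] categoryD[OF D(2)]
  have P_Mor: "X \<in> Ob K \<Longrightarrow> P X \<in> Mor E" for X by (rule epiD(1)[OF P(1)])
  have Q_Ob: "fob Q X \<in> Ob E" if "X \<in> Ob K" for X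
    using categoryD(2)[OF D(2) P_Mor[OF that]] P(3)[OF that] by simp
  have idt: "fmor Q (Idt K X) = Idt E (fob Q X)" if X: "X \<in> Ob K" for X
  proof (rule epiD(2)[OF P(1)[OF X]])
    have "Cmp E (fmor Q (Idt K X)) (P X) = P X"
      using square[of "Idt K X"] categoryD(9)[OF D(2) P_Mor[OF X]] X P(2)
      by (simp add: cat D)
    moreover have "Cmp E (Idt E (fob Q X)) (P X) = P X"
      using categoryD(10)[OF D(2) P_Mor[OF X]] P(3)[OF X] by simp
    ultimately show "Cmp E (fmor Q (Idt K X)) (P X) = Cmp E (Idt E (fob Q X)) (P X)" by simp
  qed (use X k P Q_Ob cat in simp_all)
  have cmp: "fmor Q (Cmp K l j) = Cmp E (fmor Q l) (fmor Q j)"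
    if j: "j \<in> Mor K" and l: "l \<in> Mor K" and jl: "Sc K l = Tg K j" for j l
  proof (rule epiD(2)[OF P(1)])
    let ?X = "Sc K j" and ?Y = "Tg K j" and ?Z = "Tg K l"
    have ob: "?X \<in> Ob K" "?Y \<in> Ob K" "?Z \<in> Ob K" using j l cat by auto
    show "?X \<in> Ob K" by (rule ob)
    have lj: "Cmp K l j \<in> Mor K" "Sc K (Cmp K l j) = ?X" "Tg K (Cmp K l j) = ?Z"
      using j l jl cat by auto
    note mor = P_Mor[OF ob(1)] P_Mor[OF ob(2)] P_Mor[OF ob(3)] k[OF j] k[OF l] k[OF lj(1)]
      P(2,3)[OF ob(1)] P(2,3)[OF ob(2)] P(2,3)[OF ob(3)] D(4-6)[OF j] D(4-6)[OF l]
    have "Cmp E (Cmp E (fmor Q l) (fmor Q j)) (P ?X) = Cmp E (fmor Q l) (Cmp E (fmor Q j) (P ?X))"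
      by (rule categoryD(11)[OF D(2), symmetric]) (simp_all add: mor jl)
    also have "\<dots> = Cmp E (fmor Q l) (Cmp E (P ?Y) (fmor U j))" by (simp add: square j)
    also have "\<dots> = Cmp E (Cmp E (fmor Q l) (P ?Y)) (fmor U j)"
      by (rule categoryD(11)[OF D(2)]) (simp_all add: mor jl)
    also have "\<dots> = Cmp E (Cmp E (P ?Z) (fmor U l)) (fmor U j)" using square[OF l] jl by simp
    also have "\<dots> = Cmp E (P ?Z) (Cmp E (fmor U l) (fmor U j))"
      by (rule categoryD(11)[OF D(2), symmetric]) (simp_all add: mor jl)
    also have "\<dots> = Cmp E (fmor Q (Cmp K l j)) (P ?X)"
      using square[OF lj(1)] lj D(8)[OF j l jl] by simp
    finally show "Cmp E (fmor Q (Cmp K l j)) (P ?X) = Cmp E (Cmp E (fmor Q l) (fmor Q j)) (P ?X)" ..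
    show "fmor Q (Cmp K l j) \<in> Mor E" "Sc E (fmor Q (Cmp K l j)) = Tg E (P ?X)"
      using mor lj by simp_all
    show "Cmp E (fmor Q l) (fmor Q j) \<in> Mor E" "Sc E (Cmp E (fmor Q l) (fmor Q j)) = Tg E (P ?X)"
      using mor jl categoryD(6,7)[OF D(2), of "fmor Q j" "fmor Q l"] by simp_all
  qed
  have "is_functor Q"
    unfolding is_functor_def Q using D Q Q_Ob k idt cmp by (auto simp: PiE_def Pi_def)
  then show ?thesis
    unfolding nat_trans_def using U Q P P_Mor square cat by (auto simp: Hom_def)
qed

text \<open>
  For \<open>k\<close> from \<open>X\<close> to \<open>Y\<close>, both ways around the square for \<open>F\<close> and \<open>F'\<close>,
  composed with the epimorphism \<open>\<pi> X\<close>, equal \<open>\<pi>' Y\<close> after \<open>fmor U k\<close>.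
\<close>

lemma nat_trans_factor:
  assumes \<pi>: "nat_trans U F \<pi>" and \<pi>': "nat_trans U F' \<pi>'"
    and epi: "\<And>X. X \<in> Ob (fdom U) \<Longrightarrow> epi (fcod U) (\<pi> X)"
    and factor: "\<And>X. X \<in> Ob (fdom U) \<Longrightarrow>
      \<exists>g\<in>Hom (fcod U) (fob F X) (fob F' X). Cmp (fcod U) g (\<pi> X) = \<pi>' X"
  shows "\<exists>\<alpha>. nat_trans F F' \<alpha>"
proof -
  define K E where "K = fdom U" and "E = fcod U"
  note FF = nat_transD(1-4)[OF \<pi>] nat_transD(1-4)[OF \<pi>']
  have dc: "fdom U = K" "fcod U = E" "fdom F = K" "fcod F = E" "fdom F' = K" "fcod F' = E"
    using FF by (simp_all add: K_def E_def)
  note D = functorD[OF FF(1) dc(1,2)] functorD[OF FF(2) dc(3,4)] functorD[OF FF(6) dc(5,6)]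
  obtain \<alpha> where \<alpha>: "\<And>X. X \<in> Ob K \<Longrightarrow> \<alpha> X \<in> Hom E (fob F X) (fob F' X)"
    "\<And>X. X \<in> Ob K \<Longrightarrow> Cmp E (\<alpha> X) (\<pi> X) = \<pi>' X"
    using factor unfolding dc by metis
  have "Cmp E (\<alpha> (Tg K k)) (fmor F k) = Cmp E (fmor F' k) (\<alpha> (Sc K k))" if k: "k \<in> Mor K" for k
  proof -
    let ?X = "Sc K k" and ?Y = "Tg K k"
    have ob: "?X \<in> Ob K" "?Y \<in> Ob K" using k D(1) by (auto dest: categoryD)
    have "\<pi> ?X \<in> Hom E (fob U ?X) (fob F ?X)" "\<pi> ?Y \<in> Hom E (fob U ?Y) (fob F ?Y)"
      "\<alpha> ?X \<in> Hom E (fob F ?X) (fob F' ?X)" "\<alpha> ?Y \<in> Hom E (fob F ?Y) (fob F' ?Y)"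
      using nat_transD(5)[OF \<pi>] \<alpha>(1) ob by (simp_all add: dc)
    then have mor: "\<pi> ?X \<in> Mor E" "\<pi> ?Y \<in> Mor E" "\<alpha> ?X \<in> Mor E" "\<alpha> ?Y \<in> Mor E"
      "fmor U k \<in> Mor E" "fmor F k \<in> Mor E" "fmor F' k \<in> Mor E"
      and st: "Sc E (\<pi> ?X) = fob U ?X" "Tg E (\<pi> ?X) = fob F ?X"
      "Sc E (\<pi> ?Y) = fob U ?Y" "Tg E (\<pi> ?Y) = fob F ?Y"
      "Sc E (\<alpha> ?X) = fob F ?X" "Tg E (\<alpha> ?X) = fob F' ?X"
      "Sc E (\<alpha> ?Y) = fob F ?Y" "Tg E (\<alpha> ?Y) = fob F' ?Y"
      "Sc E (fmor U k) = fob U ?X" "Tg E (fmor U k) = fob U ?Y"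
      "Sc E (fmor F k) = fob F ?X" "Tg E (fmor F k) = fob F ?Y"
      "Sc E (fmor F' k) = fob F' ?X" "Tg E (fmor F' k) = fob F' ?Y"
      using k D by (auto simp: Hom_def)
    show ?thesis
    proof (rule epiD(2)[OF epi[of ?X, unfolded dc, OF ob(1)]])
      have "Cmp E (Cmp E (\<alpha> ?Y) (fmor F k)) (\<pi> ?X) = Cmp E (\<alpha> ?Y) (Cmp E (fmor F k) (\<pi> ?X))"
        by (rule categoryD(11)[OF D(2), symmetric]) (simp_all add: mor st)
      also have "Cmp E (fmor F k) (\<pi> ?X) = Cmp E (\<pi> ?Y) (fmor U k)"
        using nat_transD(6)[OF \<pi>, of k] k by (simp add: dc)
      also have "Cmp E (\<alpha> ?Y) (Cmp E (\<pi> ?Y) (fmor U k)) = Cmp E (Cmp E (\<alpha> ?Y) (\<pi> ?Y)) (fmor U k)"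
        by (rule categoryD(11)[OF D(2)]) (simp_all add: mor st)
      also have "\<dots> = Cmp E (fmor F' k) (\<pi>' ?X)"
        using nat_transD(6)[OF \<pi>', of k] k \<alpha>(2) ob by (simp add: dc)
      also have "\<dots> = Cmp E (fmor F' k) (Cmp E (\<alpha> ?X) (\<pi> ?X))" by (simp add: \<alpha>(2) ob)
      also have "\<dots> = Cmp E (Cmp E (fmor F' k) (\<alpha> ?X)) (\<pi> ?X)"
        by (rule categoryD(11)[OF D(2)]) (simp_all add: mor st)
      finally show "Cmp E (Cmp E (\<alpha> ?Y) (fmor F k)) (\<pi> ?X) = Cmp E (Cmp E (fmor F' k) (\<alpha> ?X)) (\<pi> ?X)" .
    qed (simp_all add: mor st categoryD(6,7)[OF D(2)])
  qed
  then have "nat_trans F F' (\<lambda>X\<in>Ob K. \<alpha> X)"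
    unfolding nat_trans_def using FF \<alpha> D(1) by (auto simp: dc categoryD)
  then show ?thesis by blast
qed

section \<open>Categories of categories with congruences\<close>

lemma category_mk_cat:
  assumes "\<And>f. f \<in> M \<Longrightarrow> s f \<in> A" "\<And>f. f \<in> M \<Longrightarrow> t f \<in> A"
    "\<And>a. a \<in> A \<Longrightarrow> i a \<in> M" "\<And>a. a \<in> A \<Longrightarrow> s (i a) = a" "\<And>a. a \<in> A \<Longrightarrow> t (i a) = a"
    "\<And>f g. \<lbrakk>f \<in> M; g \<in> M; s g = t f\<rbrakk> \<Longrightarrow> c g f \<in> M \<and> s (c g f) = s f \<and> t (c g f) = t g"
    "\<And>f. f \<in> M \<Longrightarrow> c f (i (s f)) = f" "\<And>f. f \<in> M \<Longrightarrow> c (i (t f)) f = f"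
    "\<And>f g h. \<lbrakk>f \<in> M; g \<in> M; h \<in> M; s g = t f; s h = t g\<rbrakk> \<Longrightarrow> c h (c g f) = c (c h g) f"
  shows "category (mk_cat A M s t i c)"
  using assms unfolding category_def Hom_def by auto

text \<open>
  The common shape of \<open>RCCat\<close> and \<open>GCCat\<close>: an object is a category paired with extra structure, and
  a morphism is a functor together with its structured source and target.
\<close>

definition category_over where
  "category_over Os Ms = mk_cat Os Ms (\<lambda>(X, F, Y). X) (\<lambda>(X, F, Y). Y)
     (\<lambda>X. (X, func_id (fst X), X)) (\<lambda>(Y, G, Z) (X, F, Y'). (X, func_comp G F, Z))"

lemma category_over_simps [simp]:
  "Ob (category_over Os Ms) = Os" "Mor (category_over Os Ms) = Ms"
  "(X, F, Y) \<in> Ms \<Longrightarrow> Sc (category_over Os Ms) (X, F, Y) = X"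
  "(X, F, Y) \<in> Ms \<Longrightarrow> Tg (category_over Os Ms) (X, F, Y) = Y"
  "X \<in> Os \<Longrightarrow> Idt (category_over Os Ms) X = (X, func_id (fst X), X)"
  "(X, F, Y) \<in> Ms \<Longrightarrow> (Y, G, Z) \<in> Ms \<Longrightarrow>
    Cmp (category_over Os Ms) (Y, G, Z) (X, F, Y) = (X, func_comp G F, Z)"
  by (simp_all add: category_over_def)

lemma category_category_over:
  assumes Ms: "\<And>X F Y. (X, F, Y) \<in> Ms \<Longrightarrow>
      X \<in> Os \<and> Y \<in> Os \<and> is_functor F \<and> fdom F = fst X \<and> fcod F = fst Y"
    and Os: "\<And>X. X \<in> Os \<Longrightarrow> (X, func_id (fst X), X) \<in> Ms"
    and comp: "\<And>X F Y G Z. (X, F, Y) \<in> Ms \<Longrightarrow> (Y, G, Z) \<in> Ms \<Longrightarrow> (X, func_comp G F, Z) \<in> Ms"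
  shows "category (category_over Os Ms)"
proof -
  have unit: "func_comp F (func_id (fst X)) = F" "func_comp (func_id (fst Y)) F = F"
    if "(X, F, Y) \<in> Ms" for X F Y
    using Ms[OF that] func_comp_id[of F] by auto
  have assoc: "func_comp H (func_comp G F) = func_comp (func_comp H G) F"
    if "(X, F, Y) \<in> Ms" "(Y, G, Z) \<in> Ms" "(Z, H, V) \<in> Ms" for X F Y G Z H V
    using Ms[OF that(1)] Ms[OF that(2)] Ms[OF that(3)] by (intro func_comp_assoc) auto
  show ?thesis
    unfolding category_over_def
  proof (rule category_mk_cat, goal_cases)
    case (9 k l n)
    then show ?case using assoc by (cases k; cases l; cases n) auto
  qed (use Ms Os comp unit in \<open>auto split: prod.splits\<close>)
qed

lemma functor_underlying:
  assumes "category (category_over Os Ms)"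
    "\<And>X. X \<in> Os \<Longrightarrow> U_category elts (fst X)"
    "\<And>X F Y. (X, F, Y) \<in> Ms \<Longrightarrow>
      X \<in> Os \<and> Y \<in> Os \<and> is_functor F \<and> fdom F = fst X \<and> fcod F = fst Y"
  shows "is_functor (mk_func (category_over Os Ms) (Cat elts) (\<lambda>(C, \<Phi>). C) (\<lambda>(X, F, Y). F))"
proof -
  note Ms = assms(3)
  have U: "U_category elts C" if "(C, \<Phi>) \<in> Os" for C \<Phi> using assms(2)[OF that] by simp
  show ?thesis
  proof (rule functor_mk_func[OF assms(1) category_Cat])
    fix X assume "X \<in> Ob (category_over Os Ms)"
    then show "(\<lambda>(C, \<Phi>). C) X \<in> Ob (Cat elts)"
      "(\<lambda>(X, F, Y). F) (Idt (category_over Os Ms) X) = Idt (Cat elts) ((\<lambda>(C, \<Phi>). C) X)"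
      using assms(2)[of X] by (auto simp: case_prod_beta)
  next
    fix k assume "k \<in> Mor (category_over Os Ms)"
    then obtain X F Y where k: "k = (X, F, Y)" "(X, F, Y) \<in> Ms" by (cases k) auto
    then have "F \<in> Mor (Cat elts)" using Ms[OF k(2)] assms(2) by auto
    then show "(\<lambda>(X, F, Y). F) k \<in> Mor (Cat elts)"
      "Sc (Cat elts) ((\<lambda>(X, F, Y). F) k) = (\<lambda>(C, \<Phi>). C) (Sc (category_over Os Ms) k)"
      "Tg (Cat elts) ((\<lambda>(X, F, Y). F) k) = (\<lambda>(C, \<Phi>). C) (Tg (category_over Os Ms) k)"
      using Ms[OF k(2)] k by (simp_all add: case_prod_beta)
  next
    fix k l assume "k \<in> Mor (category_over Os Ms)" "l \<in> Mor (category_over Os Ms)"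
      "Sc (category_over Os Ms) l = Tg (category_over Os Ms) k"
    then obtain X F Y G Z where *: "k = (X, F, Y)" "l = (Y, G, Z)" "(X, F, Y) \<in> Ms" "(Y, G, Z) \<in> Ms"
      by (cases k; cases l) auto
    then have "F \<in> Mor (Cat elts)" "G \<in> Mor (Cat elts)" "fdom G = fcod F"
      using Ms[OF *(3)] Ms[OF *(4)] assms(2) by auto
    then show "(\<lambda>(X, F, Y). F) (Cmp (category_over Os Ms) l k) =
        Cmp (Cat elts) ((\<lambda>(X, F, Y). F) l) ((\<lambda>(X, F, Y). F) k)"
      using * by simp
  qed
qed

lemma category_full_subcat:
  assumes "category C"
  shows "category (full_subcat C S)"
  unfolding full_subcat_def
  by (rule category_mk_cat) (use assms in \<open>auto simp: categoryD\<close>)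

lemma functor_inclusion:
  assumes "category C"
  shows "is_functor (mk_func (full_subcat C S) C (\<lambda>a. a) (\<lambda>f. f))"
  by (rule functor_mk_func[OF category_full_subcat[OF assms] assms]) (auto simp: full_subcat_def)

text \<open>
  Restriction to a full subcategory is composition with the inclusion, so restricting
  a natural transformation is an instance of whiskering.
\<close>

lemma func_restrict_eq_comp:
  "fdom F = C \<Longrightarrow> func_restrict S F = func_comp F (mk_func S C (\<lambda>a. a) (\<lambda>f. f))"
  by (auto simp: func_restrict_def func_comp_def mk_func_def fun_eq_iff)

lemma RCCat_eq: "RCCat elts = category_over (rc_objects elts) (rc_morphisms elts)"
  and GCCat_eq: "GCCat elts = category_over (gc_objects elts) (gc_morphisms elts)"
  by (simp_all add: RCCat_def GCCat_def category_over_def)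

lemma rc_morphisms_iff:
  "((C, \<Phi>), F, (D, \<Upsilon>)) \<in> rc_morphisms elts \<longleftrightarrow>
        (C, \<Phi>) \<in> rc_objects elts \<and> (D, \<Upsilon>) \<in> rc_objects elts \<and>
        is_functor F \<and> fdom F = C \<and> fcod F = D \<and>
        (\<forall>a b. (a, b) \<in> rob \<Phi> \<longrightarrow> (fob F a, fob F b) \<in> rob \<Upsilon>) \<and>
        (\<forall>a b a' b' f f'. (f, f') \<in> rfl \<Phi> a b a' b' \<longrightarrow>
           (fmor F f, fmor F f') \<in> rfl \<Upsilon> (fob F a) (fob F b) (fob F a') (fob F b'))"
  by (auto simp: rc_morphisms_def)

lemma gc_morphisms_iff:
  "((C, \<Psi>), F, (D, \<Omega>)) \<in> gc_morphisms elts \<longleftrightarrow>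
        (C, \<Psi>) \<in> gc_objects elts \<and> (D, \<Omega>) \<in> gc_objects elts \<and>
        is_functor F \<and> fdom F = C \<and> fcod F = D \<and>
        (\<forall>a b. (a, b) \<in> gob \<Psi> \<longrightarrow> (fob F a, fob F b) \<in> gob \<Omega>) \<and>
        (\<forall>u v. (u, v) \<in> gfl \<Psi> \<longrightarrow> (map (fmor F) u, map (fmor F) v) \<in> gfl \<Omega>)"
  by (auto simp: gc_morphisms_def)

lemma rc_morphismsD:
  "(X, F, Y) \<in> rc_morphisms elts \<Longrightarrow>
     X \<in> rc_objects elts \<and> Y \<in> rc_objects elts \<and> is_functor F \<and> fdom F = fst X \<and> fcod F = fst Y"
  by (cases X; cases Y) (simp add: rc_morphisms_iff)

lemma gc_morphismsD:
  "(X, F, Y) \<in> gc_morphisms elts \<Longrightarrow>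
     X \<in> gc_objects elts \<and> Y \<in> gc_objects elts \<and> is_functor F \<and> fdom F = fst X \<and> fcod F = fst Y"
  by (cases X; cases Y) (simp add: gc_morphisms_iff)

lemma category_RCCat: "category (RCCat elts)"
  unfolding RCCat_eq
proof (rule category_category_over[OF rc_morphismsD])
  fix X assume "X \<in> rc_objects elts"
  then obtain C \<Phi> where X: "X = (C, \<Phi>)" and C: "category C" "riguet_congruence C \<Phi>"
    and X': "(C, \<Phi>) \<in> rc_objects elts"
    by (auto simp: rc_objects_def U_category_def)
  interpret riguet_cong C \<Phi> by unfold_locales (use C in auto)
  have "f \<in> Mor C \<and> f' \<in> Mor C \<and> a \<in> Ob C \<and> a' \<in> Ob C \<and> b \<in> Ob C \<and> b' \<in> Ob C"
    if "(f, f') \<in> rfl \<Phi> a b a' b'" for f f' a b a' b'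
    using that rsimD categoryD(1,2)[OF category_C] by (auto simp: rfl_iff)
  moreover have "a \<in> Ob C \<and> b \<in> Ob C" if "(a, b) \<in> rob \<Phi>" for a b
    using that equiv_rob by (auto simp: equiv_def)
  ultimately show "(X, func_id (fst X), X) \<in> rc_morphisms elts"
    unfolding X using X' functor_id[OF C(1)]
    by (auto simp: rc_morphisms_iff) (auto simp: func_id_def)
next
  fix X F Y G Z
  assume F: "(X, F, Y) \<in> rc_morphisms elts" and G: "(Y, G, Z) \<in> rc_morphisms elts"
  obtain C \<Phi> where X: "X = (C, \<Phi>)" by (cases X)
  have C: "category C" "riguet_congruence C \<Phi>"
    using F by (auto simp: X rc_objects_def U_category_def dest!: rc_morphismsD)
  interpret riguet_cong C \<Phi> by unfold_locales (use C in auto)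
  have "f \<in> Mor C \<and> f' \<in> Mor C \<and> a \<in> Ob C \<and> a' \<in> Ob C \<and> b \<in> Ob C \<and> b' \<in> Ob C"
    if "(f, f') \<in> rfl \<Phi> a b a' b'" for f f' a b a' b'
    using that rsimD categoryD(1,2)[OF category_C] by (auto simp: rfl_iff)
  moreover have rob: "a \<in> Ob C \<and> b \<in> Ob C" if "(a, b) \<in> rob \<Phi>" for a b
    using that equiv_rob by (auto simp: equiv_def)
  ultimately have eq: "fmor (func_comp G F) f = fmor G (fmor F f)"
      "fmor (func_comp G F) f' = fmor G (fmor F f')"
      "fob (func_comp G F) a = fob G (fob F a)" "fob (func_comp G F) b = fob G (fob F b)"
      "fob (func_comp G F) a' = fob G (fob F a')" "fob (func_comp G F) b' = fob G (fob F b')"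
      if "(f, f') \<in> rfl \<Phi> a b a' b'" for f f' a b a' b'
    using rc_morphismsD[OF F] that by (simp_all add: X)
  have eq_ob: "fob (func_comp G F) a = fob G (fob F a)" "fob (func_comp G F) b = fob G (fob F b)"
    if "(a, b) \<in> rob \<Phi>" for a b
    using rc_morphismsD[OF F] rob[OF that] by (simp_all add: X)
  obtain D \<Upsilon> E \<Theta> where YZ: "Y = (D, \<Upsilon>)" "Z = (E, \<Theta>)" by (cases Y; cases Z)
  note F' = F[unfolded X YZ rc_morphisms_iff] and G' = G[unfolded YZ rc_morphisms_iff]
  have "is_functor (func_comp G F)" "fdom (func_comp G F) = C" "fcod (func_comp G F) = E"
    using F' G' by (simp_all add: functor_comp)
  then show "(X, func_comp G F, Z) \<in> rc_morphisms elts"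
    using F' G' unfolding X YZ rc_morphisms_iff
    by (simp del: func_comp_simps add: eq eq_ob)
qed

lemma category_GCCat: "category (GCCat elts)"
  unfolding GCCat_eq
proof (rule category_category_over[OF gc_morphismsD])
  fix X assume "X \<in> gc_objects elts"
  then obtain C \<Psi> where X: "X = (C, \<Psi>)" and C: "category C" "generalized_congruence C \<Psi>"
    and X': "(C, \<Psi>) \<in> gc_objects elts"
    by (auto simp: gc_objects_def U_category_def)
  interpret gen_cong C \<Psi> by unfold_locales (use C in auto)
  have "set u \<subseteq> Mor C" if "u \<in> W" for u
    using mor_plusD(4) that .
  then have "map (fmor (func_id C)) u = u" if "u \<in> W" for u
    using that by (intro map_idI) (auto simp: func_id_def)
  moreover have "a \<in> Ob C \<and> b \<in> Ob C" if "(a, b) \<in> gob \<Psi>" for a b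
    using that equiv_gob by (auto simp: equiv_def)
  ultimately show "(X, func_id (fst X), X) \<in> gc_morphisms elts"
    unfolding X using X' functor_id[OF C(1)] gfl_closed
    by (auto simp: gc_morphisms_iff) (auto simp: func_id_def)
next
  fix X F Y G Z
  assume F: "(X, F, Y) \<in> gc_morphisms elts" and G: "(Y, G, Z) \<in> gc_morphisms elts"
  obtain C \<Psi> where X: "X = (C, \<Psi>)" by (cases X)
  have C: "category C" "generalized_congruence C \<Psi>"
    using F by (auto simp: X gc_objects_def U_category_def dest!: gc_morphismsD)
  interpret gen_cong C \<Psi> by unfold_locales (use C in auto)
  have "map (fmor (func_comp G F)) u = map (fmor G) (map (fmor F) u)" if "u \<in> W" for u
    using mor_plusD(4)[OF that] gc_morphismsD[OF F] by (auto simp: X)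
  moreover have gob: "a \<in> Ob C \<and> b \<in> Ob C" if "(a, b) \<in> gob \<Psi>" for a b
    using that equiv_gob by (auto simp: equiv_def)
  ultimately have eq: "map (fmor (func_comp G F)) u = map (fmor G) (map (fmor F) u)"
      "map (fmor (func_comp G F)) v = map (fmor G) (map (fmor F) v)" if "(u, v) \<in> gfl \<Psi>" for u v
    using gfl_closed[OF that] by blast+
  have eq_ob: "fob (func_comp G F) a = fob G (fob F a)" "fob (func_comp G F) b = fob G (fob F b)"
    if "(a, b) \<in> gob \<Psi>" for a b
    using gc_morphismsD[OF F] gob[OF that] by (simp_all add: X)
  obtain D \<Upsilon> E \<Theta> where YZ: "Y = (D, \<Upsilon>)" "Z = (E, \<Theta>)" by (cases Y; cases Z)
  note F' = F[unfolded X YZ gc_morphisms_iff] and G' = G[unfolded YZ gc_morphisms_iff]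
  have "is_functor (func_comp G F)" "fdom (func_comp G F) = C" "fcod (func_comp G F) = E"
    using F' G' by (simp_all add: functor_comp)
  then show "(X, func_comp G F, Z) \<in> gc_morphisms elts"
    using F' G' unfolding X YZ gc_morphisms_iff
    by (simp del: func_comp_simps map_map add: eq eq_ob)
qed

section \<open>The generalized congruence generated by a Riguet congruence\<close>

lemma gencongI:
  assumes "equiv (Ob C) E" "equiv (mor_plus C E) R"
    "\<And>a b. (a, b) \<in> E \<Longrightarrow> ([Idt C a], [Idt C b]) \<in> R"
    "\<And>u v. (u, v) \<in> R \<Longrightarrow> (Sc C (hd u), Sc C (hd v)) \<in> E"
    "\<And>u v. (u, v) \<in> R \<Longrightarrow> (Tg C (last u), Tg C (last v)) \<in> E"
    "\<And>f g. \<lbrakk>f \<in> Mor C; g \<in> Mor C; Sc C g = Tg C f\<rbrakk> \<Longrightarrow> ([f, g], [Cmp C g f]) \<in> R"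
    "\<And>u u' v v'. \<lbrakk>(u, u') \<in> R; (v, v') \<in> R; (Tg C (last u), Sc C (hd v)) \<in> E\<rbrakk> \<Longrightarrow>
      (u @ v, u' @ v') \<in> R"
  shows "generalized_congruence C \<lparr>gob = E, gfl = R\<rparr>"
  unfolding generalized_congruence_def using assms by simp

text \<open>
  The largest generalized congruence. It shows that the family of congruences containing a given Riguet
  congruence is nonempty, so that its intersection makes sense.
\<close>

lemma gencong_total:
  assumes "category C"
  defines "E \<equiv> Ob C \<times> Ob C"
  shows "generalized_congruence C \<lparr>gob = E, gfl = mor_plus C E \<times> mor_plus C E\<rparr>"
proof -
  note cat = categoryD[OF assms(1)]
  have ends: "Sc C (hd u) \<in> Ob C" "Tg C (last u) \<in> Ob C" if "u \<in> mor_plus C E" for u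
    using mor_plusD[OF that] cat(1,2) by auto
  show ?thesis
  proof (rule gencongI)
    show "equiv (Ob C) E" "equiv (mor_plus C E) (mor_plus C E \<times> mor_plus C E)"
      by (auto simp: E_def equiv_def refl_on_def sym_def trans_def)
    show "(u @ v, u' @ v') \<in> mor_plus C E \<times> mor_plus C E"
      if "(u, u') \<in> mor_plus C E \<times> mor_plus C E" "(v, v') \<in> mor_plus C E \<times> mor_plus C E" for u u' v v'
      using that ends by (auto simp: mor_plus_append[OF mor_plusD(1) mor_plusD(1)] E_def)
  qed (use assms(1) ends in \<open>auto simp: E_def mor_plus_Cons categoryD\<close>)
qed

text \<open>
  The carrier of the relation on sequences depends on the relation on objects. It
  commutes with intersections of nonempty families, as it is
  defined by conditions on consecutive members.
\<close>

lemma gencong_Inter: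
  assumes "category C" "S \<noteq> {}" and S: "\<And>\<Psi>. \<Psi> \<in> S \<Longrightarrow> generalized_congruence C \<Psi>"
  shows "generalized_congruence C \<lparr>gob = (\<Inter>\<Psi>\<in>S. gob \<Psi>), gfl = (\<Inter>\<Psi>\<in>S. gfl \<Psi>)\<rparr>"
proof (rule gencongI)
  have gc: "gen_cong C \<Psi>" if "\<Psi> \<in> S" for \<Psi>
    using S[OF that] assms(1) by unfold_locales
  have W: "mor_plus C (\<Inter>\<Psi>\<in>S. gob \<Psi>) = (\<Inter>\<Psi>\<in>S. mor_plus C (gob \<Psi>))"
    using assms(2) by (auto simp: mor_plus_def)
  obtain \<Psi>\<^sub>0 where \<Psi>\<^sub>0: "\<Psi>\<^sub>0 \<in> S" using assms(2) by auto
  show "equiv (Ob C) (\<Inter>\<Psi>\<in>S. gob \<Psi>)"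
  proof (rule equivI)
    show "(\<Inter>\<Psi>\<in>S. gob \<Psi>) \<subseteq> Ob C \<times> Ob C"
    proof
      fix x assume "x \<in> (\<Inter>\<Psi>\<in>S. gob \<Psi>)"
      then have "x \<in> gob \<Psi>\<^sub>0" using \<Psi>\<^sub>0 by simp
      then show "x \<in> Ob C \<times> Ob C"
        using gen_cong.gob_closed[OF gc[OF \<Psi>\<^sub>0], of "fst x" "snd x"] by (cases x) simp
    qed
    show "refl_on (Ob C) (\<Inter>\<Psi>\<in>S. gob \<Psi>)"
      by (intro refl_onI INT_I gen_cong.gob_refl[OF gc])
    show "sym (\<Inter>\<Psi>\<in>S. gob \<Psi>)"
      by (rule symI) (auto intro: gen_cong.gob_sym[OF gc])
    show "trans (\<Inter>\<Psi>\<in>S. gob \<Psi>)"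
      by (rule transI) (auto intro: gen_cong.gob_trans[OF gc])
  qed
  show "equiv (mor_plus C (\<Inter>\<Psi>\<in>S. gob \<Psi>)) (\<Inter>\<Psi>\<in>S. gfl \<Psi>)"
  proof (rule equivI)
    show "(\<Inter>\<Psi>\<in>S. gfl \<Psi>) \<subseteq> mor_plus C (\<Inter>\<Psi>\<in>S. gob \<Psi>) \<times> mor_plus C (\<Inter>\<Psi>\<in>S. gob \<Psi>)"
      unfolding W
    proof clarify
      fix u v assume uv: "(u, v) \<in> (\<Inter>\<Psi>\<in>S. gfl \<Psi>)"
      have "u \<in> mor_plus C (gob \<Psi>)" "v \<in> mor_plus C (gob \<Psi>)" if "\<Psi> \<in> S" for \<Psi>
        using gen_cong.gfl_closed[OF gc[OF that], of u v] uv that by blast+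
      then show "u \<in> (\<Inter>\<Psi>\<in>S. mor_plus C (gob \<Psi>)) \<and> v \<in> (\<Inter>\<Psi>\<in>S. mor_plus C (gob \<Psi>))"
        by simp
    qed
    show "refl_on (mor_plus C (\<Inter>\<Psi>\<in>S. gob \<Psi>)) (\<Inter>\<Psi>\<in>S. gfl \<Psi>)"
      unfolding W by (intro refl_onI INT_I gen_cong.gfl_refl[OF gc]; blast)
    show "sym (\<Inter>\<Psi>\<in>S. gfl \<Psi>)"
      by (rule symI) (auto intro: gen_cong.gfl_sym[OF gc])
    show "trans (\<Inter>\<Psi>\<in>S. gfl \<Psi>)"
      by (rule transI) (auto intro: gen_cong.gfl_trans[OF gc])
  qed
  show "([Idt C a], [Idt C b]) \<in> (\<Inter>\<Psi>\<in>S. gfl \<Psi>)" if "(a, b) \<in> (\<Inter>\<Psi>\<in>S. gob \<Psi>)" for a b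
    using that gen_cong.gfl_Idt[OF gc] by blast
  show "(Sc C (hd u), Sc C (hd v)) \<in> (\<Inter>\<Psi>\<in>S. gob \<Psi>)" if "(u, v) \<in> (\<Inter>\<Psi>\<in>S. gfl \<Psi>)" for u v
    using that gen_cong.gfl_Sc[OF gc] by blast
  show "(Tg C (last u), Tg C (last v)) \<in> (\<Inter>\<Psi>\<in>S. gob \<Psi>)" if "(u, v) \<in> (\<Inter>\<Psi>\<in>S. gfl \<Psi>)" for u v
    using that gen_cong.gfl_Tg[OF gc] by blast
  show "([f, g], [Cmp C g f]) \<in> (\<Inter>\<Psi>\<in>S. gfl \<Psi>)" if "f \<in> Mor C" "g \<in> Mor C" "Sc C g = Tg C f" for f g
    using gen_cong.gfl_Cmp[OF gc that] by blast
  show "(u @ v, u' @ v') \<in> (\<Inter>\<Psi>\<in>S. gfl \<Psi>)"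
    if "(u, u') \<in> (\<Inter>\<Psi>\<in>S. gfl \<Psi>)" "(v, v') \<in> (\<Inter>\<Psi>\<in>S. gfl \<Psi>)"
      "(Tg C (last u), Sc C (hd v)) \<in> (\<Inter>\<Psi>\<in>S. gob \<Psi>)" for u u' v v'
  proof (rule INT_I)
    fix \<Psi> assume "\<Psi> \<in> S"
    with that show "(u @ v, u' @ v') \<in> gfl \<Psi>" by (intro gen_cong.gfl_append[OF gc]) blast+
  qed
qed

definition pullback_cong where
  "pullback_cong F \<Omega> =
     (let C = fdom F; E = {(a, b). a \<in> Ob C \<and> b \<in> Ob C \<and> (fob F a, fob F b) \<in> gob \<Omega>} in
       \<lparr>gob = E, gfl = {(u, v). u \<in> mor_plus C E \<and> v \<in> mor_plus C E \<and>
          (map (fmor F) u, map (fmor F) v) \<in> gfl \<Omega>}\<rparr>)"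

text \<open>
  Every axiom is preserved because \<open>F\<close> commutes with all the operations involved. For concatenation,
  \<open>u' @ v'\<close> is again in the carrier because its image is related to that of \<open>u @ v\<close>.
\<close>

lemma gencong_pullback:
  assumes F: "is_functor F" and \<Omega>: "generalized_congruence (fcod F) \<Omega>"
  shows "generalized_congruence (fdom F) (pullback_cong F \<Omega>)"
proof -
  define C D where "C = fdom F" and "D = fcod F"
  define E where "E = {(a, b). a \<in> Ob C \<and> b \<in> Ob C \<and> (fob F a, fob F b) \<in> gob \<Omega>}"
  let ?R = "{(u, v). u \<in> mor_plus C E \<and> v \<in> mor_plus C E \<and>
    (map (fmor F) u, map (fmor F) v) \<in> gfl \<Omega>}"
  note dc = C_def[symmetric] D_def[symmetric]
  note Fs = functorD[OF F dc]
  note cat = categoryD[OF Fs(1)]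
  interpret gen_cong D \<Omega> by unfold_locales (use Fs(2) \<Omega> D_def in auto)
  have W: "map (fmor F) u \<in> mor_plus D (gob \<Omega>)" if "u \<in> mor_plus C E" for u
    by (rule mor_plus_map[OF F dc that]) (simp add: E_def)
  have ends: "Sc D (hd (map (fmor F) u)) = fob F (Sc C (hd u))"
    "Tg D (last (map (fmor F) u)) = fob F (Tg C (last u))"
    "Sc C (hd u) \<in> Ob C" "Tg C (last u) \<in> Ob C" if "u \<in> mor_plus C E" for u
    using mor_plusD[OF that] by (simp_all add: hd_map last_map Fs cat)
  have app: "u @ v \<in> mor_plus C E"
    if "u \<in> mor_plus C E" "v \<in> mor_plus C E" "(Tg C (last u), Sc C (hd v)) \<in> E" for u v
    using that mor_plus_append mor_plusD(1) by metis
  have "generalized_congruence C \<lparr>gob = E, gfl = ?R\<rparr>"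
  proof (rule gencongI)
    show "equiv (Ob C) E"
    proof (rule equivI)
      show "E \<subseteq> Ob C \<times> Ob C" by (auto simp: E_def)
      show "refl_on (Ob C) E" by (auto simp: E_def refl_on_def Fs intro: gob_refl)
      show "sym E" using equiv_gob by (auto simp: E_def equiv_def sym_def)
      show "trans E" using equiv_gob by (auto simp: E_def equiv_def intro!: transI dest: transD)
    qed
    show "equiv (mor_plus C E) ?R"
    proof (rule equivI)
      show "?R \<subseteq> mor_plus C E \<times> mor_plus C E" by auto
      show "refl_on (mor_plus C E) ?R" by (auto simp: refl_on_def intro: gfl_refl W)
      show "sym ?R" by (auto simp: sym_def intro: gfl_sym)
      show "trans ?R" by (auto intro!: transI intro: gfl_trans)
    qed
    show "([Idt C a], [Idt C b]) \<in> ?R" if "(a, b) \<in> E" for a b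
      using that gfl_Idt by (auto simp: E_def mor_plus_Cons cat Fs)
    show "(Sc C (hd u), Sc C (hd v)) \<in> E" if "(u, v) \<in> ?R" for u v
      using that gfl_Sc[of "map (fmor F) u" "map (fmor F) v"] ends by (auto simp: E_def)
    show "(Tg C (last u), Tg C (last v)) \<in> E" if "(u, v) \<in> ?R" for u v
      using that gfl_Tg[of "map (fmor F) u" "map (fmor F) v"] ends by (auto simp: E_def)
    show "([f, g], [Cmp C g f]) \<in> ?R" if "f \<in> Mor C" "g \<in> Mor C" "Sc C g = Tg C f" for f g
      using that gfl_Cmp[of "fmor F f" "fmor F g"] gob_refl
      by (auto simp: mor_plus_Cons cat Fs E_def)
    show "(u @ v, u' @ v') \<in> ?R"
      if uv: "(u, u') \<in> ?R" "(v, v') \<in> ?R" "(Tg C (last u), Sc C (hd v)) \<in> E" for u u' v v'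
    proof -
      have gfl: "(map (fmor F) u @ map (fmor F) v, map (fmor F) u' @ map (fmor F) v') \<in> gfl \<Omega>"
        using uv ends by (intro gfl_append) (auto simp: E_def)
      have "(fob F (Tg C (last u')), fob F (Sc C (hd v'))) \<in> gob \<Omega>"
        using gfl_closed(2)[OF gfl] uv ends mor_plusD(1)[of u' C E] mor_plusD(1)[of v' C E]
          mor_plus_append[where C = D, of "map (fmor F) u'" "map (fmor F) v'"] by auto
      then have "(Tg C (last u'), Sc C (hd v')) \<in> E" using uv ends by (auto simp: E_def)
      then show ?thesis using gfl uv app by auto
    qed
  qed
  then show ?thesis by (simp add: pullback_cong_def C_def E_def Let_def)
qed

context riguet_cong
begin

lemma natural_cong_least:
  shows "natural_spec C \<Phi> (natural_cong C \<Phi>)"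
    and "natural_spec C \<Phi> \<Psi> \<Longrightarrow> gob (natural_cong C \<Phi>) \<subseteq> gob \<Psi>"
    and "natural_spec C \<Phi> \<Psi> \<Longrightarrow> gfl (natural_cong C \<Phi>) \<subseteq> gfl \<Psi>"
proof -
  let ?S = "{\<Psi>. natural_spec C \<Phi> \<Psi>}"
  let ?N = "\<lparr>gob = (\<Inter>\<Psi>\<in>?S. gob \<Psi>), gfl = (\<Inter>\<Psi>\<in>?S. gfl \<Psi>)\<rparr>"
  let ?least = "\<lambda>\<Psi>. natural_spec C \<Phi> \<Psi> \<and>
    (\<forall>\<Psi>'. natural_spec C \<Phi> \<Psi>' \<longrightarrow> gob \<Psi> \<subseteq> gob \<Psi>' \<and> gfl \<Psi> \<subseteq> gfl \<Psi>')"
  let ?E = "Ob C \<times> Ob C"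
  have "natural_spec C \<Phi> \<lparr>gob = ?E, gfl = mor_plus C ?E \<times> mor_plus C ?E\<rparr>"
    unfolding natural_spec_def using gencong_total[OF category_C] equiv_rob rsimD(1,2)
    by (auto simp: equiv_def mor_plus_Cons rfl_iff)
  then have "?S \<noteq> {}" by blast
  then have "generalized_congruence C ?N"
    by (intro gencong_Inter category_C) (auto simp: natural_spec_def)
  then have "natural_spec C \<Phi> ?N" by (auto simp: natural_spec_def)
  then have N: "?least ?N" by auto
  have "\<Psi> = ?N" if "?least \<Psi>" for \<Psi>
  proof -
    have "gob \<Psi> = gob ?N" "gfl \<Psi> = gfl ?N" using that N by (meson subset_antisym)+
    then show ?thesis by (intro gencong.equality) auto
  qed
  then have "?least (natural_cong C \<Phi>)"
    unfolding natural_cong_def by (rule theI[of ?least, OF N])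
  then show "natural_spec C \<Phi> (natural_cong C \<Phi>)"
    "natural_spec C \<Phi> \<Psi> \<Longrightarrow> gob (natural_cong C \<Phi>) \<subseteq> gob \<Psi>"
    "natural_spec C \<Phi> \<Psi> \<Longrightarrow> gfl (natural_cong C \<Phi>) \<subseteq> gfl \<Psi>" by auto
qed

end

lemma riguet_cong_rc_objects: "(C, \<Phi>) \<in> rc_objects elts \<Longrightarrow> riguet_cong C \<Phi>"
  by unfold_locales (auto simp: rc_objects_def U_category_def)

lemma gen_cong_gc_objects: "(C, \<Psi>) \<in> gc_objects elts \<Longrightarrow> gen_cong C \<Psi>"
  by unfold_locales (auto simp: gc_objects_def U_category_def)

lemma natural_ob_gc_objects: "X \<in> rc_objects elts \<Longrightarrow> natural_ob X \<in> gc_objects elts"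
  using riguet_cong.natural_cong_least(1)[OF riguet_cong_rc_objects]
  by (cases X) (auto simp: natural_ob_def gc_objects_def natural_spec_def rc_objects_def)

text \<open>
  If \<open>F\<close> respects the Riguet congruences, the pullback along \<open>F\<close> of the congruence generated on its
  codomain contains the given one on its domain, hence also the congruence generated by that.
\<close>

lemma natural_gc_morphisms:
  assumes "(X, F, Y) \<in> rc_morphisms elts"
  shows "(natural_ob X, F, natural_ob Y) \<in> gc_morphisms elts"
proof -
  obtain C \<Phi> D \<Upsilon> where XY: "X = (C, \<Phi>)" "Y = (D, \<Upsilon>)" by (cases X; cases Y)
  note F = assms[unfolded XY rc_morphisms_iff]
  interpret C: riguet_cong C \<Phi> using F riguet_cong_rc_objects by blast
  interpret D: riguet_cong D \<Upsilon> using F riguet_cong_rc_objects by blast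
  note natD = D.natural_cong_least(1)[unfolded natural_spec_def]
  have "natural_spec C \<Phi> (pullback_cong F (natural_cong D \<Upsilon>))"
    unfolding natural_spec_def
  proof (intro conjI allI impI)
    show "generalized_congruence C (pullback_cong F (natural_cong D \<Upsilon>))"
      using gencong_pullback[of F] F natD by auto
    show "rob \<Phi> \<subseteq> gob (pullback_cong F (natural_cong D \<Upsilon>))"
      using F natD C.equiv_rob by (auto simp: pullback_cong_def Let_def equiv_def)
    fix a b a' b' f f' assume ff: "(f, f') \<in> rfl \<Phi> a b a' b'"
    then have "f \<in> Mor C" "f' \<in> Mor C" using C.rsimD by (auto simp: C.rfl_iff)
    moreover have "([fmor F f], [fmor F f']) \<in> gfl (natural_cong D \<Upsilon>)"
      using ff F natD by blast
    ultimately show "([f], [f']) \<in> gfl (pullback_cong F (natural_cong D \<Upsilon>))"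
      using F by (auto simp: pullback_cong_def Let_def mor_plus_Cons)
  qed
  then have "gob (natural_cong C \<Phi>) \<subseteq> gob (pullback_cong F (natural_cong D \<Upsilon>))"
    "gfl (natural_cong C \<Phi>) \<subseteq> gfl (pullback_cong F (natural_cong D \<Upsilon>))"
    by (rule C.natural_cong_least)+
  moreover have "natural_ob X \<in> gc_objects elts" "natural_ob Y \<in> gc_objects elts"
    using F XY natural_ob_gc_objects by auto
  ultimately show ?thesis
    using F unfolding XY by (auto simp: natural_ob_def gc_morphisms_iff pullback_cong_def Let_def)
qed

lemma functor_Natural: "is_functor (Natural elts)"
  unfolding Natural_def
proof (rule functor_mk_func[OF category_RCCat category_GCCat])
  fix X assume "X \<in> Ob (RCCat elts)"
  then show "natural_ob X \<in> Ob (GCCat elts)"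
    "(\<lambda>(X, F, Y). (natural_ob X, F, natural_ob Y)) (Idt (RCCat elts) X) = Idt (GCCat elts) (natural_ob X)"
    using natural_ob_gc_objects[of X]
    by (auto simp: RCCat_eq GCCat_eq) (simp_all add: natural_ob_def case_prod_beta)
next
  fix k assume "k \<in> Mor (RCCat elts)"
  then obtain X F Y where k: "k = (X, F, Y)" "(X, F, Y) \<in> rc_morphisms elts"
    by (cases k) (auto simp: RCCat_eq)
  show "(\<lambda>(X, F, Y). (natural_ob X, F, natural_ob Y)) k \<in> Mor (GCCat elts)"
    "Sc (GCCat elts) ((\<lambda>(X, F, Y). (natural_ob X, F, natural_ob Y)) k) = natural_ob (Sc (RCCat elts) k)"
    "Tg (GCCat elts) ((\<lambda>(X, F, Y). (natural_ob X, F, natural_ob Y)) k) = natural_ob (Tg (RCCat elts) k)"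
    using k natural_gc_morphisms[OF k(2)] by (simp_all add: RCCat_eq GCCat_eq)
next
  fix k l assume "k \<in> Mor (RCCat elts)" "l \<in> Mor (RCCat elts)" "Sc (RCCat elts) l = Tg (RCCat elts) k"
  then obtain X F Y G Z where *: "k = (X, F, Y)" "l = (Y, G, Z)"
    "(X, F, Y) \<in> rc_morphisms elts" "(Y, G, Z) \<in> rc_morphisms elts"
    by (cases k; cases l) (auto simp: RCCat_eq)
  then show "(\<lambda>(X, F, Y). (natural_ob X, F, natural_ob Y)) (Cmp (RCCat elts) l k) =
      Cmp (GCCat elts) ((\<lambda>(X, F, Y). (natural_ob X, F, natural_ob Y)) l)
        ((\<lambda>(X, F, Y). (natural_ob X, F, natural_ob Y)) k)"
    using natural_gc_morphisms[OF *(3)] natural_gc_morphisms[OF *(4)]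
    by (simp add: RCCat_eq GCCat_eq)
qed

section \<open>The Riguet congruence of a strong generalized congruence\<close>

text \<open>
  The lifting axiom is strength. For compatibility with composition, replace \<open>g \<circ> f\<close> by the sequence
  of \<open>f\<close> and \<open>g\<close>: sequences of related morphisms are related by concatenation.
\<close>

lemma (in gen_cong) riguet_flat_cong:
  assumes "strong C \<Psi>"
  shows "riguet_congruence C (flat_cong C \<Psi>)"
proof -
  note cat = categoryD[OF category_C]
  have cmp: "([Cmp C g f], [Cmp C g' f']) \<in> gfl \<Psi>"
    if "f \<in> Hom C a b" "f' \<in> Hom C a' b'" "g \<in> Hom C b c" "g' \<in> Hom C b' c'"
      "([f], [f']) \<in> gfl \<Psi>" "([g], [g']) \<in> gfl \<Psi>" for a b c a' b' c' f g f' g'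
  proof -
    have "([f, g], [f', g']) \<in> gfl \<Psi>"
      using gfl_append[OF that(5,6)] that(1,3) gob_refl[of b] cat(2)[of f] by (auto simp: Hom_def)
    moreover have "([f, g], [Cmp C g f]) \<in> gfl \<Psi>" "([f', g'], [Cmp C g' f']) \<in> gfl \<Psi>"
      using that by (auto simp: Hom_def intro: gfl_Cmp)
    ultimately show ?thesis using gfl_sym gfl_trans by blast
  qed
  have lift: "\<exists>f'\<in>Hom C a' b'. ([f], [f']) \<in> gfl \<Psi>"
    if "f \<in> Hom C a b" "(a, a') \<in> gob \<Psi>" "(b, b') \<in> gob \<Psi>" for a b a' b' f
    using assms that unfolding strong_def by blast
  have hom_cmp: "Cmp C g f \<in> Hom C a c" if "f \<in> Hom C a b" "g \<in> Hom C b c" for a b c f g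
    using that by (auto simp: Hom_def cat)
  have refl: "([f], [f]) \<in> gfl \<Psi>" if "f \<in> Hom C a b" for a b f
    using that gfl_refl W_singleton by (auto simp: Hom_def)
  have idt: "Idt C a \<in> Hom C a a" if "a \<in> Ob C" for a
    using that by (auto simp: Hom_def cat)
  show ?thesis
    unfolding riguet_congruence_def flat_cong_def
    using equiv_gob
    apply (intro conjI)
            apply simp
           apply force
          apply force
         apply (auto intro: idt gob_closed gob_refl gfl_Idt)[1]
        apply (auto intro: gob_refl refl)[1]
       apply (auto intro: gob_sym gfl_sym)[1]
      apply (auto intro: gob_trans gfl_trans)[1]
     apply (auto intro: cmp hom_cmp)[1]
    using lift apply fastforce
    done
qed

lemma SGCCat_simps:
  "Ob (SGCCat elts) = {(C, \<Psi>) \<in> gc_objects elts. strong C \<Psi>}"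
  "(X, F, Y) \<in> Mor (SGCCat elts) \<longleftrightarrow> (X, F, Y) \<in> gc_morphisms elts \<and>
     (\<lambda>(C, \<Psi>). strong C \<Psi>) X \<and> (\<lambda>(C, \<Psi>). strong C \<Psi>) Y"
  "(X, F, Y) \<in> Mor (SGCCat elts) \<Longrightarrow> Sc (SGCCat elts) (X, F, Y) = X"
  "(X, F, Y) \<in> Mor (SGCCat elts) \<Longrightarrow> Tg (SGCCat elts) (X, F, Y) = Y"
  "X \<in> Ob (SGCCat elts) \<Longrightarrow> Idt (SGCCat elts) X = (X, func_id (fst X), X)"
  "(X, F, Y) \<in> Mor (SGCCat elts) \<Longrightarrow> (Y, G, Z) \<in> Mor (SGCCat elts) \<Longrightarrow>
    Cmp (SGCCat elts) (Y, G, Z) (X, F, Y) = (X, func_comp G F, Z)"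
  unfolding SGCCat_def full_subcat_def GCCat_eq by (auto split: prod.splits)

lemma category_SGCCat: "category (SGCCat elts)"
  unfolding SGCCat_def by (rule category_full_subcat[OF category_GCCat])

lemma flat_ob_rc_objects: "X \<in> Ob (SGCCat elts) \<Longrightarrow> flat_ob X \<in> rc_objects elts"
  using gen_cong.riguet_flat_cong[OF gen_cong_gc_objects]
  by (cases X) (auto simp: SGCCat_simps flat_ob_def rc_objects_def gc_objects_def)

lemma flat_rc_morphisms:
  assumes "(X, F, Y) \<in> Mor (SGCCat elts)"
  shows "(flat_ob X, F, flat_ob Y) \<in> rc_morphisms elts"
proof -
  obtain C \<Psi> D \<Omega> where XY: "X = (C, \<Psi>)" "Y = (D, \<Omega>)" by (cases X; cases Y)
  have XY': "X \<in> Ob (SGCCat elts)" "Y \<in> Ob (SGCCat elts)"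
    using assms gc_morphismsD[of X F Y elts] by (auto simp: SGCCat_simps)
  have F: "(X, F, Y) \<in> gc_morphisms elts" using assms by (simp add: SGCCat_simps)
  note F' = F[unfolded XY gc_morphisms_iff]
  note Fs = functorD[of F C D]
  have hom: "fmor F f \<in> Hom D (fob F a) (fob F b)" if "f \<in> Hom C a b" for f a b
    using that F' Fs by (auto simp: Hom_def)
  have gfl: "([fmor F f], [fmor F g]) \<in> gfl \<Omega>" if "([f], [g]) \<in> gfl \<Psi>" for f g
    using that F' by force
  show ?thesis
    using F' hom gfl flat_ob_rc_objects[OF XY'(1)] flat_ob_rc_objects[OF XY'(2)]
    unfolding XY by (auto simp: flat_ob_def rc_morphisms_iff flat_cong_def)
qed

lemma functor_Flat: "is_functor (Flat elts)"
  unfolding Flat_def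
proof (rule functor_mk_func[OF category_SGCCat category_RCCat])
  fix X assume "X \<in> Ob (SGCCat elts)"
  then show "flat_ob X \<in> Ob (RCCat elts)"
    "(\<lambda>(X, F, Y). (flat_ob X, F, flat_ob Y)) (Idt (SGCCat elts) X) = Idt (RCCat elts) (flat_ob X)"
    using flat_ob_rc_objects[of X]
    by (simp_all add: RCCat_eq SGCCat_simps(5)) (simp add: flat_ob_def case_prod_beta)
next
  fix k assume "k \<in> Mor (SGCCat elts)"
  then obtain X F Y where k: "k = (X, F, Y)" "(X, F, Y) \<in> Mor (SGCCat elts)"
    by (cases k) auto
  show "(\<lambda>(X, F, Y). (flat_ob X, F, flat_ob Y)) k \<in> Mor (RCCat elts)"
    "Sc (RCCat elts) ((\<lambda>(X, F, Y). (flat_ob X, F, flat_ob Y)) k) = flat_ob (Sc (SGCCat elts) k)"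
    "Tg (RCCat elts) ((\<lambda>(X, F, Y). (flat_ob X, F, flat_ob Y)) k) = flat_ob (Tg (SGCCat elts) k)"
    using k flat_rc_morphisms[OF k(2)] by (simp_all add: RCCat_eq SGCCat_simps(3,4))
next
  fix k l assume "k \<in> Mor (SGCCat elts)" "l \<in> Mor (SGCCat elts)" "Sc (SGCCat elts) l = Tg (SGCCat elts) k"
  then obtain X F Y G Z where *: "k = (X, F, Y)" "l = (Y, G, Z)"
    "(X, F, Y) \<in> Mor (SGCCat elts)" "(Y, G, Z) \<in> Mor (SGCCat elts)"
    by (cases k; cases l) (auto simp: SGCCat_simps(3,4))
  then show "(\<lambda>(X, F, Y). (flat_ob X, F, flat_ob Y)) (Cmp (SGCCat elts) l k) =
      Cmp (RCCat elts) ((\<lambda>(X, F, Y). (flat_ob X, F, flat_ob Y)) l)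
        ((\<lambda>(X, F, Y). (flat_ob X, F, flat_ob Y)) k)"
    using flat_rc_morphisms[OF *(3)] flat_rc_morphisms[OF *(4)]
    by (simp add: RCCat_eq SGCCat_simps(6))
qed

section \<open>The projections and the comparison of the quotients\<close>

lemma sharp_eqI:
  fixes P :: "('o1, 'm1, 'o2, 'm2) func" and F :: "('o1, 'm1, 'o3, 'm3) func"
  assumes "is_functor G" "fdom G = fcod P" "fcod G = fcod F" "func_comp G P = F"
    and cancel: "\<And>H :: ('o2, 'm2, 'o3, 'm3) func. \<lbrakk>is_functor H; fdom H = fcod P; fcod H = fcod G;
      func_comp H P = func_comp G P\<rbrakk> \<Longrightarrow> H = G"
  shows "sharp P F = G"
  unfolding sharp_def
proof (rule the_equality)
  show "is_functor G \<and> fdom G = fcod P \<and> fcod G = fcod F \<and> func_comp G P = F"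
    by (intro conjI assms)
  fix H assume "is_functor H \<and> fdom H = fcod P \<and> fcod H = fcod F \<and> func_comp H P = F"
  then show "H = G" by (intro cancel) (simp_all only: assms(3,4))
qed

lemma RProj_simps [simp]: "fdom (RProj elts C \<Phi>) = C" "fcod (RProj elts C \<Phi>) = RQuot elts C \<Phi>"
  and GProj_simps [simp]: "fdom (GProj elts C \<Psi>) = C" "fcod (GProj elts C \<Psi>) = GQuot elts C \<Psi>"
  by (simp_all add: RProj_def GProj_def)

context universe
begin

lemma small_riguet_rc_objects: "(C, \<Phi>) \<in> rc_objects elts \<Longrightarrow> small_riguet elts C \<Phi>"
  by unfold_locales (auto simp: rc_objects_def U_category_def)

lemma small_gen_gc_objects: "(C, \<Psi>) \<in> gc_objects elts \<Longrightarrow> small_gen elts C \<Psi>"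
  by unfold_locales (auto simp: gc_objects_def U_category_def)

lemma RProj_Cat:
  assumes "(C, \<Phi>) \<in> rc_objects elts"
  shows "U_category elts (RQuot elts C \<Phi>)" "epi (Cat elts) (RProj elts C \<Phi>)"
proof -
  interpret small_riguet elts C \<Phi> by (rule small_riguet_rc_objects[OF assms])
  show "U_category elts (RQuot elts C \<Phi>)" by (rule U_category_RQuot)
  then have P: "RProj elts C \<Phi> \<in> Mor (Cat elts)" using functor_RProj small_C by simp
  show "epi (Cat elts) (RProj elts C \<Phi>)"
    unfolding epi_def
  proof (intro conjI ballI impI P)
    fix G H assume GH: "G \<in> Mor (Cat elts)" "H \<in> Mor (Cat elts)"
      and eq: "Sc (Cat elts) G = Tg (Cat elts) (RProj elts C \<Phi>) \<and>
        Sc (Cat elts) H = Tg (Cat elts) (RProj elts C \<Phi>) \<and>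
        Cmp (Cat elts) G (RProj elts C \<Phi>) = Cmp (Cat elts) H (RProj elts C \<Phi>)"
    then have dom: "fdom G = RQuot elts C \<Phi>" "fdom H = RQuot elts C \<Phi>"
      using P by (simp_all del: Cat_simps(2))
    have comp: "func_comp G (RProj elts C \<Phi>) = func_comp H (RProj elts C \<Phi>)"
      using eq Cat_simps(6)[OF P GH(1)] Cat_simps(6)[OF P GH(2)] dom by simp
    then have "fcod (func_comp G (RProj elts C \<Phi>)) = fcod (func_comp H (RProj elts C \<Phi>))"
      by (rule arg_cong)
    then have "fcod G = fcod H" by (simp only: func_comp_simps)
    then show "G = H" by (rule RProj_cancel[OF _ _ dom _ comp, rotated -1]) (use GH in simp_all)
  qed
qed

lemma GProj_Cat:
  assumes "(C, \<Psi>) \<in> gc_objects elts"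
  shows "U_category elts (GQuot elts C \<Psi>)" "epi (Cat elts) (GProj elts C \<Psi>)"
proof -
  interpret small_gen elts C \<Psi> by (rule small_gen_gc_objects[OF assms])
  show "U_category elts (GQuot elts C \<Psi>)" by (rule U_category_GQuot)
  then have P: "GProj elts C \<Psi> \<in> Mor (Cat elts)" using functor_GProj small_C by simp
  show "epi (Cat elts) (GProj elts C \<Psi>)"
    unfolding epi_def
  proof (intro conjI ballI impI P)
    fix G H assume GH: "G \<in> Mor (Cat elts)" "H \<in> Mor (Cat elts)"
      and eq: "Sc (Cat elts) G = Tg (Cat elts) (GProj elts C \<Psi>) \<and>
        Sc (Cat elts) H = Tg (Cat elts) (GProj elts C \<Psi>) \<and>
        Cmp (Cat elts) G (GProj elts C \<Psi>) = Cmp (Cat elts) H (GProj elts C \<Psi>)"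
    then have dom: "fdom G = GQuot elts C \<Psi>" "fdom H = GQuot elts C \<Psi>"
      using P by (simp_all del: Cat_simps(2))
    have comp: "func_comp G (GProj elts C \<Psi>) = func_comp H (GProj elts C \<Psi>)"
      using eq Cat_simps(6)[OF P GH(1)] Cat_simps(6)[OF P GH(2)] dom by simp
    then have "fcod (func_comp G (GProj elts C \<Psi>)) = fcod (func_comp H (GProj elts C \<Psi>))"
      by (rule arg_cong)
    then have "fcod G = fcod H" by (simp only: func_comp_simps)
    then show "G = H" by (rule GProj_cancel[OF _ _ dom _ comp, rotated -1]) (use GH in simp_all)
  qed
qed

text \<open>
  The composite of \<open>F\<close> with the projection of \<open>D\<close> identifies related objects and related morphisms.
\<close>

lemma RProj_lift:
  assumes "((C, \<Phi>), F, (D, \<Upsilon>)) \<in> rc_morphisms elts"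
  obtains G where "is_functor G" "fdom G = RQuot elts C \<Phi>" "fcod G = RQuot elts D \<Upsilon>"
    "func_comp G (RProj elts C \<Phi>) = func_comp (RProj elts D \<Upsilon>) F"
proof -
  note F = assms[unfolded rc_morphisms_iff]
  interpret C: small_riguet elts C \<Phi> using F small_riguet_rc_objects by blast
  interpret D: small_riguet elts D \<Upsilon> using F small_riguet_rc_objects by blast
  note Fs = functorD[of F C D]
  let ?F = "func_comp (RProj elts D \<Upsilon>) F"
  have F': "is_functor ?F" "fdom ?F = C" using F D.functor_RProj by (auto intro: functor_comp)
  have ob: "fob ?F a = fob ?F b" if "(a, b) \<in> rob \<Phi>" for a b
  proof -
    have "(fob F a, fob F b) \<in> rob \<Upsilon>" "a \<in> Ob C" "b \<in> Ob C"
      using F that C.equiv_rob by (auto simp: equiv_def)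
    then show ?thesis using F Fs by (auto simp: RProj_def D.p_eq_iff)
  qed
  have mor: "fmor ?F f = fmor ?F g" if "(f, g) \<in> C.rsim" for f g
  proof -
    have "(f, g) \<in> rfl \<Phi> (Sc C f) (Tg C f) (Sc C g) (Tg C g)" using that by (simp add: C.rfl_iff)
    then have "(fmor F f, fmor F g) \<in> rfl \<Upsilon> (fob F (Sc C f)) (fob F (Tg C f)) (fob F (Sc C g)) (fob F (Tg C g))"
      using F by blast
    then have "(fmor F f, fmor F g) \<in> D.rsim" by (simp add: D.rfl_iff)
    moreover have "f \<in> Mor C" "g \<in> Mor C" using C.rsimD[OF that] by auto
    ultimately show ?thesis using F Fs by (auto simp: RProj_def D.q_eq_iff)
  qed
  obtain G where "is_functor G" "fdom G = RQuot elts C \<Phi>" "fcod G = fcod ?F"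
    "func_comp G (RProj elts C \<Phi>) = ?F"
    by (rule C.RProj_factor[OF F' ob mor])
  then show thesis using that by simp
qed

lemma Q_R_square:
  assumes k: "((C, \<Phi>), F, (D, \<Upsilon>)) \<in> rc_morphisms elts"
  defines "G \<equiv> sharp (RProj elts C \<Phi>) (func_comp (RProj elts D \<Upsilon>) F)"
  shows "is_functor G" "fdom G = RQuot elts C \<Phi>" "fcod G = RQuot elts D \<Upsilon>"
    "func_comp G (RProj elts C \<Phi>) = func_comp (RProj elts D \<Upsilon>) F"
proof -
  interpret small_riguet elts C \<Phi> using k small_riguet_rc_objects by (simp add: rc_morphisms_iff)
  obtain H where H: "is_functor H" "fdom H = RQuot elts C \<Phi>" "fcod H = RQuot elts D \<Upsilon>"
    "func_comp H (RProj elts C \<Phi>) = func_comp (RProj elts D \<Upsilon>) F"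
    using RProj_lift[OF k] .
  have "G = H"
    unfolding G_def by (rule sharp_eqI) (use H in \<open>auto intro: RProj_cancel\<close>)
  with H show "is_functor G" "fdom G = RQuot elts C \<Phi>" "fcod G = RQuot elts D \<Upsilon>"
    "func_comp G (RProj elts C \<Phi>) = func_comp (RProj elts D \<Upsilon>) F" by simp_all
qed

lemma Q_G_square:
  assumes k: "((C, \<Psi>), F, (D, \<Omega>)) \<in> gc_morphisms elts"
  defines "G \<equiv> sharp (GProj elts C \<Psi>) (func_comp (GProj elts D \<Omega>) F)"
  shows "is_functor G" "fdom G = GQuot elts C \<Psi>" "fcod G = GQuot elts D \<Omega>"
    "func_comp G (GProj elts C \<Psi>) = func_comp (GProj elts D \<Omega>) F"
proof -
  interpret small_gen elts C \<Psi> using k small_gen_gc_objects by (simp add: gc_morphisms_iff)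
  obtain H where H: "is_functor H" "fdom H = GQuot elts C \<Psi>" "fcod H = GQuot elts D \<Omega>"
    "func_comp H (GProj elts C \<Psi>) = func_comp (GProj elts D \<Omega>) F"
    using GProj_lift[OF k] .
  have "G = H"
    unfolding G_def by (rule sharp_eqI) (use H in \<open>auto intro: GProj_cancel\<close>)
  with H show "is_functor G" "fdom G = GQuot elts C \<Psi>" "fcod G = GQuot elts D \<Omega>"
    "func_comp G (GProj elts C \<Psi>) = func_comp (GProj elts D \<Omega>) F" by simp_all
qed

definition pr_R where "pr_R = (\<lambda>X\<in>rc_objects elts. case X of (C, \<Phi>) \<Rightarrow> RProj elts C \<Phi>)"
definition pr_G where "pr_G = (\<lambda>X\<in>gc_objects elts. case X of (C, \<Psi>) \<Rightarrow> GProj elts C \<Psi>)"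

lemma functor_U_R: "is_functor (U_R elts)"
  unfolding U_R_def RCCat_eq
  by (rule functor_underlying[OF category_RCCat[unfolded RCCat_eq] _ rc_morphismsD])
    (auto simp: rc_objects_def)

lemma functor_U_G: "is_functor (U_G elts)"
  unfolding U_G_def GCCat_eq
  by (rule functor_underlying[OF category_GCCat[unfolded GCCat_eq] _ gc_morphismsD])
    (auto simp: gc_objects_def)

lemma nat_trans_pr_R: "nat_trans (U_R elts) (Q_R elts) pr_R"
proof -
  let ?P = "\<lambda>X :: 'u robj. case X of (C, \<Phi>) \<Rightarrow> RProj elts C \<Phi>"
  let ?K = "RCCat elts" and ?E = "Cat elts"
  have ob: "fob (Q_R elts) (C, \<Phi>) = RQuot elts C \<Phi>" "fob (U_R elts) (C, \<Phi>) = C"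
    if "(C, \<Phi>) \<in> rc_objects elts" for C \<Phi>
    using that by (simp_all add: Q_R_def U_R_def RCCat_eq)
  have "nat_trans (U_R elts) (Q_R elts) (\<lambda>X\<in>Ob ?K. ?P X)"
  proof (rule nat_trans_epi_components[where E = ?E])
    show "is_functor (U_R elts)" by (rule functor_U_R)
    show "fdom (U_R elts) = ?K" "fcod (U_R elts) = ?E" "fdom (Q_R elts) = ?K" "fcod (Q_R elts) = ?E"
      "fob (Q_R elts) \<in> extensional (Ob ?K)" "fmor (Q_R elts) \<in> extensional (Mor ?K)"
      by (simp_all add: U_R_def Q_R_def)
  next
    fix X assume "X \<in> Ob ?K"
    then obtain C \<Phi> where X: "X = (C, \<Phi>)" "(C, \<Phi>) \<in> rc_objects elts"
      by (cases X) (auto simp: RCCat_eq)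
    show "epi ?E (?P X)" using RProj_Cat(2)[OF X(2)] X(1) by simp
    then have "?P X \<in> Mor ?E" by (rule epiD)
    then show "Sc ?E (?P X) = fob (U_R elts) X" "Tg ?E (?P X) = fob (Q_R elts) X"
      using X ob by (simp_all del: Cat_simps(2))
  next
    fix k assume "k \<in> Mor ?K"
    then obtain C \<Phi> F D \<Upsilon> where k: "k = ((C, \<Phi>), F, (D, \<Upsilon>))"
      and rc: "((C, \<Phi>), F, (D, \<Upsilon>)) \<in> rc_morphisms elts"
      by (cases k) (auto simp: RCCat_eq)
    then have st: "Sc ?K k = (C, \<Phi>)" "Tg ?K k = (D, \<Upsilon>)" by (simp_all add: RCCat_eq)
    have U: "fmor (U_R elts) k = F" using rc by (simp add: k U_R_def RCCat_eq)
    have Q: "fmor (Q_R elts) k = sharp (RProj elts C \<Phi>) (func_comp (RProj elts D \<Upsilon>) F)"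
      using rc by (simp add: k Q_R_def RCCat_eq)
    note F = rc[unfolded rc_morphisms_iff]
    have CD: "(C, \<Phi>) \<in> rc_objects elts" "(D, \<Upsilon>) \<in> rc_objects elts" using F by auto
    note sq = Q_R_square[OF rc, folded Q]
    note P = epiD(1)[OF RProj_Cat(2)[OF CD(1)]] epiD(1)[OF RProj_Cat(2)[OF CD(2)]]
    have FM: "F \<in> Mor ?E" using F by (auto simp: rc_objects_def)
    show QM: "fmor (Q_R elts) k \<in> Mor ?E" using sq RProj_Cat(1)[OF CD(1)] RProj_Cat(1)[OF CD(2)] by simp
    then show "Sc ?E (fmor (Q_R elts) k) = fob (Q_R elts) (Sc ?K k)"
      "Tg ?E (fmor (Q_R elts) k) = fob (Q_R elts) (Tg ?K k)"
      using sq ob CD st by (simp_all del: Cat_simps(2))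
    show "Cmp ?E (fmor (Q_R elts) k) (?P (Sc ?K k)) = Cmp ?E (?P (Tg ?K k)) (fmor (U_R elts) k)"
      using sq QM P FM F by (simp add: st U del: Cat_simps(2))
  qed
  then show ?thesis by (simp add: pr_R_def RCCat_eq)
qed

lemma nat_trans_pr_G: "nat_trans (U_G elts) (Q_G elts) pr_G"
proof -
  let ?P = "\<lambda>X :: 'u gobj. case X of (C, \<Psi>) \<Rightarrow> GProj elts C \<Psi>"
  let ?K = "GCCat elts" and ?E = "Cat elts"
  have ob: "fob (Q_G elts) (C, \<Psi>) = GQuot elts C \<Psi>" "fob (U_G elts) (C, \<Psi>) = C"
    if "(C, \<Psi>) \<in> gc_objects elts" for C \<Psi>
    using that by (simp_all add: Q_G_def U_G_def GCCat_eq)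
  have "nat_trans (U_G elts) (Q_G elts) (\<lambda>X\<in>Ob ?K. ?P X)"
  proof (rule nat_trans_epi_components[where E = ?E])
    show "is_functor (U_G elts)" by (rule functor_U_G)
    show "fdom (U_G elts) = ?K" "fcod (U_G elts) = ?E" "fdom (Q_G elts) = ?K" "fcod (Q_G elts) = ?E"
      "fob (Q_G elts) \<in> extensional (Ob ?K)" "fmor (Q_G elts) \<in> extensional (Mor ?K)"
      by (simp_all add: U_G_def Q_G_def)
  next
    fix X assume "X \<in> Ob ?K"
    then obtain C \<Psi> where X: "X = (C, \<Psi>)" "(C, \<Psi>) \<in> gc_objects elts"
      by (cases X) (auto simp: GCCat_eq)
    show "epi ?E (?P X)" using GProj_Cat(2)[OF X(2)] X(1) by simp
    then have "?P X \<in> Mor ?E" by (rule epiD)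
    then show "Sc ?E (?P X) = fob (U_G elts) X" "Tg ?E (?P X) = fob (Q_G elts) X"
      using X ob by (simp_all del: Cat_simps(2))
  next
    fix k assume "k \<in> Mor ?K"
    then obtain C \<Psi> F D \<Omega> where k: "k = ((C, \<Psi>), F, (D, \<Omega>))"
      and gc: "((C, \<Psi>), F, (D, \<Omega>)) \<in> gc_morphisms elts"
      by (cases k) (auto simp: GCCat_eq)
    then have st: "Sc ?K k = (C, \<Psi>)" "Tg ?K k = (D, \<Omega>)" by (simp_all add: GCCat_eq)
    have U: "fmor (U_G elts) k = F" using gc by (simp add: k U_G_def GCCat_eq)
    have Q: "fmor (Q_G elts) k = sharp (GProj elts C \<Psi>) (func_comp (GProj elts D \<Omega>) F)"
      using gc by (simp add: k Q_G_def GCCat_eq)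
    note F = gc[unfolded gc_morphisms_iff]
    have CD: "(C, \<Psi>) \<in> gc_objects elts" "(D, \<Omega>) \<in> gc_objects elts" using F by auto
    note sq = Q_G_square[OF gc, folded Q]
    note P = epiD(1)[OF GProj_Cat(2)[OF CD(1)]] epiD(1)[OF GProj_Cat(2)[OF CD(2)]]
    have FM: "F \<in> Mor ?E" using F by (auto simp: gc_objects_def)
    show QM: "fmor (Q_G elts) k \<in> Mor ?E" using sq GProj_Cat(1)[OF CD(1)] GProj_Cat(1)[OF CD(2)] by simp
    then show "Sc ?E (fmor (Q_G elts) k) = fob (Q_G elts) (Sc ?K k)"
      "Tg ?E (fmor (Q_G elts) k) = fob (Q_G elts) (Tg ?K k)"
      using sq ob CD st by (simp_all del: Cat_simps(2))
    show "Cmp ?E (fmor (Q_G elts) k) (?P (Sc ?K k)) = Cmp ?E (?P (Tg ?K k)) (fmor (U_G elts) k)"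
      using sq QM P FM F by (simp add: st U del: Cat_simps(2))
  qed
  then show ?thesis by (simp add: pr_G_def GCCat_eq)
qed

definition pr_S where
  "pr_S = (\<lambda>X\<in>Ob (SGCCat elts). pr_G (fob (mk_func (SGCCat elts) (GCCat elts) (\<lambda>a. a) (\<lambda>f. f)) X))"

lemma nat_trans_pr_S: "nat_trans (U_S elts) (Q_S elts) pr_S"
proof -
  let ?I = "mk_func (SGCCat elts) (GCCat elts) (\<lambda>a. a) (\<lambda>f. f)"
  have "is_functor ?I" unfolding SGCCat_def by (rule functor_inclusion[OF category_GCCat])
  then have "nat_trans (func_comp (U_G elts) ?I) (func_comp (Q_G elts) ?I)
      (\<lambda>X\<in>Ob (fdom ?I). pr_G (fob ?I X))"
    by (rule nat_trans_whisker[OF nat_trans_pr_G]) (simp add: U_G_def)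
  moreover have "fdom (U_G elts) = GCCat elts" "fdom (Q_G elts) = GCCat elts"
    by (simp_all add: U_G_def Q_G_def)
  ultimately show ?thesis
    by (simp add: U_S_def Q_S_def pr_S_def func_restrict_eq_comp)
qed

text \<open>
  The generated congruence contains \<open>\<Phi>\<close>, so the projection to its quotient identifies
  \<open>\<Phi>\<close>-related objects and morphisms.
\<close>

lemma GProj_natural_factor:
  assumes "(C, \<Phi>) \<in> rc_objects elts"
  obtains G where "is_functor G" "fdom G = RQuot elts C \<Phi>"
    "fcod G = GQuot elts C (natural_cong C \<Phi>)"
    "func_comp G (RProj elts C \<Phi>) = GProj elts C (natural_cong C \<Phi>)"
proof -
  interpret R: small_riguet elts C \<Phi> by (rule small_riguet_rc_objects[OF assms])
  have "(C, natural_cong C \<Phi>) \<in> gc_objects elts"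
    using natural_ob_gc_objects[OF assms] by (simp add: natural_ob_def)
  then interpret G: small_gen elts C "natural_cong C \<Phi>" by (rule small_gen_gc_objects)
  note nat = R.natural_cong_least(1)[unfolded natural_spec_def]
  have fl: "([f], [g]) \<in> gfl (natural_cong C \<Phi>)" if "(f, g) \<in> R.rsim" for f g
    using that nat unfolding R.rsim_def by blast
  show thesis
  proof (rule R.RProj_factor[OF G.functor_GProj GProj_simps(1)])
    show "fob (GProj elts C (natural_cong C \<Phi>)) a = fob (GProj elts C (natural_cong C \<Phi>)) b"
      if "(a, b) \<in> rob \<Phi>" for a b
    proof -
      have "(a, b) \<in> gob (natural_cong C \<Phi>)" using that nat by blast
      then show ?thesis using G.gob_closed by (simp add: GProj_def G.p_eq_iff)
    qed
    show "fmor (GProj elts C (natural_cong C \<Phi>)) f = fmor (GProj elts C (natural_cong C \<Phi>)) g"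
      if "(f, g) \<in> R.rsim" for f g
      using fl[OF that] R.rsimD(1,2)[OF that] by (simp add: GProj_def G.q_eq_iff G.W_singleton)
  qed (use that in simp)
qed

text \<open>
  Morphisms related by \<open>flat_cong C \<Psi>\<close> are related as sequences of length one, so the projection to the
  quotient by \<open>\<Psi>\<close> identifies them.
\<close>

lemma GProj_flat_factor:
  assumes "(C, \<Psi>) \<in> Ob (SGCCat elts)"
  obtains G where "is_functor G" "fdom G = RQuot elts C (flat_cong C \<Psi>)" "fcod G = GQuot elts C \<Psi>"
    "func_comp G (RProj elts C (flat_cong C \<Psi>)) = GProj elts C \<Psi>"
proof -
  have "(C, flat_cong C \<Psi>) \<in> rc_objects elts"
    using flat_ob_rc_objects[OF assms] by (simp add: flat_ob_def)
  then interpret R: small_riguet elts C "flat_cong C \<Psi>" by (rule small_riguet_rc_objects)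
  interpret G: small_gen elts C \<Psi>
    by (rule small_gen_gc_objects) (use assms in \<open>simp add: SGCCat_simps\<close>)
  show thesis
  proof (rule R.RProj_factor[OF G.functor_GProj GProj_simps(1)])
    show "fob (GProj elts C \<Psi>) a = fob (GProj elts C \<Psi>) b" if "(a, b) \<in> rob (flat_cong C \<Psi>)" for a b
    proof -
      have "(a, b) \<in> gob \<Psi>" using that by (simp add: flat_cong_def)
      then show ?thesis using G.gob_closed by (simp add: GProj_def G.p_eq_iff)
    qed
    show "fmor (GProj elts C \<Psi>) f = fmor (GProj elts C \<Psi>) g" if "(f, g) \<in> R.rsim" for f g
    proof -
      have "([f], [g]) \<in> gfl \<Psi>" using that unfolding R.rsim_def by (auto simp: flat_cong_def)
      then show ?thesis using R.rsimD(1,2)[OF that] by (simp add: GProj_def G.q_eq_iff G.W_singleton)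
    qed
  qed (use that in simp)
qed

lemma nat_trans_RQuot_natural: "\<exists>\<alpha>. nat_trans (Q_R elts) (func_comp (Q_G elts) (Natural elts)) \<alpha>"
proof -
  have dom [simp]: "fdom (Natural elts) = RCCat elts" "fcod (Natural elts) = GCCat elts"
    "fdom (U_G elts) = GCCat elts" "fcod (U_G elts) = Cat elts" "fcod (U_R elts) = Cat elts"
    "fdom (U_R elts) = RCCat elts"
    by (simp_all add: Natural_def U_G_def U_R_def)
  have U: "func_comp (U_G elts) (Natural elts) = U_R elts"
  proof (rule functor_eqI)
    show "is_functor (func_comp (U_G elts) (Natural elts))"
      by (rule functor_comp[OF functor_Natural functor_U_G]) simp
    show "is_functor (U_R elts)" by (rule functor_U_R)
  next
    fix X assume "X \<in> Ob (fdom (U_R elts))"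
    then show "fob (func_comp (U_G elts) (Natural elts)) X = fob (U_R elts) X"
      using natural_ob_gc_objects[of X]
      by (cases X) (simp add: U_G_def U_R_def Natural_def RCCat_eq GCCat_eq, simp add: natural_ob_def)
  next
    fix k assume "k \<in> Mor (fdom (U_R elts))"
    then obtain X F Y where k: "k = (X, F, Y)" "(X, F, Y) \<in> rc_morphisms elts"
      by (cases k) (auto simp: RCCat_eq)
    then show "fmor (func_comp (U_G elts) (Natural elts)) k = fmor (U_R elts) k"
      using natural_gc_morphisms[OF k(2)]
      by (simp add: U_G_def U_R_def Natural_def RCCat_eq GCCat_eq)
  qed simp_all
  let ?\<pi> = "\<lambda>X\<in>Ob (fdom (Natural elts)). pr_G (fob (Natural elts) X)"
  have "nat_trans (func_comp (U_G elts) (Natural elts)) (func_comp (Q_G elts) (Natural elts)) ?\<pi>"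
    by (rule nat_trans_whisker[OF nat_trans_pr_G functor_Natural]) simp
  then have "nat_trans (U_R elts) (func_comp (Q_G elts) (Natural elts)) ?\<pi>" by (simp only: U)
  then show ?thesis
  proof (rule nat_trans_factor[OF nat_trans_pr_R])
    fix X assume "X \<in> Ob (fdom (U_R elts))"
    then obtain C \<Phi> where X: "X = (C, \<Phi>)" "(C, \<Phi>) \<in> rc_objects elts"
      by (cases X) (simp add: RCCat_eq)
    have gc: "(C, natural_cong C \<Phi>) \<in> gc_objects elts"
      using natural_ob_gc_objects[OF X(2)] by (simp add: natural_ob_def)
    show "epi (fcod (U_R elts)) (pr_R X)"
      using RProj_Cat(2)[OF X(2)] X by (simp add: pr_R_def)
    obtain G where G: "is_functor G" "fdom G = RQuot elts C \<Phi>"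
      "fcod G = GQuot elts C (natural_cong C \<Phi>)"
      "func_comp G (RProj elts C \<Phi>) = GProj elts C (natural_cong C \<Phi>)"
      using GProj_natural_factor[OF X(2)] .
    have GM: "G \<in> Mor (Cat elts)" using G RProj_Cat(1)[OF X(2)] GProj_Cat(1)[OF gc] by simp
    have "fob (Q_R elts) X = RQuot elts C \<Phi>"
      "fob (func_comp (Q_G elts) (Natural elts)) X = GQuot elts C (natural_cong C \<Phi>)"
      using X gc by (simp_all add: Q_R_def Q_G_def Natural_def RCCat_eq GCCat_eq natural_ob_def)
    moreover have "?\<pi> X = GProj elts C (natural_cong C \<Phi>)"
      using X gc by (simp add: pr_G_def Natural_def RCCat_eq natural_ob_def)
    moreover have "pr_R X = RProj elts C \<Phi>" using X by (simp add: pr_R_def)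
    ultimately show "\<exists>g\<in>Hom (fcod (U_R elts)) (fob (Q_R elts) X) (fob (func_comp (Q_G elts) (Natural elts)) X).
        Cmp (fcod (U_R elts)) g (pr_R X) = ?\<pi> X"
      using G GM epiD(1)[OF RProj_Cat(2)[OF X(2)]]
      by (intro bexI[of _ G]) (simp_all add: Hom_def del: Cat_simps(2))
  qed
qed

lemma nat_trans_flat_GQuot: "\<exists>\<beta>. nat_trans (func_comp (Q_R elts) (Flat elts)) (Q_S elts) \<beta>"
proof -
  have dom [simp]: "fdom (Flat elts) = SGCCat elts" "fcod (Flat elts) = RCCat elts"
    "fdom (U_S elts) = SGCCat elts" "fcod (U_S elts) = Cat elts" "fcod (U_R elts) = Cat elts"
    "fdom (U_R elts) = RCCat elts"
    by (simp_all add: Flat_def U_S_def U_R_def U_G_def func_restrict_def)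
  have gcM: "k \<in> gc_morphisms elts" if "k \<in> Mor (SGCCat elts)" for k
    using that by (cases k) (simp add: SGCCat_simps)
  have gcO: "X \<in> gc_objects elts" if "X \<in> Ob (SGCCat elts)" for X
    using that by (cases X) (simp add: SGCCat_simps)
  have U: "func_comp (U_R elts) (Flat elts) = U_S elts"
  proof (rule functor_eqI)
    show "is_functor (func_comp (U_R elts) (Flat elts))"
      by (rule functor_comp[OF functor_Flat functor_U_R]) simp
    show "is_functor (U_S elts)" by (rule nat_transD(1)[OF nat_trans_pr_S])
  next
    fix X assume "X \<in> Ob (fdom (U_S elts))"
    then have X: "X \<in> Ob (SGCCat elts)" by simp
    show "fob (func_comp (U_R elts) (Flat elts)) X = fob (U_S elts) X"
      using X flat_ob_rc_objects[OF X] gcO[OF X]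
      by (cases X) (simp add: U_G_def U_R_def U_S_def func_restrict_def Flat_def RCCat_eq GCCat_eq,
          simp add: flat_ob_def)
  next
    fix k assume "k \<in> Mor (fdom (U_S elts))"
    then obtain X F Y where k: "k = (X, F, Y)" "(X, F, Y) \<in> Mor (SGCCat elts)" by (cases k) auto
    then show "fmor (func_comp (U_R elts) (Flat elts)) k = fmor (U_S elts) k"
      using flat_rc_morphisms[OF k(2)] gcM[OF k(2)]
      by (simp add: U_G_def U_R_def U_S_def func_restrict_def Flat_def RCCat_eq GCCat_eq)
  qed simp_all
  let ?\<pi> = "\<lambda>X\<in>Ob (fdom (Flat elts)). pr_R (fob (Flat elts) X)"
  have "nat_trans (func_comp (U_R elts) (Flat elts)) (func_comp (Q_R elts) (Flat elts)) ?\<pi>"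
    by (rule nat_trans_whisker[OF nat_trans_pr_R functor_Flat]) simp
  then have "nat_trans (U_S elts) (func_comp (Q_R elts) (Flat elts)) ?\<pi>" by (simp only: U)
  then show ?thesis
  proof (rule nat_trans_factor[OF _ nat_trans_pr_S])
    fix X assume "X \<in> Ob (fdom (U_S elts))"
    then obtain C \<Psi> where X: "X = (C, \<Psi>)" "(C, \<Psi>) \<in> Ob (SGCCat elts)"
      by (cases X) simp
    have rc: "(C, flat_cong C \<Psi>) \<in> rc_objects elts"
      using flat_ob_rc_objects[OF X(2)] by (simp add: flat_ob_def)
    have \<pi>: "?\<pi> X = RProj elts C (flat_cong C \<Psi>)"
      using X rc by (simp add: pr_R_def Flat_def flat_ob_def)
    show "epi (fcod (U_S elts)) (?\<pi> X)"
      unfolding \<pi> using RProj_Cat(2)[OF rc] by simp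
    obtain G where G: "is_functor G" "fdom G = RQuot elts C (flat_cong C \<Psi>)"
      "fcod G = GQuot elts C \<Psi>" "func_comp G (RProj elts C (flat_cong C \<Psi>)) = GProj elts C \<Psi>"
      using GProj_flat_factor[OF X(2)] .
    have GM: "G \<in> Mor (Cat elts)" using G RProj_Cat(1)[OF rc] GProj_Cat(1)[OF gcO[OF X(2)]] by simp
    have "fob (Q_S elts) X = GQuot elts C \<Psi>"
      "fob (func_comp (Q_R elts) (Flat elts)) X = RQuot elts C (flat_cong C \<Psi>)"
      using X rc gcO[OF X(2)]
      by (simp_all add: Q_R_def Q_S_def Q_G_def func_restrict_def Flat_def RCCat_eq GCCat_eq flat_ob_def)
    moreover have "pr_S X = GProj elts C \<Psi>"
      using X gcO[OF X(2)] by (simp add: pr_S_def pr_G_def)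
    ultimately show "\<exists>g\<in>Hom (fcod (U_S elts)) (fob (func_comp (Q_R elts) (Flat elts)) X) (fob (Q_S elts) X).
        Cmp (fcod (U_S elts)) g (?\<pi> X) = pr_S X"
      unfolding \<pi> using G GM epiD(1)[OF RProj_Cat(2)[OF rc]]
      by (intro bexI[of _ G]) (simp_all add: Hom_def del: Cat_simps(2))
  qed
qed

end

theorem proposition2p48:
  fixes elts :: "'u \<Rightarrow> 'u set"
  assumes "grothendieck_universe elts"
  shows "(\<exists>pr_R. nat_trans (U_R elts) (Q_R elts) pr_R) \<and>
         (\<exists>pr_G. nat_trans (U_G elts) (Q_G elts) pr_G) \<and>
         (\<exists>pr_S. nat_trans (U_S elts) (Q_S elts) pr_S) \<and>
         (\<exists>\<alpha>. nat_trans (Q_R elts) (func_comp (Q_G elts) (Natural elts)) \<alpha>) \<and>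
         (\<exists>\<beta>. nat_trans (func_comp (Q_R elts) (Flat elts)) (Q_S elts) \<beta>)"
proof -
  interpret universe elts by (rule universe.intro[OF assms])
  show ?thesis
    using nat_trans_pr_R nat_trans_pr_G nat_trans_pr_S nat_trans_RQuot_natural nat_trans_flat_GQuot
    by blast
qed

end
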